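(* Let $s(n,\# S_\ell,P_k)$ denote the $S_\ell$-score of the $P_k$-saturation game on $n$ vertices under optimal play (the statements below hold both when Max starts and when Mini starts). Then: (1) If $k\ge 7$, then for every $\ell\ge 3$ we have $s(n,\# S_\ell,P_k)=\Theta(n^{\ell-1})$ (the implied constants may depend on $k$ and $\ell$). (2) $s(n,\# S_3,P_4)=n-o(n)$, and $s(n,\# S_\ell,P_4)=0$ for all $\ell\ge 4$. (3) $s(n,\# S_3,P_5)=3n-o(n)$, $s(n,\# S_4,P_5)=n-o(n)$, $s(n,\# S_5,P_5)\le 1$, and $s(n,\# S_\ell,P_5)=0$ for all $\ell\ge 6$.
   Context: For graphs $F$ and $H$, the $F$-saturation game on $n$ vertices is played by two players, Max and Mini, who alternately claim previously unclaimed edges of the complete graph $K_n$, subject to the rule that the graph $G$ of all claimed edges must remain $F$-free (contain no subgraph isomorphic to $F$). The game ends when no further edge can be claimed, i.e. when $G$ is $F$-saturated. The $H$-score of the game is the number of (not necessarily induced) subgraphs of the final graph $G$ isomorphic to $H$. Max aims to maximize and Mini to minimize the $H$-score; $s_1(n,\# H,F)$ is the score under optimal play when Max starts, $s_2(n,\# H,F)$ when Mini starts, and $s(n,\# H,F)$ is used for a statement valid for both. $P_k$ denotes the path on $k$ vertices and $S_\ell$ the star on $\ell$ vertices (one center joined to $\ell-1$ leaves). *)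

theory Defs
  imports "HOL-Library.Landau_Symbols"
begin

text \<open>A graph is a pair of a vertex set and a set of edges, each edge being a two-element set of
  vertices.\<close>

type_synonym 'a graph = "'a set \<times> 'a set set"

abbreviation verts :: "'a graph \<Rightarrow> 'a set" where
  "verts G \<equiv> fst G"

abbreviation edges :: "'a graph \<Rightarrow> 'a set set" where
  "edges G \<equiv> snd G"

definition all_edges :: "'a set \<Rightarrow> 'a set set" where
  "all_edges V = {{u, v} | u v. u \<in> V \<and> v \<in> V \<and> u \<noteq> v}"

definition simple_graph :: "'a graph \<Rightarrow> bool" where
  "simple_graph G \<longleftrightarrow> edges G \<subseteq> all_edges (verts G)"

definition is_subgraph :: "'a graph \<Rightarrow> 'a graph \<Rightarrow> bool" where
  "is_subgraph S G \<longleftrightarrow> simple_graph S \<and> verts S \<subseteq> verts G \<and> edges S \<subseteq> edges G"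

definition graph_iso :: "'a graph \<Rightarrow> 'b graph \<Rightarrow> bool" where
  "graph_iso G H \<longleftrightarrow>
     (\<exists>f. bij_betw f (verts G) (verts H) \<and> (\<lambda>e. f ` e) ` edges G = edges H)"

definition copies :: "'b graph \<Rightarrow> 'a graph \<Rightarrow> 'a graph set" where
  "copies H G = {S. is_subgraph S G \<and> graph_iso S H}"

definition graph_free :: "'b graph \<Rightarrow> 'a graph \<Rightarrow> bool" where
  "graph_free F G \<longleftrightarrow> copies F G = {}"

text \<open>Both graphs are indexed by their number of vertices; the centre of the star is \<open>0\<close>.\<close>

definition path_graph :: "nat \<Rightarrow> nat graph" where
  "path_graph k = ({..<k}, {{i, Suc i} | i. Suc i < k})"

definition star_graph :: "nat \<Rightarrow> nat graph" where
  "star_graph l = ({..<l}, {{0, i} | i. 0 < i \<and> i < l})"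

datatype player = Max_player | Mini_player

fun opponent :: "player \<Rightarrow> player" where
  "opponent Max_player = Mini_player"
| "opponent Mini_player = Max_player"

definition legal_moves :: "nat graph \<Rightarrow> nat \<Rightarrow> nat set set \<Rightarrow> nat set set" where
  "legal_moves F n E =
     {e \<in> all_edges {..<n} - E. graph_free F ({..<n}, insert e E)}"

lemma finite_all_edges: "finite V \<Longrightarrow> finite (all_edges V)"
  by (rule finite_subset[of _ "Pow V"]) (auto simp: all_edges_def)

lemma card_unclaimed_less:
  assumes "e \<in> legal_moves F n E"
  shows "card (all_edges {..<n} - insert e E) < card (all_edges {..<n} - E)"
  using assms by (intro psubset_card_mono) (auto simp: legal_moves_def finite_all_edges)

text \<open>\<open>game_value F H n p E\<close> is the \<open>H\<close>-score of the final graph when the \<open>F\<close>-saturation game on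
  the vertices \<open>0, \<dots>, n - 1\<close> is continued optimally from the set \<open>E\<close> of claimed edges with
  player \<open>p\<close> to move.\<close>

function game_value ::
  "nat graph \<Rightarrow> nat graph \<Rightarrow> nat \<Rightarrow> player \<Rightarrow> nat set set \<Rightarrow> nat" where
  "game_value F H n p E =
     (if legal_moves F n E = {} then card (copies H ({..<n}, E))
      else (case p of
        Max_player \<Rightarrow>
          Max ((\<lambda>e. game_value F H n (opponent p) (insert e E)) ` legal_moves F n E)
      | Mini_player \<Rightarrow>
          Min ((\<lambda>e. game_value F H n (opponent p) (insert e E)) ` legal_moves F n E)))"
  by pat_completeness auto
termination
  by (relation "measure (\<lambda>(F, H, n, p, E). card (all_edges {..<n} - E))")
     (simp_all add: card_unclaimed_less del: Diff_insert)

declare game_value.simps [simp del]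

definition sat_score :: "player \<Rightarrow> nat \<Rightarrow> nat graph \<Rightarrow> nat graph \<Rightarrow> nat" where
  "sat_score first n H F = game_value F H n first {}"

end

theory Submission
  imports Defs "HOL-Library.Disjoint_Sets"
begin

text \<open>
  For \<open>l \<ge> 3\<close> the score is \<open>\<Sum>v. deg v choose (l - 1)\<close>, so only degrees matter.

  If it is Max's turn and some vertex \<open>v\<close> has two arms in different components of \<open>G - v\<close>, then Max
  can attach isolated components to \<open>v\<close> for the rest of the game: a longest path through the new
  component can be rerouted through an arm, so the move is legal, and Mini's next edge can merge only
  two of the three arms.  Hence, as long as small components abound, Mini must at once repair every
  cut vertex that Max creates.

  For \<open>k \<ge> 7\<close> Max uses this to build some triangles and a clique on \<open>k - 4\<close> vertices, and then only plays
  isolated edges.  Once the isolated vertices have run out Mini has no waiting move; the parity can be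
  corrected by Max by joining two triangles, or a vertex to a triangle.  When Mini joins two
  components, Max gets a cut vertex with arms on two vertices, possibly after attaching one of the
  prepared cliques, and thus a vertex of linear degree.  The upper bound holds since \<open>P\<^sub>k\<close>-free graphs
  have linearly many edges.

  For \<open>k \<in> {4, 5}\<close> the same threat lets Max build cliques on \<open>k - 1\<close> vertices one after the other, while
  Mini, by closing Hamiltonian cycles, keeps all components but one on fewer than \<open>k\<close> vertices.
\<close>

text \<open>A component on \<open>j\<close> vertices can be attached at \<open>v\<close> if
  \<open>v\<close> has two separated arms on \<open>j\<close> vertices. While isolated vertices
  abound, \<open>j = 1\<close> suffices, and every join other than that of two isolated vertices
  creates a cut vertex. Later only isolated edges remain, so \<open>j = 2\<close>, and some joins
  fall short because one arm has a single vertex: a vertex hung on an edge, which Max completes to a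
  triangle, two edges joined to a path, and a vertex hung on a clique. In the last two cases Max
  joins a clique \<open>B\<close> to the vertex with the short arm. If \<open>X\<close> is the side
  of the long arm, only an edge between \<open>X\<close> and \<open>B\<close> could spoil this, and
  such an edge leaves another cut vertex or closes a path on \<open>k\<close> vertices provided that
  \<open>|X| + |B| + 2 = k\<close>. For two edges \<open>|X| = 2\<close>, whence the clique on
  \<open>k - 4\<close> vertices. The same size serves a vertex hung on a triangle, and a triangle
  serves a vertex hung on that clique. \<open>B\<close> has to contain an arm on two vertices beyond
  its contact vertex, so \<open>k - 4 \<ge> 3\<close>.

  For \<open>k \<le> 5\<close> the threat is real since a vertex of degree \<open>d\<close> yields
  \<open>d choose (l - 1)\<close> stars, more than the linear loss from the vertices not yet placed
  in cliques.\<close>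

lemma all_edges_pair [simp]: "{u, v} \<in> all_edges V \<longleftrightarrow> u \<in> V \<and> v \<in> V \<and> u \<noteq> v"
  by (auto simp: all_edges_def doubleton_eq_iff)

lemma all_edgesE:
  assumes "e \<in> all_edges V"
  obtains u v where "e = {u, v}" "u \<in> V" "v \<in> V" "u \<noteq> v"
  using assms by (auto simp: all_edges_def)

lemma all_edges_mono: "U \<subseteq> V \<Longrightarrow> all_edges U \<subseteq> all_edges V"
  by (auto simp: all_edges_def)

section \<open>Paths\<close>

text \<open>A path is the list of its vertices. No vertex set is mentioned, so a list with at most
  one element is a path whatever the edges are.\<close>

definition ispath :: "'a set set \<Rightarrow> 'a list \<Rightarrow> bool" where
  "ispath E xs \<longleftrightarrow> distinct xs \<and> successively (\<lambda>x y. {x, y} \<in> E) xs"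

definition pfree :: "nat \<Rightarrow> 'a set set \<Rightarrow> bool" where
  "pfree k E \<longleftrightarrow> (\<forall>xs. ispath E xs \<longrightarrow> length xs < k)"

lemma ispath_Nil [simp]: "ispath E []"
  by (simp add: ispath_def)

lemma ispath_single [simp]: "ispath E [x]"
  by (simp add: ispath_def)

lemma ispath_append:
  "ispath E (xs @ ys) \<longleftrightarrow> ispath E xs \<and> ispath E ys \<and> set xs \<inter> set ys = {} \<and>
     (xs \<noteq> [] \<longrightarrow> ys \<noteq> [] \<longrightarrow> {last xs, hd ys} \<in> E)"
  by (auto simp: ispath_def successively_append_iff)

lemma ispath_Cons:
  "ispath E (x # xs) \<longleftrightarrow> x \<notin> set xs \<and> ispath E xs \<and> (xs \<noteq> [] \<longrightarrow> {x, hd xs} \<in> E)"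
  using ispath_append[of E "[x]" xs] by auto

lemma ispath_rev [simp]: "ispath E (rev xs) \<longleftrightarrow> ispath E xs"
  by (simp add: ispath_def insert_commute)

lemma ispath_mono: "ispath E xs \<Longrightarrow> E \<subseteq> E' \<Longrightarrow> ispath E' xs"
  unfolding ispath_def by (auto elim: successively_mono)

lemma ispath_take: "ispath E xs \<Longrightarrow> ispath E (take i xs)"
  by (metis append_take_drop_id ispath_append)

lemma ispath_insert_notin:
  assumes "ispath (insert {u, v} E) xs" "u \<notin> set xs \<or> v \<notin> set xs"
  shows "ispath E xs"
  unfolding ispath_def
proof
  show "successively (\<lambda>x y. {x, y} \<in> E) xs"
    using assms(1) unfolding ispath_def
    by (rule successively_mono[OF conjunct2]) (use assms(2) in \<open>auto simp: doubleton_eq_iff\<close>)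
qed (use assms(1) in \<open>simp add: ispath_def\<close>)

text \<open>The vertices of a path are distinct, so it uses the new edge in at most one place, and
  each half contains only one end of that edge.\<close>

lemma ispath_insertE:
  assumes "ispath (insert {u, v} E) zs" "\<not> ispath E zs"
  obtains P x y Q where "{x, y} = {u, v}" "zs = P @ x # y # Q"
    "ispath E (P @ [x])" "ispath E (y # Q)"
proof -
  have d: "distinct zs" using assms(1) by (simp add: ispath_def)
  then obtain i where i: "Suc i < length zs" "{zs ! i, zs ! Suc i} \<notin> E"
    using assms(2) by (auto simp: ispath_def successively_conv_nth)
  with assms(1) have e: "{zs ! i, zs ! Suc i} = {u, v}"
    by (auto simp: ispath_def successively_conv_nth)
  define P Q where "P = take i zs" and "Q = drop (Suc (Suc i)) zs"
  have zs: "zs = P @ zs ! i # zs ! Suc i # Q"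
    using i(1) by (simp add: P_def Q_def Cons_nth_drop_Suc)
  have p: "ispath (insert {u, v} E) ((P @ [zs ! i]) @ (zs ! Suc i # Q))"
    using assms(1) zs by simp
  then have 1: "ispath (insert {u, v} E) (P @ [zs ! i])" "ispath (insert {u, v} E) (zs ! Suc i # Q)"
    using ispath_append by blast+
  have "set (P @ [zs ! i]) \<inter> set (zs ! Suc i # Q) = {}"
    using p unfolding ispath_append[of _ "P @ [zs ! i]"] by blast
  then have "zs ! Suc i \<notin> set (P @ [zs ! i])" "zs ! i \<notin> set (zs ! Suc i # Q)"
    by auto
  with e 1 have "ispath E (P @ [zs ! i])" "ispath E (zs ! Suc i # Q)"
    by (auto intro!: ispath_insert_notin[of u v] simp: doubleton_eq_iff)
  with e zs that show thesis by blast
qed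

lemma ispath_subset:
  assumes "ispath E xs" "2 \<le> length xs" "E \<subseteq> all_edges V"
  shows "set xs \<subseteq> V"
proof
  fix x assume "x \<in> set xs"
  then obtain i where i: "i < length xs" "x = xs ! i" by (auto simp: in_set_conv_nth)
  have s: "\<And>i. Suc i < length xs \<Longrightarrow> {xs ! i, xs ! Suc i} \<in> all_edges V"
    using assms(1,3) unfolding ispath_def successively_conv_nth by blast
  show "x \<in> V"
  proof (cases "Suc i < length xs")
    case True then show ?thesis using s[of i] i by simp
  next
    case False
    then obtain j where "i = Suc j" using i assms(2) by (cases i) auto
    then show ?thesis using s[of j] i by simp
  qed
qed

lemma pfree_alt: "pfree k E \<longleftrightarrow> (\<forall>xs. ispath E xs \<longrightarrow> length xs \<noteq> k)"
proof
  assume r: "\<forall>xs. ispath E xs \<longrightarrow> length xs \<noteq> k"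
  show "pfree k E" unfolding pfree_def
  proof (intro allI impI, rule ccontr)
    fix xs assume xs: "ispath E xs" "\<not> length xs < k"
    then have "ispath E (take k xs)" "length (take k xs) = k" by (auto intro: ispath_take)
    with r show False by blast
  qed
qed (auto simp: pfree_def)

lemma pfreeD: "pfree k E \<Longrightarrow> ispath E xs \<Longrightarrow> length xs < k"
  by (simp add: pfree_def)

text \<open>Only a path through the new edge has to be bounded, and after reversal it runs from
  \<open>c\<close> to \<open>v\<close>.\<close>

lemma pfree_insertI:
  assumes "pfree k E"
    and main: "\<And>P Q. ispath E (P @ [c]) \<Longrightarrow> ispath E (v # Q) \<Longrightarrow> length (P @ c # v # Q) < k"
  shows "pfree k (insert {v, c} E)"
  unfolding pfree_def
proof (intro allI impI)
  fix zs assume zs: "ispath (insert {v, c} E) zs"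
  show "length zs < k"
  proof (cases "ispath E zs")
    case True then show ?thesis by (rule pfreeD[OF assms(1)])
  next
    case False
    from ispath_insertE[OF zs this] obtain P x y Q where
      xy: "{x, y} = {v, c}" and z: "zs = P @ x # y # Q" "ispath E (P @ [x])" "ispath E (y # Q)" .
    consider "x = c" "y = v" | "x = v" "y = c" using xy unfolding doubleton_eq_iff by blast
    then show ?thesis
    proof cases
      case 1
      then show ?thesis using z main by simp
    next
      case 2
      then have "ispath E (rev Q @ [c])" "ispath E (v # rev P)"
        using z ispath_rev[of E "y # Q"] ispath_rev[of E "P @ [x]"] by simp_all
      from main[OF this] show ?thesis using z by simp
    qed
  qed
qed

text \<open>\<open>2 \<le> k\<close> ensures that a list of length \<open>k\<close> contains an edge
  at each of its vertices, and therefore lies in \<open>V\<close>.\<close>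

lemma graph_free_path:
  assumes k: "2 \<le> k" and E: "E \<subseteq> all_edges V"
  shows "graph_free (path_graph k) (V, E) \<longleftrightarrow> pfree k E"
proof
  assume free: "graph_free (path_graph k) (V, E)"
  show "pfree k E" unfolding pfree_alt
  proof (intro allI impI notI)
    fix xs assume xs: "ispath E xs" "length xs = k"
    define S where "S = (set xs, {{xs ! i, xs ! Suc i} | i. Suc i < k})"
    have d: "distinct xs" and s: "\<And>i. Suc i < k \<Longrightarrow> {xs ! i, xs ! Suc i} \<in> E"
      using xs by (auto simp: ispath_def successively_conv_nth)
    have "simple_graph S"
      using xs d by (auto simp: simple_graph_def S_def nth_eq_iff_index_eq)
    then have "is_subgraph S (V, E)"
      using ispath_subset[OF xs(1) _ E] xs k s by (auto simp: is_subgraph_def S_def)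
    moreover have "graph_iso (path_graph k) S"
    proof -
      have "bij_betw (\<lambda>i. xs ! i) {..<k} (set xs)"
        using bij_betw_nth[OF d] xs by auto
      moreover have "(\<lambda>e. (\<lambda>i. xs ! i) ` e) ` edges (path_graph k) = edges S"
        by (auto simp: path_graph_def S_def image_iff) (metis image_insert image_empty)
      ultimately show ?thesis by (auto simp: graph_iso_def path_graph_def S_def)
    qed
    then obtain f where f: "bij_betw f {..<k} (set xs)"
      "(\<lambda>e. f ` e) ` edges (path_graph k) = edges S"
      by (auto simp: graph_iso_def path_graph_def S_def)
    have "graph_iso S (path_graph k)"
    proof -
      let ?g = "inv_into {..<k} f"
      have g: "?g ` f ` e = e" if "e \<subseteq> {..<k}" for e
        using that f(1) by (simp add: bij_betw_def)
      have sub: "e \<subseteq> {..<k}" if "e \<in> edges (path_graph k)" for e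
        using that by (auto simp: path_graph_def)
      have "(\<lambda>e. ?g ` e) ` edges S = (\<lambda>e. ?g ` f ` e) ` edges (path_graph k)"
        unfolding f(2)[symmetric] by (simp add: image_image)
      also have "\<dots> = (\<lambda>e. e) ` edges (path_graph k)"
        using g sub by (intro image_cong) auto
      finally show ?thesis
        using bij_betw_inv_into[OF f(1)] by (auto simp: graph_iso_def path_graph_def S_def)
    qed
    ultimately have "S \<in> copies (path_graph k) (V, E)" by (simp add: copies_def)
    with free show False unfolding graph_free_def by blast
  qed
next
  assume pf: "pfree k E"
  show "graph_free (path_graph k) (V, E)" unfolding graph_free_def
  proof (rule ccontr)
    assume "copies (path_graph k) (V, E) \<noteq> {}"
    then obtain S f where S: "is_subgraph S (V, E)" and f: "bij_betw f (verts S) {..<k}"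
      and fe: "(\<lambda>e. f ` e) ` edges S = edges (path_graph k)"
      by (auto simp: copies_def graph_iso_def path_graph_def)
    let ?g = "inv_into (verts S) f"
    have g: "bij_betw ?g {..<k} (verts S)" using f by (rule bij_betw_inv_into)
    have "ispath E (map ?g [0..<k])"
      unfolding ispath_def
    proof
      show "distinct (map ?g [0..<k])"
        using g by (auto simp: distinct_map bij_betw_def atLeast0LessThan)
      show "successively (\<lambda>x y. {x, y} \<in> E) (map ?g [0..<k])"
        unfolding successively_conv_nth
      proof (intro allI impI)
        fix i assume i: "Suc i < length (map ?g [0..<k])"
        then have "{i, Suc i} \<in> edges (path_graph k)" by (auto simp: path_graph_def)
        then obtain e where e: "e \<in> edges S" "f ` e = {i, Suc i}" using fe by (metis imageE)
        have "e \<subseteq> verts S" using S e(1) by (auto simp: is_subgraph_def simple_graph_def all_edges_def)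
        then have "e = ?g ` f ` e" using f by (simp add: bij_betw_def)
        then have "e = {?g i, ?g (Suc i)}" using e(2) by simp
        then show "{map ?g [0..<k] ! i, map ?g [0..<k] ! Suc i} \<in> E"
          using S e(1) i by (auto simp: is_subgraph_def)
      qed
    qed
    from pfreeD[OF pf this] show False by simp
  qed
qed

section \<open>Stars and degrees\<close>

definition nbh :: "'a set set \<Rightarrow> 'a \<Rightarrow> 'a set" where
  "nbh E v = {u. {v, u} \<in> E}"

definition deg :: "'a set set \<Rightarrow> 'a \<Rightarrow> nat" where
  "deg E v = card (nbh E v)"

lemma nbh_subset: "E \<subseteq> all_edges V \<Longrightarrow> nbh E v \<subseteq> V - {v}"
proof
  fix u assume E: "E \<subseteq> all_edges V" and "u \<in> nbh E v"
  then have "{v, u} \<in> all_edges V" by (auto simp only: nbh_def)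
  then show "u \<in> V - {v}" by auto
qed

lemma finite_nbh: "finite V \<Longrightarrow> E \<subseteq> all_edges V \<Longrightarrow> finite (nbh E v)"
  by (meson finite_Diff finite_subset nbh_subset)

lemma deg_mono: "finite V \<Longrightarrow> E' \<subseteq> all_edges V \<Longrightarrow> E \<subseteq> E' \<Longrightarrow> deg E v \<le> deg E' v"
  unfolding deg_def by (rule card_mono) (auto simp: finite_nbh, auto simp: nbh_def)

text \<open>A copy of the star is a centre together with a set of \<open>l - 1\<close> of its
  neighbours. The centre is determined by the copy since \<open>l \<ge> 3\<close>; a single edge
  would have two centres.\<close>

lemma card_copies_star:
  assumes l: "3 \<le> l" and fin: "finite V" and E: "E \<subseteq> all_edges V"
  shows "card (copies (star_graph l) (V, E)) = (\<Sum>v\<in>V. deg E v choose (l - 1))"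
proof -
  define D where "D = Sigma V (\<lambda>v. {S. S \<subseteq> nbh E v \<and> card S = l - 1})"
  define h :: "'a \<times> 'a set \<Rightarrow> 'a graph" where
    "h = (\<lambda>(v, S). (insert v S, (\<lambda>x. {v, x}) ` S))"
  have fS: "finite S" if "S \<subseteq> nbh E v" for S v
    using that finite_nbh[OF fin E] finite_subset by blast
  have inj: "inj_on h D"
  proof (rule inj_onI, clarify)
    fix v S w T assume A: "(v, S) \<in> D" "(w, T) \<in> D" and h: "h (v, S) = h (w, T)"
    have e: "(\<lambda>x. {v, x}) ` S = (\<lambda>x. {w, x}) ` T" and i: "insert v S = insert w T"
      using h by (auto simp: h_def)
    have vS: "v \<notin> S" and wT: "w \<notin> T"
      using A nbh_subset[OF E] by (auto simp: D_def)
    have cS: "card S = l - 1" "finite S" using A fS by (auto simp: D_def)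
    have "v = w"
    proof (rule ccontr)
      assume ne: "v \<noteq> w"
      \<comment> \<open>With distinct centres an edge \<open>v x\<close> is also an edge at
        \<open>w\<close>, which forces \<open>x = w\<close>; but there are at least two
        leaves.\<close>
      have "S \<subseteq> {w}"
      proof
        fix x assume x: "x \<in> S"
        then have "{v, x} \<in> (\<lambda>x. {w, x}) ` T" using e by blast
        with ne show "x \<in> {w}" by (auto simp: doubleton_eq_iff)
      qed
      then have "card S \<le> 1" using card_mono[of "{w}" S] by simp
      with cS l show False by simp
    qed
    moreover from this have "S = T" using i vS wT by auto
    ultimately show "v = w \<and> S = T" by simp
  qed
  have im: "h ` D = copies (star_graph l) (V, E)"
  proof (intro equalityI subsetI)
    fix G assume "G \<in> h ` D"
    then obtain v S where vS: "v \<in> V" "S \<subseteq> nbh E v" "card S = l - 1" and G: "G = h (v, S)"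
      by (auto simp: D_def)
    have SV: "S \<subseteq> V - {v}" using nbh_subset[OF E] vS(2) by blast
    have finS: "finite S" using fS vS(2) .
    then obtain g where g: "bij_betw g S {1..<l}"
      using ex_bij_betw_finite_nat finite_same_card_bij[of S "{1..<l}"] vS(3) by auto
    define f where "f = g(v := 0)"
    have vnS: "v \<notin> S" using SV by auto
    have fg: "f x = g x" if "x \<in> S" for x using that vnS by (auto simp: f_def)
    have "bij_betw f S {1..<l}" using g fg by (simp cong: bij_betw_cong)
    then have "bij_betw f (insert v S) (insert 0 {1..<l})"
      using notIn_Un_bij_betw[of v S f "{1..<l}"] vnS by (simp add: f_def)
    moreover have "insert 0 {1..<l} = {..<l}" using l by auto
    ultimately have b: "bij_betw f (insert v S) {..<l}" by simp
    have im: "f ` S = {1..<l}" using \<open>bij_betw f S {1..<l}\<close> by (simp add: bij_betw_def)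
    have f0: "f v = 0" by (simp add: f_def)
    have "(\<lambda>e. f ` e) ` ((\<lambda>x. {v, x}) ` S) = (\<lambda>y. {0, y}) ` f ` S"
      unfolding image_image by (simp add: f0)
    also have "\<dots> = edges (star_graph l)" unfolding im by (auto simp: star_graph_def)
    finally have "graph_iso G (star_graph l)"
      using b by (auto simp: graph_iso_def G h_def star_graph_def)
    moreover have "is_subgraph G (V, E)"
      using vS SV by (auto simp: is_subgraph_def simple_graph_def G h_def nbh_def)
    ultimately show "G \<in> copies (star_graph l) (V, E)" by (simp add: copies_def)
  next
    fix G assume "G \<in> copies (star_graph l) (V, E)"
    then obtain f where sub: "is_subgraph G (V, E)" and f: "bij_betw f (verts G) {..<l}"
      and fe: "(\<lambda>e. f ` e) ` edges G = edges (star_graph l)"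
      by (auto simp: copies_def graph_iso_def star_graph_def)
    let ?g = "inv_into (verts G) f"
    have g: "bij_betw ?g {..<l} (verts G)" using f by (rule bij_betw_inv_into)
    define v S where "v = ?g 0" and "S = ?g ` {1..<l}"
    have ed: "e = ?g ` f ` e" if "e \<in> edges G" for e
    proof -
      have "e \<subseteq> verts G" using sub that by (auto simp: is_subgraph_def simple_graph_def all_edges_def)
      then show ?thesis using f by (simp add: bij_betw_def)
    qed
    have "edges G = (\<lambda>e. e) ` edges G" by simp
    also have "\<dots> = (\<lambda>e. ?g ` f ` e) ` edges G"
      using ed by (rule image_cong[OF refl])
    also have "\<dots> = (\<lambda>e. ?g ` e) ` (\<lambda>e. f ` e) ` edges G"
      by (rule image_image[symmetric])
    also have "\<dots> = (\<lambda>e. ?g ` e) ` edges (star_graph l)" by (simp only: fe)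
    also have "edges (star_graph l) = (\<lambda>i. {0, i}) ` {1..<l}"
      by (auto simp: star_graph_def)
    finally have eG: "edges G = (\<lambda>x. {v, x}) ` S"
      by (simp add: image_image v_def S_def)
    have "{..<l} = insert 0 {1..<l}" using l by auto
    then have vG: "verts G = insert v S"
      using g by (simp add: bij_betw_def v_def S_def)
    have "card S = l - 1"
      using g unfolding S_def by (subst card_image) (auto simp: bij_betw_def intro: inj_on_subset)
    moreover have "S \<subseteq> nbh E v" using sub eG by (auto simp: is_subgraph_def nbh_def)
    moreover have "v \<in> V" using sub vG by (auto simp: is_subgraph_def)
    ultimately have "(v, S) \<in> D" by (simp add: D_def)
    moreover have "G = h (v, S)" using eG vG by (simp add: h_def prod_eq_iff)
    ultimately show "G \<in> h ` D" by blast
  qed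
  have "card (copies (star_graph l) (V, E)) = card D"
    using card_image[OF inj] by (simp add: im)
  also have "\<dots> = (\<Sum>v\<in>V. card {S. S \<subseteq> nbh E v \<and> card S = l - 1})"
    unfolding D_def
    using finite_nbh[OF fin E] by (intro card_SigmaI[OF fin] ballI finite_Collect_conjI disjI1) simp
  also have "\<dots> = (\<Sum>v\<in>V. deg E v choose (l - 1))"
    by (simp add: n_subsets finite_nbh[OF fin E] deg_def)
  finally show ?thesis .
qed

section \<open>Forcing a property of the final graph\<close>

text \<open>Existence of a strategy of player \<open>w\<close> that makes the final graph satisfy
  \<open>\<Phi>\<close>. This replaces game values by goals. The opponent's rule asks for a legal
  move, as otherwise it would hold vacuously at the end of the game.\<close>

inductive forces ::
  "nat graph \<Rightarrow> nat \<Rightarrow> player \<Rightarrow> (nat set set \<Rightarrow> bool) \<Rightarrow> player \<Rightarrow> nat set set \<Rightarrow> bool"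
  for F n w \<Phi> where
  forces_end: "legal_moves F n E = {} \<Longrightarrow> \<Phi> E \<Longrightarrow> forces F n w \<Phi> p E"
| forces_own: "e \<in> legal_moves F n E \<Longrightarrow> forces F n w \<Phi> (opponent w) (insert e E) \<Longrightarrow>
    forces F n w \<Phi> w E"
| forces_opp: "legal_moves F n E \<noteq> {} \<Longrightarrow>
    (\<And>e. e \<in> legal_moves F n E \<Longrightarrow> forces F n w \<Phi> w (insert e E)) \<Longrightarrow>
    forces F n w \<Phi> (opponent w) E"

lemma finite_legal_moves: "finite (legal_moves F n E)"
  by (rule finite_subset[of _ "all_edges {..<n}"]) (auto simp: legal_moves_def finite_all_edges)

lemma Max_player_forces:
  assumes "forces F n Max_player \<Phi> p E" and "\<And>E. \<Phi> E \<Longrightarrow> B \<le> card (copies H ({..<n}, E))"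
  shows "B \<le> game_value F H n p E"
  using assms(1)
proof induction
  case (forces_end E p)
  then show ?case using assms(2) by (subst game_value.simps) simp
next
  case (forces_own e E)
  then show ?case
    by (subst game_value.simps) (auto simp: finite_legal_moves Max_ge_iff)
next
  case (forces_opp E)
  then show ?case
    by (subst game_value.simps) (auto simp: finite_legal_moves)
qed

lemma Mini_player_forces:
  assumes "forces F n Mini_player \<Phi> p E" and "\<And>E. \<Phi> E \<Longrightarrow> card (copies H ({..<n}, E)) \<le> B"
  shows "game_value F H n p E \<le> B"
  using assms(1)
proof induction
  case (forces_end E p)
  then show ?case using assms(2) by (subst game_value.simps) simp
next
  case (forces_own e E)
  then show ?case
    by (subst game_value.simps) (auto simp: finite_legal_moves Min_le_iff)
next
  case (forces_opp E)
  then show ?case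
    by (subst game_value.simps) (auto simp: finite_legal_moves)
qed

lemma forces_oppI:
  assumes "legal_moves F n E = {} \<Longrightarrow> \<Phi> E"
    and "\<And>e. e \<in> legal_moves F n E \<Longrightarrow> forces F n w \<Phi> w (insert e E)"
  shows "forces F n w \<Phi> (opponent w) E"
  using assms by (cases "legal_moves F n E = {}") (auto intro: forces.intros)

text \<open>If no move of either player can break the invariant, the rest of the game may be played
  arbitrarily.\<close>

lemma forces_invariant:
  assumes "I E" and fin: "\<And>E. I E \<Longrightarrow> legal_moves F n E = {} \<Longrightarrow> \<Phi> E"
    and step: "\<And>E e. I E \<Longrightarrow> e \<in> legal_moves F n E \<Longrightarrow> I (insert e E)"
  shows "forces F n w \<Phi> p E"
  using assms(1)
proof (induction "card (all_edges {..<n} - E)" arbitrary: E p rule: less_induct)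
  case less
  have IH: "forces F n w \<Phi> q (insert e E)" if "e \<in> legal_moves F n E" for e q
    using that by (intro less.hyps card_unclaimed_less step less.prems)
  show ?case
  proof (cases "legal_moves F n E = {}")
    case True
    then show ?thesis using fin less.prems by (auto intro: forces_end)
  next
    case False
    then obtain e where e: "e \<in> legal_moves F n E" by blast
    consider "p = w" | "p = opponent w" by (cases p; cases w) auto
    then show ?thesis
      by cases (use IH e False in \<open>auto intro: forces_own forces_opp\<close>)
  qed
qed

section \<open>Cut vertices\<close>

text \<open>For \<open>S = {}\<close> the set \<open>A\<close> is a union of components; for
  \<open>S = {v}\<close> and \<open>v \<notin> A\<close> it is a union of components of the graph
  without \<open>v\<close>.\<close>

definition closed_upto :: "'a set set \<Rightarrow> 'a set \<Rightarrow> 'a set \<Rightarrow> bool" where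
  "closed_upto E S A \<longleftrightarrow> (\<forall>p q. {p, q} \<in> E \<longrightarrow> p \<in> A \<longrightarrow> q \<in> A \<union> S)"

text \<open>The arms are \<open>xs\<close> and \<open>ys\<close>, separated by \<open>A\<close>. The
  number \<open>j\<close> is the size of the components that can be attached at \<open>v\<close>: a
  path inside such a component has at most \<open>j\<close> vertices, hence is no longer than an
  arm.\<close>

definition cut :: "'a set set \<Rightarrow> 'a \<Rightarrow> nat \<Rightarrow> bool" where
  "cut E v j \<longleftrightarrow> (\<exists>A xs ys. v \<notin> A \<and> closed_upto E {v} A \<and>
     ispath E (v # xs) \<and> length xs = j \<and> set xs \<subseteq> A \<and>
     ispath E (v # ys) \<and> length ys = j \<and> set ys \<inter> A = {})"

definition clique_comp :: "'a set set \<Rightarrow> 'a set \<Rightarrow> bool" where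
  "clique_comp E C \<longleftrightarrow> all_edges C \<subseteq> E \<and> closed_upto E {} C"

text \<open>The supply of complete components on \<open>j\<close> vertices that Max can attach to a
  cut vertex.\<close>

definition stock :: "'a set \<Rightarrow> 'a set set \<Rightarrow> nat \<Rightarrow> nat" where
  "stock V E j = card {C. C \<subseteq> V \<and> card C = j \<and> clique_comp E C}"

lemma closed_uptoD: "closed_upto E S A \<Longrightarrow> {p, q} \<in> E \<Longrightarrow> p \<in> A \<Longrightarrow> q \<in> A \<union> S"
  by (auto simp: closed_upto_def)

lemma closed_upto_insert:
  assumes "closed_upto E S A" "p \<in> A \<Longrightarrow> q \<in> A \<union> S" "q \<in> A \<Longrightarrow> p \<in> A \<union> S"
  shows "closed_upto (insert {p, q} E) S A"
  using assms by (auto simp: closed_upto_def doubleton_eq_iff)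

lemma closed_upto_weaken: "closed_upto E S A \<Longrightarrow> S \<subseteq> T \<Longrightarrow> closed_upto E T A"
  unfolding closed_upto_def by blast

lemma ispath_closed:
  assumes "closed_upto E S A" "ispath E xs" "set xs \<inter> S = {}"
  shows "set xs \<subseteq> A \<or> set xs \<inter> A = {}"
  using assms(2,3)
proof (induction xs)
  case (Cons x xs)
  show ?case
  proof (cases "xs = []")
    case True then show ?thesis by auto
  next
    case False
    then have e: "{x, hd xs} \<in> E" "hd xs \<in> set xs" using Cons.prems by (auto simp: ispath_Cons)
    have "x \<in> A \<longleftrightarrow> hd xs \<in> A"
      using closed_uptoD[OF assms(1), of x "hd xs"] closed_uptoD[OF assms(1), of "hd xs" x] e Cons.prems(2)
      by (auto simp: insert_commute)
    moreover have "set xs \<subseteq> A \<or> set xs \<inter> A = {}"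
      using Cons by (auto simp: ispath_Cons)
    ultimately show ?thesis using e by auto
  qed
qed auto

lemma clique_edge: "all_edges C \<subseteq> E \<Longrightarrow> p \<in> C \<Longrightarrow> q \<in> C \<Longrightarrow> p \<noteq> q \<Longrightarrow> {p, q} \<in> E"
  by (rule subsetD) auto

lemma clique_ispath: "all_edges C \<subseteq> E \<Longrightarrow> distinct zs \<Longrightarrow> set zs \<subseteq> C \<Longrightarrow> ispath E zs"
proof (induction zs)
  case (Cons z zs)
  then show ?case by (cases zs) (auto simp: ispath_Cons intro!: clique_edge[of C E])
qed auto

lemma ispath_length:
  assumes "ispath E xs" "set xs \<subseteq> C" "finite C"
  shows "length xs \<le> card C"
  using assms by (metis card_mono distinct_card ispath_def)

lemma enum_from:
  assumes "finite C" "c \<in> C"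
  obtains zs where "distinct (c # zs)" "set (c # zs) = C" "length zs = card C - 1"
proof -
  obtain zs where "distinct zs" "set zs = C - {c}"
    using finite_distinct_list[of "C - {c}"] assms by auto
  then show thesis using that[of zs] assms by (auto simp: distinct_card[symmetric])
qed

lemma clique_comp_unique:
  assumes "clique_comp E C" "clique_comp E D" "p \<in> C" "p \<in> D"
  shows "C = D"
proof -
  have "C \<subseteq> D" if "clique_comp E C" "clique_comp E D" "p \<in> C" "p \<in> D" for C D
  proof
    fix x assume "x \<in> C"
    then have "x = p \<or> {p, x} \<in> E" using that clique_edge[of C E p x] by (auto simp: clique_comp_def)
    then show "x \<in> D" using that closed_uptoD[of E "{}" D p x] by (auto simp: clique_comp_def)
  qed
  then show ?thesis using assms by blast
qed

lemma clique_comp_insert: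
  "clique_comp E C \<Longrightarrow> p \<notin> C \<Longrightarrow> q \<notin> C \<Longrightarrow> clique_comp (insert {p, q} E) C"
  by (auto simp: clique_comp_def intro: closed_upto_insert)

text \<open>A new edge spoils only complete components that contain one of its ends, and each end
  lies in at most one of them.\<close>

lemma stock_insert:
  assumes "finite V"
  shows "stock V E j \<le> stock V (insert {p, q} E) j + (card {r \<in> {p, q}. \<exists>C. r \<in> C \<and> card C = j \<and> clique_comp E C})"
proof -
  define S where "S = {C. C \<subseteq> V \<and> card C = j \<and> clique_comp E C}"
  define T where "T = {C. C \<subseteq> V \<and> card C = j \<and> clique_comp (insert {p, q} E) C}"
  define R where "R = {r \<in> {p, q}. \<exists>C. r \<in> C \<and> card C = j \<and> clique_comp E C}"
  have fin: "finite S" "finite T"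
    using assms by (auto simp: S_def T_def intro: finite_subset[of _ "Pow V"])
  have finR: "finite R" by (simp add: R_def)
  have "S \<subseteq> T \<union> (\<lambda>r. THE C. r \<in> C \<and> clique_comp E C) ` R"
  proof
    fix C assume C: "C \<in> S"
    show "C \<in> T \<union> (\<lambda>r. THE C. r \<in> C \<and> clique_comp E C) ` R"
    proof (cases "p \<notin> C \<and> q \<notin> C")
      case True
      then show ?thesis using C by (auto simp: S_def T_def intro: clique_comp_insert)
    next
      case False
      then obtain r where r: "r \<in> {p, q}" "r \<in> C" by auto
      then have "r \<in> R" using C by (auto simp: R_def S_def)
      moreover have "(THE C. r \<in> C \<and> clique_comp E C) = C"
      proof (rule the_equality)
        show "r \<in> C \<and> clique_comp E C" using C r by (simp add: S_def)
        then show "D = C" if "r \<in> D \<and> clique_comp E D" for D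
          using that clique_comp_unique[of E D C r] by blast
      qed
      ultimately show ?thesis by force
    qed
  qed
  then have "card S \<le> card (T \<union> (\<lambda>r. THE C. r \<in> C \<and> clique_comp E C) ` R)"
    using fin finR by (intro card_mono) auto
  also have "\<dots> \<le> card T + card R"
    using card_image_le[OF finR] card_Un_le by (meson add_left_mono order_trans)
  finally show ?thesis by (simp add: stock_def S_def T_def R_def)
qed

lemma stock_insert2:
  assumes "finite V"
  shows "stock V E j \<le> stock V (insert {p, q} E) j + 2"
proof -
  have "card {r \<in> {p, q}. \<exists>C. r \<in> C \<and> card C = j \<and> clique_comp E C} \<le> card {p, q}"
    by (intro card_mono) auto
  also have "\<dots> \<le> 2" by (simp add: card_insert_if)
  finally show ?thesis using stock_insert[OF assms, of E j p q] by simp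
qed

text \<open>Otherwise \<open>v\<close> and an arm, which are \<open>j + 1\<close> vertices, would
  fit into \<open>C\<close>.\<close>

lemma cut_not_in_clique_comp:
  assumes "cut E v j" "clique_comp E C" "card C \<le> j" "finite C"
  shows "v \<notin> C"
proof
  assume "v \<in> C"
  obtain xs where xs: "ispath E (v # xs)" "length xs = j" using assms(1) by (auto simp: cut_def)
  have "set (v # xs) \<subseteq> C"
    using ispath_closed[of E "{}" C, OF _ xs(1)] assms(2) \<open>v \<in> C\<close> by (auto simp: clique_comp_def)
  from ispath_length[OF xs(1) this] assms xs show False by simp
qed

lemma pfree_attach:
  assumes pf: "pfree k E" and cut: "cut E v j" and C: "clique_comp E C" "finite C" "card C \<le> j"
    and c: "c \<in> C"
  shows "pfree k (insert {v, c} E)"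
proof (rule pfree_insertI[OF pf])
  fix P Q assume P: "ispath E (P @ [c])" and Q: "ispath E (v # Q)"
  have clC: "closed_upto E {} C" using C by (simp add: clique_comp_def)
  obtain A xs ys where A: "v \<notin> A" "closed_upto E {v} A" "ispath E (v # xs)" "length xs = j" "set xs \<subseteq> A"
     "ispath E (v # ys)" "length ys = j" "set ys \<inter> A = {}"
    using cut by (auto simp: cut_def)
  have "set (P @ [c]) \<subseteq> C" using ispath_closed[OF clC P] c by auto
  from ispath_length[OF P this C(2)] have lP: "Suc (length P) \<le> j" using C by simp
  have "set Q \<subseteq> A \<or> set Q \<inter> A = {}"
    using Q by (intro ispath_closed[OF A(2)]) (auto simp: ispath_Cons)
  \<comment> \<open>Beyond \<open>v\<close> the path stays on one side of \<open>A\<close>, so the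
    arm on the other side is free to replace the initial part \<open>P @ [c]\<close>, which is no
    longer than that arm.\<close>
  then obtain us where us: "ispath E (v # us)" "length us = j" "set us \<inter> set Q = {}"
    using A by blast
  have "ispath E (rev us @ v # Q)"
    using us Q by (subst ispath_append) (auto simp: ispath_Cons last_rev insert_commute)
  from pfreeD[OF pf this] lP us show "length (P @ c # v # Q) < k" by simp
qed

text \<open>Attaching a component at a cut vertex produces three separated arms, of which one further edge
  joins at most two.\<close>

lemma cut_attach_reply:
  assumes cut: "cut E v j" and C: "clique_comp E C" "finite C" "card C = j" and c: "c \<in> C"
  shows "cut (insert {p, q} (insert {v, c} E)) v j" (is "cut ?E v j")
proof -
  have vC: "v \<notin> C" using cut_not_in_clique_comp[OF cut C(1)] C by simp
  have clC: "closed_upto E {} C" using C by (simp add: clique_comp_def)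
  obtain A xs ys where A: "v \<notin> A" "closed_upto E {v} A" "ispath E (v # xs)" "length xs = j" "set xs \<subseteq> A"
     "ispath E (v # ys)" "length ys = j" "set ys \<inter> A = {}"
    using cut by (auto simp: cut_def)
  have xsC: "set xs \<inter> C = {}" "set ys \<inter> C = {}"
    using ispath_closed[OF clC A(3)] ispath_closed[OF clC A(6)] vC by auto
  have "E \<subseteq> ?E" by auto
  then have px: "ispath ?E (v # xs)" "ispath ?E (v # ys)" using A ispath_mono by blast+
  obtain zs where zs: "distinct (c # zs)" "set (c # zs) = C" "length zs = card C - 1"
    using enum_from[OF C(2) c] .
  have "ispath ?E (c # zs)"
    using C(1) zs by (intro clique_ispath[of C]) (auto simp: clique_comp_def)
  then have pz: "ispath ?E (v # c # zs)" using vC zs by (auto simp: ispath_Cons)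
  have lz: "length (c # zs) = j" using zs C c by (metis distinct_card)
  have clCv: "closed_upto E {v} C" using closed_upto_weaken[OF clC] by simp
  have cl1: "closed_upto E {v} (A - C)" "closed_upto E {v} (A \<union> C)"
    unfolding closed_upto_def
    using closed_uptoD[OF A(2)] closed_uptoD[OF clC] closed_uptoD[OF clC, of _ _, unfolded insert_commute[of _ _ "{}"]]
    by (metis DiffE DiffI UnE UnI1 UnI2 Un_empty_right insert_commute)+
  have cl2: "closed_upto (insert {v, c} E) {v} (A - C)" "closed_upto (insert {v, c} E) {v} (A \<union> C)"
    "closed_upto (insert {v, c} E) {v} C"
    by (intro closed_upto_insert cl1 clCv; use A(1) c vC in simp)+
  \<comment> \<open>The arms lie in \<open>A - C\<close>, in \<open>C\<close> and outside
    \<open>A \<union> C\<close>. If the reply leaves \<open>A - C\<close> towards \<open>C\<close>,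
    the set \<open>A \<union> C\<close> remains closed up to \<open>v\<close>; if it leaves
    \<open>A - C\<close> towards anything else, \<open>C\<close> does.\<close>
  consider "closed_upto ?E {v} (A - C)"
    | p' q' where "{p', q'} = {p, q}" "p' \<in> A - C" "q' \<notin> A - C \<union> {v}"
  proof (cases "closed_upto ?E {v} (A - C)")
    case False
    then obtain p' q' where pq: "{p', q'} \<in> ?E" "p' \<in> A - C" "q' \<notin> A - C \<union> {v}"
      by (auto simp only: closed_upto_def)
    then have "{p', q'} \<notin> insert {v, c} E" using closed_uptoD[OF cl2(1)] by blast
    with pq that(2) show thesis by blast
  qed (rule that(1))
  then show ?thesis
  proof cases
    case 1
    show ?thesis unfolding cut_def
      by (rule exI[of _ "A - C"], rule exI[of _ xs], rule exI[of _ ys]) (use 1 A px xsC in auto)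
  next
    case 2
    have e: "?E = insert {p', q'} (insert {v, c} E)" using 2 by simp
    show ?thesis
    proof (cases "q' \<in> C")
      case True
      then have "closed_upto ?E {v} (A \<union> C)"
        unfolding e using 2 by (intro closed_upto_insert cl2) auto
      then show ?thesis unfolding cut_def
        by (intro exI[of _ "A \<union> C"] exI[of _ xs] exI[of _ ys]) (use A px xsC vC in auto)
    next
      case False
      then have "closed_upto ?E {v} C"
        unfolding e using 2 by (intro closed_upto_insert cl2) auto
      then show ?thesis unfolding cut_def
        by (intro exI[of _ C] exI[of _ "c # zs"] exI[of _ xs]) (use A px pz lz zs xsC vC in auto)
    qed
  qed
qed

section \<open>The path saturation game\<close>

locale path_game =
  fixes k n :: nat
  assumes k4: "4 \<le> k"
begin

abbreviation V :: "nat set" where "V \<equiv> {..<n}"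

abbreviation legal :: "nat set set \<Rightarrow> nat set set" where
  "legal \<equiv> legal_moves (path_graph k) n"

abbreviation maxi :: "(nat set set \<Rightarrow> bool) \<Rightarrow> player \<Rightarrow> nat set set \<Rightarrow> bool" where
  "maxi \<equiv> forces (path_graph k) n Max_player"

abbreviation mini :: "(nat set set \<Rightarrow> bool) \<Rightarrow> player \<Rightarrow> nat set set \<Rightarrow> bool" where
  "mini \<equiv> forces (path_graph k) n Mini_player"

definition pos :: "nat set set \<Rightarrow> bool" where
  "pos E \<longleftrightarrow> E \<subseteq> all_edges V \<and> pfree k E"

lemma posD: "pos E \<Longrightarrow> E \<subseteq> all_edges V" "pos E \<Longrightarrow> pfree k E"
  by (auto simp: pos_def)

lemma legal_iff: "pos E \<Longrightarrow> e \<in> legal E \<longleftrightarrow> e \<in> all_edges V \<and> e \<notin> E \<and> pfree k (insert e E)"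
  using k4 graph_free_path[of k "insert e E" V]
  by (cases "e \<in> all_edges V") (auto simp: legal_moves_def pos_def)

lemma legal_pos: "pos E \<Longrightarrow> e \<in> legal E \<Longrightarrow> pos (insert e E)"
  by (auto simp: legal_iff pos_def)

lemma maxi_own: "e \<in> legal E \<Longrightarrow> maxi \<Phi> Mini_player (insert e E) \<Longrightarrow> maxi \<Phi> Max_player E"
  using forces_own[of e "path_graph k" n E Max_player \<Phi>] by simp

lemma mini_own: "e \<in> legal E \<Longrightarrow> mini \<Phi> Max_player (insert e E) \<Longrightarrow> mini \<Phi> Mini_player E"
  using forces_own[of e "path_graph k" n E Mini_player \<Phi>] by simp

lemma forces_reply:
  assumes "pos E" "legal E = {} \<Longrightarrow> \<Phi> E"
    and "\<And>p q. p \<in> V \<Longrightarrow> q \<in> V \<Longrightarrow> p \<noteq> q \<Longrightarrow> {p, q} \<notin> E \<Longrightarrow> pos (insert {p, q} E) \<Longrightarrow>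
      forces (path_graph k) n w \<Phi> w (insert {p, q} E)"
  shows "forces (path_graph k) n w \<Phi> (opponent w) E"
proof (rule forces_oppI)
  fix e assume e: "e \<in> legal E"
  then have "e \<in> all_edges V" "e \<notin> E" "pos (insert e E)"
    using assms(1) legal_iff legal_pos by blast+
  then show "forces (path_graph k) n w \<Phi> w (insert e E)" using assms(3) by (auto elim!: all_edgesE)
qed (fact assms(2))

lemmas maxi_opp = forces_reply[of _ _ Max_player, unfolded opponent.simps]
lemmas mini_opp = forces_reply[of _ _ Mini_player, unfolded opponent.simps]

lemma forces_superset:
  assumes "pos E" "\<And>E'. pos E' \<Longrightarrow> E \<subseteq> E' \<Longrightarrow> \<Phi> E'"
  shows "forces (path_graph k) n w \<Phi> p E"
  by (rule forces_invariant[of "\<lambda>E'. pos E' \<and> E \<subseteq> E'"]) (use assms legal_pos in auto)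

lemma cut_legal:
  assumes "pos E" "cut E v j" "1 \<le> j" "1 \<le> stock V E j"
  obtains C c where "C \<subseteq> V" "card C = j" "clique_comp E C" "c \<in> C" "{v, c} \<in> legal E" "{v, c} \<notin> E"
proof -
  have "{C. C \<subseteq> V \<and> card C = j \<and> clique_comp E C} \<noteq> {}"
    using assms(4) unfolding stock_def by (metis card.empty not_one_le_zero)
  then obtain C where C: "C \<subseteq> V" "card C = j" "clique_comp E C" by blast
  then obtain c where c: "c \<in> C" using assms(3) by (metis card.empty ex_in_conv not_one_le_zero)
  have finC: "finite C" using C finite_subset by blast
  have vC: "v \<notin> C" using cut_not_in_clique_comp[OF assms(2) C(3)] C finC by simp
  obtain xs where xs: "ispath E (v # xs)" "length xs = j" using assms(2) by (auto simp: cut_def)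
  have vV: "v \<in> V" using ispath_subset[OF xs(1)] xs(2) assms(1,3) by (auto simp: pos_def)
  have nE: "{v, c} \<notin> E"
    using C(3) vC c closed_uptoD[of E "{}" C c v] by (auto simp: clique_comp_def insert_commute)
  moreover have "pfree k (insert {v, c} E)"
    using pfree_attach[OF posD(2)[OF assms(1)] assms(2) C(3) finC] C c by simp
  ultimately have "{v, c} \<in> legal E"
    using assms(1) vV C(1) c vC by (subst legal_iff) auto
  with C c nE that show thesis by blast
qed

lemma maxi_cut:
  assumes "pos E" "cut E v j" "1 \<le> j" "s \<le> stock V E j"
    and "\<And>E'. pos E' \<Longrightarrow> E \<subseteq> E' \<Longrightarrow> s \<le> 3 * deg E' v \<Longrightarrow> \<Phi> E'"
  shows "maxi \<Phi> Max_player E"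
proof -
  \<comment> \<open>The sum \<open>stock V F j + 3 * deg F v\<close> stays at least \<open>s\<close>
    from round to round, and the induction is on the degree still missing.\<close>
  have gen: "maxi \<Phi> Max_player F"
    if "pos F" "cut F v j" "E \<subseteq> F" "s \<le> stock V F j + 3 * deg F v" for F
    using that
  proof (induction "s - 3 * deg F v" arbitrary: F rule: less_induct)
    case less
    show ?case
    proof (cases "s \<le> 3 * deg F v")
      case True
      show ?thesis
      proof (rule forces_superset)
        fix E' assume E': "pos E'" "F \<subseteq> E'"
        have "deg F v \<le> deg E' v"
          using E' posD by (intro deg_mono[of V]) auto
        with True less.prems E' show "\<Phi> E'" by (intro assms(5)) auto
      qed fact
    next
      case False
      with less.prems have "1 \<le> stock V F j" by simp
      from cut_legal[OF less.prems(1,2) assms(3) this]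
      obtain C c where C: "C \<subseteq> V" "card C = j" "clique_comp F C" and c: "c \<in> C"
        and e: "{v, c} \<in> legal F" "{v, c} \<notin> F" .
      have finC: "finite C" using C(1) finite_subset by blast
      let ?F = "insert {v, c} F"
      have pos1: "pos ?F" using legal_pos less.prems(1) e(1) by blast
      have degF: "Suc (deg F v) \<le> deg F' v" if "pos F'" "?F \<subseteq> F'" for F'
      proof -
        have fin: "finite (nbh F' v)" using finite_nbh[OF _ posD(1)[OF that(1)]] by simp
        have sub: "insert c (nbh F v) \<subseteq> nbh F' v" using that(2) by (auto simp: nbh_def)
        then have "card (insert c (nbh F v)) \<le> card (nbh F' v)" using fin by (rule card_mono[rotated])
        moreover have "c \<notin> nbh F v" using e(2) by (simp add: nbh_def)
        moreover have "finite (nbh F v)" using finite_subset[OF sub fin] by simp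
        ultimately show ?thesis by (simp add: deg_def)
      qed
      have cut1: "cut (insert {p, q} ?F) v j" for p q
        using cut_attach_reply[OF less.prems(2) C(3) finC C(2) c] .
      have sup1: "stock V F j \<le> stock V ?F j + 1"
      proof -
        have "{r \<in> {v, c}. \<exists>C. r \<in> C \<and> card C = j \<and> clique_comp F C} \<subseteq> {c}"
          using cut_not_in_clique_comp[OF less.prems(2)] assms(3) card_ge_0_finite by force
        from card_mono[OF _ this] have "card {r \<in> {v, c}. \<exists>C. r \<in> C \<and> card C = j \<and> clique_comp F C} \<le> 1"
          by simp
        then show ?thesis using stock_insert[of V F j v c] by simp
      qed
      have "maxi \<Phi> Mini_player ?F"
      proof (rule maxi_opp[OF pos1])
        assume no: "legal ?F = {}"
        have "s \<le> 3 * deg ?F v"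
        proof (rule ccontr)
          assume "\<not> s \<le> 3 * deg ?F v"
          then have "1 \<le> stock V ?F j" using degF[OF pos1] sup1 less.prems(4) by simp
          \<comment> \<open>With \<open>p q\<close> taken to be the edge \<open>v c\<close> itself,
            \<open>cut1\<close> says that \<open>v\<close> is still a cut vertex of
            \<open>?F\<close>, so another attachment would be legal.\<close>
          from cut_legal[OF pos1 _ assms(3) this] cut1[of v c] no show False by auto
        qed
        then show "\<Phi> ?F" using less.prems(3) pos1 by (intro assms(5)) auto
      next
        fix p q assume p: "pos (insert {p, q} ?F)"
        have d: "Suc (deg F v) \<le> deg (insert {p, q} ?F) v" using degF[OF p] by auto
        show "maxi \<Phi> Max_player (insert {p, q} ?F)"
        proof (rule less.hyps)
          show "s - 3 * deg (insert {p, q} ?F) v < s - 3 * deg F v" using d False by linarith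
          show "s \<le> stock V (insert {p, q} ?F) j + 3 * deg (insert {p, q} ?F) v"
            using d sup1 stock_insert2[of V ?F j p q] less.prems(4) by simp
        qed (use p cut1 less.prems(3) in auto)
      qed
      with e(1) show ?thesis by (rule maxi_own)
    qed
  qed
  show ?thesis using assms by (intro gen) auto
qed

end

section \<open>Vertex partitions\<close>

text \<open>\<open>E \<subseteq> clq P\<close> says that no edge leaves a class of \<open>P\<close>,
  and \<open>E = clq P\<close> that moreover all classes are complete. Positions are tracked by such
  a partition, whose classes need not be connected while Max is still filling them.\<close>

definition clq :: "'a set set \<Rightarrow> 'a set set" where
  "clq P = (\<Union>C\<in>P. all_edges C)"

definition merge :: "'a set set \<Rightarrow> 'a set \<Rightarrow> 'a set \<Rightarrow> 'a set set" where
  "merge P C D = insert (C \<union> D) (P - {C, D})"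

definition cnt :: "'a set set \<Rightarrow> nat \<Rightarrow> nat" where
  "cnt P i = card {C \<in> P. card C = i}"

lemma clq_pair: "{p, q} \<in> clq P \<longleftrightarrow> p \<noteq> q \<and> (\<exists>C\<in>P. p \<in> C \<and> q \<in> C)"
  by (auto simp: clq_def)

lemma part_unique: "partition_on A P \<Longrightarrow> C \<in> P \<Longrightarrow> D \<in> P \<Longrightarrow> p \<in> C \<Longrightarrow> p \<in> D \<Longrightarrow> C = D"
  unfolding partition_on_def disjoint_def by blast

lemma part_disjoint: "partition_on A P \<Longrightarrow> C \<in> P \<Longrightarrow> D \<in> P \<Longrightarrow> C \<noteq> D \<Longrightarrow> C \<inter> D = {}"
  unfolding partition_on_def disjoint_def by blast

lemma part_sub: "partition_on A P \<Longrightarrow> C \<in> P \<Longrightarrow> C \<subseteq> A"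
  unfolding partition_on_def by blast

lemma part_ne: "partition_on A P \<Longrightarrow> C \<in> P \<Longrightarrow> C \<noteq> {}"
  unfolding partition_on_def by blast

lemma part_ex: "partition_on A P \<Longrightarrow> p \<in> A \<Longrightarrow> \<exists>C\<in>P. p \<in> C"
  unfolding partition_on_def by blast

lemma part_finite: "partition_on A P \<Longrightarrow> finite A \<Longrightarrow> finite P"
  by (rule finite_elements)

lemma clq_sub: "partition_on A P \<Longrightarrow> clq P \<subseteq> all_edges A"
  unfolding clq_def by (intro UN_least all_edges_mono part_sub)

lemma all_edges_clq: "C \<in> P \<Longrightarrow> all_edges C \<subseteq> clq P"
  by (auto simp: clq_def)

lemma clq_edgeE:
  assumes "partition_on A P" "E \<subseteq> clq P" "{p, q} \<in> E" "p \<in> C" "C \<in> P"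
  shows "q \<in> C"
proof -
  have "{p, q} \<in> clq P" using assms by blast
  then obtain D where "D \<in> P" "p \<in> D" "q \<in> D" by (auto simp: clq_pair)
  with assms show ?thesis using part_unique by metis
qed

lemma closed_part: "partition_on A P \<Longrightarrow> E \<subseteq> clq P \<Longrightarrow> C \<in> P \<Longrightarrow> closed_upto E {} C"
  unfolding closed_upto_def using clq_edgeE by (metis Un_empty_right)

lemma clique_comp_part:
  "partition_on A P \<Longrightarrow> E \<subseteq> clq P \<Longrightarrow> C \<in> P \<Longrightarrow> all_edges C \<subseteq> E \<Longrightarrow> clique_comp E C"
  by (simp add: clique_comp_def closed_part)

lemma ispath_part:
  assumes "partition_on A P" "E \<subseteq> clq P" "ispath E (x # xs)" "x \<in> C" "C \<in> P"
  shows "set (x # xs) \<subseteq> C"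
  using ispath_closed[OF closed_part[OF assms(1,2,5)] assms(3)] assms(4) by auto

lemma partition_merge:
  assumes "partition_on A P" "C \<in> P" "D \<in> P"
  shows "partition_on A (merge P C D)"
proof (rule partition_onI)
  show "\<Union> (merge P C D) = A"
    using assms(2,3) unfolding partition_onD1[OF assms(1)] merge_def by blast
  show "{} \<notin> merge P C D"
    using part_ne[OF assms(1)] assms(2) by (auto simp: merge_def)
  show "disjnt X Y" if "X \<in> merge P C D" "Y \<in> merge P C D" "X \<noteq> Y" for X Y
    using that part_disjoint[OF assms(1), of X] part_disjoint[OF assms(1), of _ Y] assms(2,3)
    unfolding merge_def disjnt_def by (auto simp: Int_Un_distrib Int_Un_distrib2)
qed

lemma clq_merge_sub: "clq P \<subseteq> clq (merge P C D)"
proof -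
  have "all_edges X \<subseteq> clq (merge P C D)" if "X \<in> P" for X
  proof (cases "X = C \<or> X = D")
    case True
    then have "X \<subseteq> C \<union> D" by auto
    then show ?thesis using all_edges_mono[of X "C \<union> D"] all_edges_clq[of "C \<union> D" "merge P C D"]
      by (auto simp: merge_def)
  next
    case False
    then show ?thesis using that by (intro all_edges_clq) (auto simp: merge_def)
  qed
  then show ?thesis by (auto simp: clq_def)
qed

lemma clq_merge_insert:
  assumes "p \<in> C" "q \<in> D" "p \<noteq> q" "E \<subseteq> clq P"
  shows "insert {p, q} E \<subseteq> clq (merge P C D)"
  using assms clq_merge_sub[of P C D] by (auto simp: clq_pair merge_def)

lemma clq_merge:
  assumes "C \<in> P" "D \<in> P"
  shows "clq (merge P C D) \<subseteq> clq P \<union> (\<lambda>(p, q). {p, q}) ` (C \<times> D)"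
proof
  fix e assume "e \<in> clq (merge P C D)"
  then obtain X where X: "X \<in> merge P C D" "e \<in> all_edges X" by (auto simp: clq_def)
  show "e \<in> clq P \<union> (\<lambda>(p, q). {p, q}) ` (C \<times> D)"
  proof (cases "X \<in> P")
    case True then show ?thesis using X by (auto simp: clq_def)
  next
    case False
    then have "X = C \<union> D" using X by (auto simp: merge_def)
    then obtain p q where e: "e = {p, q}" "p \<in> C \<union> D" "q \<in> C \<union> D" "p \<noteq> q"
      using X by (auto elim!: all_edgesE)
    show ?thesis
    proof (cases "(p \<in> C \<and> q \<in> C) \<or> (p \<in> D \<and> q \<in> D)")
      case True then show ?thesis using e assms by (auto simp: clq_pair)
    next
      case False
      then have "(p \<in> C \<and> q \<in> D) \<or> (q \<in> C \<and> p \<in> D)" using e by blast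
      then show ?thesis using e(1) by (force simp: insert_commute)
    qed
  qed
qed

text \<open>The equation has additions on both sides because subtraction is truncated; the
  indicators cover coincidences such as two classes of equal size.\<close>

lemma cnt_merge:
  assumes "partition_on A P" "finite A" "C \<in> P" "D \<in> P" "C \<noteq> D"
  shows "cnt (merge P C D) i + of_bool (card C = i) + of_bool (card D = i) =
    cnt P i + of_bool (card C + card D = i)"
proof -
  have finP: "finite P" using part_finite assms by blast
  have fin: "finite C" "finite D" using assms part_sub finite_subset by metis+
  have dis: "C \<inter> D = {}" using part_disjoint[OF assms(1,3,4,5)] .
  have cu: "card (C \<union> D) = card C + card D" using card_Un_disjoint fin dis by blast
  have n: "C \<union> D \<notin> P - {C, D}"
    using part_unique[OF assms(1), of "C \<union> D" C] part_ne[OF assms(1,3)] assms(3) by blast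
  have 1: "cnt (merge P C D) i = card {X \<in> P - {C, D}. card X = i} + of_bool (card C + card D = i)"
  proof -
    have "{X \<in> merge P C D. card X = i} =
      (if card C + card D = i then insert (C \<union> D) {X \<in> P - {C, D}. card X = i} else {X \<in> P - {C, D}. card X = i})"
      using cu by (auto simp: merge_def)
    moreover have "C \<union> D \<notin> {X \<in> P - {C, D}. card X = i}" using n by blast
    ultimately show ?thesis using finP by (simp add: cnt_def del: Diff_iff insert_iff)
  qed
  have "{X \<in> P. card X = i} = {X \<in> P - {C, D}. card X = i} \<union> {X \<in> {C}. card X = i} \<union> {X \<in> {D}. card X = i}"
    using assms by auto
  then have "cnt P i = card ({X \<in> P - {C, D}. card X = i} \<union> {X \<in> {C}. card X = i} \<union> {X \<in> {D}. card X = i})"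
    by (simp add: cnt_def)
  also have "\<dots> = card {X \<in> P - {C, D}. card X = i} + card {X \<in> {C}. card X = i} + card {X \<in> {D}. card X = i}"
    using finP assms(5) by (subst card_Un_disjoint; (subst card_Un_disjoint)?; auto)
  also have "card {X \<in> {C}. card X = i} = of_bool (card C = i)"
    by (cases "card C = i") (auto simp: card_1_singleton_iff intro: exI[of _ C])
  also have "card {X \<in> {D}. card X = i} = of_bool (card D = i)"
    by (cases "card D = i") (auto simp: card_1_singleton_iff intro: exI[of _ D])
  finally show ?thesis using 1 by simp
qed

lemma cnt_pos:
  assumes "finite P"
  shows "0 < cnt P i \<longleftrightarrow> (\<exists>C\<in>P. card C = i)"
  using assms by (auto simp: cnt_def card_gt_0_iff)

lemma ex_cnt_avoid:
  assumes "card X < cnt P i" "finite X"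
  obtains C where "C \<in> P" "card C = i" "C \<notin> X"
proof -
  have "\<not> {C \<in> P. card C = i} \<subseteq> X"
    using assms card_mono[OF assms(2), of "{C \<in> P. card C = i}"] by (auto simp: cnt_def)
  with that show thesis by blast
qed

lemma stock_part:
  assumes P: "partition_on A P" "finite A" "E \<subseteq> clq P"
    and "\<And>C. C \<in> P \<Longrightarrow> card C = j \<Longrightarrow> all_edges C \<subseteq> E"
  shows "cnt P j \<le> stock A E j"
  unfolding cnt_def stock_def
proof (rule card_mono)
  show "finite {C. C \<subseteq> A \<and> card C = j \<and> clique_comp E C}"
    by (rule finite_subset[of _ "Pow A"]) (use assms(2) in auto)
  show "{C \<in> P. card C = j} \<subseteq> {C. C \<subseteq> A \<and> card C = j \<and> clique_comp E C}"
  proof safe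
    fix C x assume C: "C \<in> P" "j = card C"
    show "x \<in> A" if "x \<in> C" using part_sub[OF P(1) C(1)] that by blast
    show "clique_comp E C" using clique_comp_part[OF P(1,3) C(1)] assms(4) C by simp
  qed
qed

lemma clique_arm:
  assumes "all_edges C \<subseteq> E" "x \<in> C" "finite C" "j < card C"
  obtains xs where "ispath E (x # xs)" "length xs = j" "set (x # xs) \<subseteq> C"
proof -
  obtain zs where zs: "distinct (x # zs)" "set (x # zs) = C" "length zs = card C - 1"
    using enum_from[OF assms(3,2)] .
  have "set (x # take j zs) \<subseteq> C" using zs set_take_subset[of j zs] by auto
  moreover have "ispath E (x # take j zs)"
    using zs set_take_subset[of j zs]
    by (intro clique_ispath[OF assms(1)]) auto
  ultimately show thesis using that[of "take j zs"] zs assms(4) by auto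
qed

text \<open>\<open>x\<close> keeps the arm \<open>xs\<close> inside its own class and gains
  \<open>y # ys\<close> across the new edge; the class \<open>K'\<close> separates the two.\<close>

lemma cut_join:
  assumes P: "partition_on A P" "E \<subseteq> clq P" and K: "K \<in> P" "K' \<in> P" "K \<noteq> K'"
    and x: "x \<in> K" "ispath E (x # xs)" "length xs = j"
    and y: "y \<in> K'" "ispath E (y # ys)" "Suc (length ys) = j"
  shows "cut (insert {x, y} E) x j"
proof -
  have dis: "K \<inter> K' = {}" using part_disjoint[OF P(1) K] .
  have xs: "set (x # xs) \<subseteq> K" using ispath_part[OF P x(2,1) K(1)] .
  have ys: "set (y # ys) \<subseteq> K'" using ispath_part[OF P y(2,1) K(2)] .
  have cl: "closed_upto (insert {x, y} E) {x} K'"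
    using closed_upto_weaken[OF closed_part[OF P K(2)], of "{x}"] dis x(1)
    by (intro closed_upto_insert) auto
  have px: "ispath (insert {x, y} E) (x # xs)" using x(2) by (rule ispath_mono) auto
  have "ispath (insert {x, y} E) (y # ys)" using y(2) by (rule ispath_mono) auto
  then have py: "ispath (insert {x, y} E) (x # y # ys)"
    using ys dis x(1) by (subst ispath_Cons) auto
  show ?thesis unfolding cut_def
    by (rule exI[of _ K'], rule exI[of _ "y # ys"], rule exI[of _ xs])
      (use cl px py xs ys dis x y in auto)
qed

context path_game
begin

lemma pos_part:
  assumes "partition_on V P" "E \<subseteq> clq P" "\<And>C. C \<in> P \<Longrightarrow> card C < k"
  shows "pos E"
  unfolding pos_def pfree_def
proof (intro conjI allI impI)
  show E: "E \<subseteq> all_edges V" using assms clq_sub by blast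
  fix xs assume xs: "ispath E xs"
  show "length xs < k"
  proof (cases "2 \<le> length xs")
    case True
    then obtain x ys where x: "xs = x # ys" by (cases xs) auto
    then have "x \<in> V" using ispath_subset[OF xs True E] by auto
    then obtain C where C: "C \<in> P" "x \<in> C" using part_ex[OF assms(1)] by blast
    have "set xs \<subseteq> C" using ispath_part[OF assms(1,2) _ C(2,1)] xs x by blast
    moreover have "finite C" using part_sub[OF assms(1) C(1)] finite_subset by blast
    ultimately have "length xs \<le> card C" using ispath_length[OF xs] by blast
    with assms(3)[OF C(1)] show ?thesis by simp
  qed (use k4 in auto)
qed

text \<open>The reply \<open>p q\<close> with \<open>p \<in> X\<close> and \<open>q \<in> B\<close> leaves \<open>t\<close> as a cut vertex if \<open>q = t\<close>; otherwise there
  is a path on \<open>k\<close> vertices from \<open>a\<close> through \<open>v\<close>, \<open>t\<close>, all of \<open>B\<close>, \<open>q\<close>, \<open>p\<close> and all of \<open>X\<close>.\<close>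

lemma maxi_gadget:
  assumes E: "pos E" and av: "{a, v} \<in> E" "a \<noteq> v" "closed_upto E {v} {a}"
    and X: "closed_upto E {v} X" "v \<notin> X" "a \<notin> X" "finite X" "nbh E v \<subseteq> insert a X"
    and x: "ispath E [v, x0, x1]" "x0 \<in> X" "x1 \<in> X"
    and span: "\<And>p. p \<in> X \<Longrightarrow> \<exists>zs. ispath E (p # zs) \<and> set (p # zs) = X"
    and B: "clique_comp E B" "B \<subseteq> V" "3 \<le> card B" "v \<notin> B"
    and k: "card X + card B + 2 = k" and s: "s + 4 \<le> stock V E 2"
    and \<Phi>: "\<And>E' u. pos E' \<Longrightarrow> E \<subseteq> E' \<Longrightarrow> s \<le> 3 * deg E' u \<Longrightarrow> \<Phi> E'"
  shows "maxi \<Phi> Max_player E"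
proof -
  have clB: "closed_upto E {} B" "all_edges B \<subseteq> E" using B by (auto simp: clique_comp_def)
  have finB: "finite B" using B finite_subset by blast
  obtain t where t: "t \<in> B" using B(3) by (cases "B = {}") auto
  obtain ts where ts: "ispath E (t # ts)" "length ts = 2" "set (t # ts) \<subseteq> B"
    using clique_arm[OF clB(2) t finB, of 2] B(3) by auto
  then obtain b1 b2 where b: "ts = [b1, b2]" by (auto simp: length_Suc_conv numeral_2_eq_2)
  have aB: "a \<notin> B" using closed_uptoD[OF clB(1) av(1)] B(4) by auto
  have x0B: "x0 \<notin> B" using ispath_closed[OF clB(1) x(1)] B(4) by auto
  have XB: "X \<inter> B = {}"
  proof (rule ccontr)
    assume "X \<inter> B \<noteq> {}"
    then obtain p where p: "p \<in> X" "p \<in> B" by blast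
    obtain zs where zs: "ispath E (p # zs)" "set (p # zs) = X" using span p(1) by blast
    have "set (p # zs) \<subseteq> B" using ispath_closed[OF clB(1) zs(1)] p by auto
    then show False using zs(2) x(2) x0B by blast
  qed
  have vV: "v \<in> V" "a \<in> V" using av(1) posD(1)[OF E] by (auto dest: subsetD)
  define F where "F = insert {v, t} E"
  have EF: "E \<subseteq> F" by (auto simp: F_def)
  have vt: "v \<noteq> t" using B(4) t by auto
  have cX: "2 \<le> card X"
  proof -
    have "card {x0, x1} \<le> card X" using x X(4) by (intro card_mono) auto
    moreover have "x0 \<noteq> x1" using x(1) by (simp add: ispath_Cons)
    ultimately show ?thesis by simp
  qed
  \<comment> \<open>Beyond \<open>v\<close> a path continues either to \<open>a\<close> alone or
    into \<open>X\<close>, so a path through \<open>v t\<close> has at most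
    \<open>card B + 1 + card X = k - 1\<close> vertices.\<close>
  have "pfree k F" unfolding F_def
  proof (rule pfree_insertI[OF posD(2)[OF E]])
    fix Q1 Q2 assume Q1: "ispath E (Q1 @ [t])" and Q2: "ispath E (v # Q2)"
    have "set (Q1 @ [t]) \<subseteq> B" using ispath_closed[OF clB(1) Q1] t by auto
    from ispath_length[OF Q1 this finB] have l1: "Suc (length Q1) \<le> card B" by simp
    have pQ2: "ispath E Q2" "set Q2 \<inter> {v} = {}" using Q2 by (auto simp: ispath_Cons)
    have "length Q2 \<le> card X"
    proof (cases "Q2 = []")
      case False
      then have "{v, hd Q2} \<in> E" using Q2 by (simp add: ispath_Cons)
      then have hd: "hd Q2 \<in> insert a X" using X(5) by (auto simp: nbh_def)
      show ?thesis
      proof (cases "hd Q2 = a")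
        case True
        then have "set Q2 \<subseteq> {a}" using ispath_closed[OF av(3) pQ2] False hd_in_set[OF False] by auto
        from ispath_length[OF pQ2(1) this] cX show ?thesis by simp
      next
        case False
        then have "set Q2 \<subseteq> X" using ispath_closed[OF X(1) pQ2] hd hd_in_set[OF \<open>Q2 \<noteq> []\<close>] by auto
        from ispath_length[OF pQ2(1) this X(4)] show ?thesis .
      qed
    qed simp
    then show "length (Q1 @ t # v # Q2) < k" using l1 k by simp
  qed
  moreover have "{v, t} \<notin> E" using closed_uptoD[OF clB(1), of t v] t B(4) by (auto simp: insert_commute)
  ultimately have leg: "{v, t} \<in> legal E"
    using vV t B(2) vt by (subst legal_iff[OF E]) (auto simp: F_def)
  then have posF: "pos F" using legal_pos[OF E] by (simp add: F_def)
  have reply: "\<exists>u. cut (insert {p, q} F) u 2" if G: "pos (insert {p, q} F)" for p q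
  proof -
    define G where "G = insert {p, q} F"
    have EG: "E \<subseteq> G" and FG: "F \<subseteq> G" using EF by (auto simp: G_def)
    have pv: "ispath G [v, x0, x1]" using x(1) EG ispath_mono by blast
    have "ispath G (t # ts)" using ts(1) EG ispath_mono by blast
    then have pt: "ispath G [v, t, b1]" "ispath G [t, b1, b2]"
      using b ts B(4) FG by (auto simp: ispath_Cons F_def)
    have bs: "b1 \<in> B" "b2 \<in> B" "b1 \<noteq> t" "b2 \<noteq> t" using ts b by (auto simp: ispath_Cons)
    consider p' q' where "{p', q'} = {p, q}" "p' \<in> X" "q' \<in> B" |
       "\<And>p' q'. {p', q'} = {p, q} \<Longrightarrow> p' \<in> X \<Longrightarrow> q' \<notin> B" by blast
    then show ?thesis
    proof cases
      case (1 p' q')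
      have Geq: "G = insert {p', q'} F" using 1 by (simp add: G_def)
      show ?thesis
      proof (cases "q' = t")
        case True
        \<comment> \<open>The reply ends in \<open>t\<close>, so \<open>B - {t}\<close> is still
          reached only through \<open>t\<close>; the arms of \<open>t\<close> are
          \<open>b1 b2\<close> and \<open>v a\<close>.\<close>
        have "closed_upto E {t} (B - {t})"
          using clB(1) unfolding closed_upto_def by auto
        then have "closed_upto G {t} (B - {t})"
          unfolding Geq F_def using True 1 XB B(4) by (intro closed_upto_insert) auto
        moreover have "ispath G [t, v, a]"
          using vt av FG aB t by (auto simp: ispath_Cons F_def insert_commute)
        ultimately have "cut G t 2" unfolding cut_def
          by (intro exI[of _ "B - {t}"] exI[of _ "[b1, b2]"] exI[of _ "[v, a]"])
            (use pt bs B(4) aB in auto)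
        then show ?thesis by (auto simp: G_def)
      next
        case False
        obtain ms where ms: "distinct ms" "set ms = B - {t, q'}"
          using finite_distinct_list[of "B - {t, q'}"] finB by auto
        obtain zs where zs: "ispath E (p' # zs)" "set (p' # zs) = X" using span 1 by blast
        have pB: "ispath E (t # ms @ [q'])"
          using ms False 1 t by (intro clique_ispath[OF clB(2)]) auto
        have sB: "set (t # ms @ [q']) = B" using ms t 1 by auto
        have lB: "length (t # ms @ [q']) = card B"
          using pB sB by (metis distinct_card ispath_def)
        have lX: "length (p' # zs) = card X" using zs by (metis distinct_card ispath_def)
        have "{q', p'} \<in> G" by (simp add: Geq insert_commute)
        then have "ispath G ((t # ms @ [q']) @ (p' # zs))"
          unfolding ispath_append[of G "t # ms @ [q']"]
          using ispath_mono[OF pB EG] ispath_mono[OF zs(1) EG] XB sB zs(2) by auto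
        moreover have "{v, t} \<in> G" "{a, v} \<in> G" using FG EG av(1) by (auto simp: F_def)
        moreover have "v \<notin> set ((t # ms @ [q']) @ (p' # zs))" "a \<notin> set ((t # ms @ [q']) @ (p' # zs))"
          unfolding set_append sB zs(2) using X B(4) aB by auto
        ultimately have "ispath G (a # v # (t # ms @ [q']) @ (p' # zs))"
          using av(2) by (auto simp: ispath_Cons)
        moreover have "length (a # v # (t # ms @ [q']) @ (p' # zs)) = k"
          using lB lX k by simp
        ultimately show ?thesis using pfreeD[OF posD(2)[OF G[folded G_def]]] by fastforce
      qed
    next
      \<comment> \<open>No edge joins \<open>X\<close> to \<open>B\<close>. If the reply leaves
        \<open>X\<close>, it avoids \<open>B\<close>; so one of the two is still closed up to
        \<open>v\<close> and separates the arms \<open>x0 x1\<close> and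
        \<open>t b1\<close>.\<close>
      case 2
      have clXF: "closed_upto F {v} X"
        unfolding F_def using X(1,2) XB t by (intro closed_upto_insert) auto
      show ?thesis
      proof (cases "closed_upto G {v} X")
        case True
        then have "cut G v 2" unfolding cut_def
          by (intro exI[of _ X] exI[of _ "[x0, x1]"] exI[of _ "[t, b1]"])
            (use pv pt x X XB t bs in auto)
        then show ?thesis by (auto simp: G_def)
      next
        case False
        then obtain p' q' where pq: "{p', q'} \<in> G" "p' \<in> X" "q' \<notin> X \<union> {v}"
          by (auto simp only: closed_upto_def)
        then have "{p', q'} \<notin> F" using closed_uptoD[OF clXF] by blast
        then have e: "{p', q'} = {p, q}" using pq by (simp add: G_def)
        then have Geq: "G = insert {p', q'} F" by (simp add: G_def)
        have "closed_upto G {v} B"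
          unfolding Geq F_def using 2[OF e] pq XB closed_upto_weaken[OF clB(1), of "{v}"] B(4)
          by (intro closed_upto_insert) auto
        then have "cut G v 2" unfolding cut_def
          by (intro exI[of _ B] exI[of _ "[t, b1]"] exI[of _ "[x0, x1]"])
            (use pv pt x X XB t bs B(4) in auto)
        then show ?thesis by (auto simp: G_def)
      qed
    qed
  qed
  have "maxi \<Phi> Mini_player F"
  proof (rule maxi_opp[OF posF])
    fix p q assume G: "pos (insert {p, q} F)"
    obtain u where u: "cut (insert {p, q} F) u 2" using reply[OF G] by blast
    show "maxi \<Phi> Max_player (insert {p, q} F)"
    proof (rule maxi_cut[OF G u])
      show "s \<le> stock V (insert {p, q} F) 2"
        using s stock_insert2[of V E 2 v t] stock_insert2[of V F 2 p q] by (simp add: F_def)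
    qed (use \<Phi> EF in auto)
  next
    assume no: "legal F = {}"
    \<comment> \<open>Replaying \<open>v t\<close> changes nothing, so \<open>reply\<close> yields a
      cut vertex of \<open>F\<close> itself and the game cannot be over.\<close>
    have "insert {v, t} F = F" by (simp add: F_def)
    then obtain u where "cut F u 2" using reply[of v t] posF by auto
    moreover have "1 \<le> stock V F 2" using s stock_insert2[of V E 2 v t] by (simp add: F_def)
    ultimately show "\<Phi> F" using cut_legal[OF posF, of u 2] no by auto
  qed
  then show ?thesis using leg by (intro maxi_own[OF leg]) (simp add: F_def)
qed

end

text \<open>\<open>covered\<close> and \<open>reach\<close> supply arms on one and on two vertices
  in classes that need not be complete. Both survive the insertion of edges.\<close>

definition covered :: "'a set set \<Rightarrow> 'a set set \<Rightarrow> bool" where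
  "covered P E \<longleftrightarrow> (\<forall>C\<in>P. 2 \<le> card C \<longrightarrow> (\<forall>x\<in>C. \<exists>y. {x, y} \<in> E))"

definition reach :: "'a set set \<Rightarrow> 'a set set \<Rightarrow> bool" where
  "reach P E \<longleftrightarrow> (\<forall>C\<in>P. 3 \<le> card C \<longrightarrow> (\<forall>x\<in>C. \<exists>y z. ispath E [x, y, z]))"

lemma covered_mono: "covered P E \<Longrightarrow> E \<subseteq> E' \<Longrightarrow> covered P E'"
  unfolding covered_def by (meson subsetD)

lemma reach_mono: "reach P E \<Longrightarrow> E \<subseteq> E' \<Longrightarrow> reach P E'"
  unfolding reach_def by (meson ispath_mono)

lemma length_2E:
  assumes "length xs = 2"
  obtains a b where "xs = [a, b]"
  using assms by (auto simp: length_Suc_conv numeral_2_eq_2)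

lemma covered_clq: "covered P (clq P)"
  unfolding covered_def
proof (intro ballI impI)
  fix C x assume C: "C \<in> P" "2 \<le> card C" "x \<in> C"
  then have "finite C" by (metis card.infinite not_numeral_le_zero)
  from clique_arm[OF all_edges_clq[OF C(1)] C(3) this, of 1] C(2)
  obtain xs where "ispath (clq P) (x # xs)" "length xs = 1" by auto
  then show "\<exists>y. {x, y} \<in> clq P" by (cases xs) (auto simp: ispath_Cons)
qed

lemma reach_clq: "reach P (clq P)"
  unfolding reach_def
proof (intro ballI impI)
  fix C x assume C: "C \<in> P" "3 \<le> card C" "x \<in> C"
  then have "finite C" by (metis card.infinite not_numeral_le_zero)
  from clique_arm[OF all_edges_clq[OF C(1)] C(3) this, of 2] C(2)
  obtain xs where "ispath (clq P) (x # xs)" "length xs = 2" by auto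
  then show "\<exists>y z. ispath (clq P) [x, y, z]" by (metis length_2E)
qed

lemma covered_edge:
  assumes "partition_on A P" "E \<subseteq> clq P" "covered P E" "C \<in> P" "card C = 2"
  shows "all_edges C \<subseteq> E"
proof
  fix e assume "e \<in> all_edges C"
  then obtain u v where e: "e = {u, v}" "u \<in> C" "v \<in> C" "u \<noteq> v" by (rule all_edgesE)
  then obtain y where y: "{u, y} \<in> E" using assms(3,4,5) unfolding covered_def by fastforce
  then have "y \<in> C" using clq_edgeE[OF assms(1,2) y e(2) assms(4)] by simp
  moreover have "y \<noteq> u" using y assms(2) by (metis clq_pair subsetD)
  moreover obtain a b where "C = {a, b}" using assms(5) by (meson card_2_iff)
  ultimately have "y = v" using e by auto
  then show "e \<in> E" using y e by simp
qed

lemma clq_cross: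
  assumes "partition_on A P" "C \<in> P" "D \<in> P" "C \<noteq> D" "p \<in> C" "q \<in> D"
  shows "{p, q} \<notin> clq P"
proof
  assume "{p, q} \<in> clq P"
  then have "q \<in> C" by (rule clq_edgeE[OF assms(1) order_refl _ assms(5,2)])
  then show False using part_disjoint[OF assms(1-4)] assms(6) by auto
qed

section \<open>Strategies of Max on positions tracked by a partition\<close>

context path_game
begin

text \<open>A cut vertex with \<open>s\<close> components left to attach reaches degree \<open>s / 3\<close>, since in each round Max uses
  up one of them and Mini destroys at most two.\<close>

definition dgoal :: "(nat set set \<Rightarrow> bool) \<Rightarrow> nat set set \<Rightarrow> nat \<Rightarrow> bool" where
  "dgoal \<Phi> E0 s \<longleftrightarrow> (\<forall>E' u. pos E' \<longrightarrow> E0 \<subseteq> E' \<longrightarrow> s \<le> 3 * deg E' u \<longrightarrow> \<Phi> E')"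

text \<open>A path stays inside a class, so if all classes have fewer than \<open>k\<close>
  vertices, legality within and between classes depends on class sizes only.\<close>

definition part :: "nat set set \<Rightarrow> bool" where
  "part P \<longleftrightarrow> partition_on V P \<and> (\<forall>C\<in>P. card C < k)"

lemma partD: "part P \<Longrightarrow> partition_on V P" "part P \<Longrightarrow> C \<in> P \<Longrightarrow> card C < k"
  by (auto simp: part_def)

lemma part_fin: "part P \<Longrightarrow> finite P" "part P \<Longrightarrow> C \<in> P \<Longrightarrow> finite C"
  using partD part_finite part_sub finite_subset by (metis finite_lessThan)+

lemma part_pos: "part P \<Longrightarrow> E \<subseteq> clq P \<Longrightarrow> pos E"
  using pos_part partD by blast

lemma pos_ispath: "pos E \<Longrightarrow> {p, q} \<in> E \<Longrightarrow> ispath E [p, q]"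
proof -
  assume "pos E" "{p, q} \<in> E"
  then have "{p, q} \<in> all_edges V" using posD(1) by blast
  with \<open>{p, q} \<in> E\<close> show ?thesis by (auto simp: ispath_Cons)
qed

lemma part_card: "part P \<Longrightarrow> C \<in> P \<Longrightarrow> 1 \<le> card C"
  using part_fin part_ne[OF partD(1)] by (metis One_nat_def Suc_leI card_gt_0_iff)

lemma part_merge:
  "part P \<Longrightarrow> C \<in> P \<Longrightarrow> D \<in> P \<Longrightarrow> card C + card D < k \<Longrightarrow> part (merge P C D)"
  using partition_merge[of V P C D] card_Un_le[of C D] by (auto simp: part_def merge_def)

lemma legal_merge:
  assumes "part P" "E \<subseteq> clq P" "C \<in> P" "D \<in> P" "C \<noteq> D" "card C + card D < k" "p \<in> C" "q \<in> D"
  shows "{p, q} \<in> legal E"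
proof -
  have ne: "p \<noteq> q" using part_disjoint[OF partD(1)[OF assms(1)] assms(3,4,5)] assms(7,8) by auto
  have "insert {p, q} E \<subseteq> clq (merge P C D)"
    using assms ne by (intro clq_merge_insert)
  then have "pos (insert {p, q} E)" by (rule part_pos[OF part_merge[OF assms(1,3,4,6)]])
  moreover have "{p, q} \<notin> E"
  proof
    assume "{p, q} \<in> E"
    then have "q \<in> C" by (rule clq_edgeE[OF partD(1)[OF assms(1)] assms(2) _ assms(7,3)])
    then show False using part_disjoint[OF partD(1)[OF assms(1)] assms(3,4,5)] assms(8) by auto
  qed
  ultimately show ?thesis
    using part_pos[OF assms(1,2)] by (subst legal_iff) (auto simp: pos_def)
qed

lemma legal_inside:
  assumes "part P" "E \<subseteq> clq P" "e \<in> clq P" "e \<notin> E"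
  shows "e \<in> legal E"
proof -
  have "pos (insert e E)" using assms by (intro part_pos[of P]) auto
  then show ?thesis using part_pos[OF assms(1,2)] assms(4) by (subst legal_iff) (auto simp: pos_def)
qed

lemma move_cases:
  assumes "part P" "p \<in> V" "q \<in> V" "p \<noteq> q"
  obtains "{p, q} \<in> clq P" | C D where "C \<in> P" "D \<in> P" "C \<noteq> D" "p \<in> C" "q \<in> D"
proof -
  obtain C D where "C \<in> P" "p \<in> C" "D \<in> P" "q \<in> D"
    using part_ex[OF partD(1)[OF assms(1)]] assms(2,3) by metis
  then show thesis using that assms(4) by (cases "C = D") (auto simp: clq_pair)
qed

lemma two_of_size:
  assumes "part P" "2 \<le> cnt P i"
  obtains C D where "C \<in> P" "D \<in> P" "C \<noteq> D" "card C = i" "card D = i"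
proof -
  obtain C where "C \<in> P" "card C = i" using assms cnt_pos[OF part_fin(1)[OF assms(1)], of i] by auto
  moreover obtain D where "D \<in> P" "card D = i" "D \<notin> {C}"
    using ex_cnt_avoid[of "{C}" P i] assms by auto
  ultimately show thesis using that by auto
qed

text \<open>Two classes of size \<open>i\<close> can be joined. This settles the end-of-game case
  whenever Mini is to move.\<close>

lemma legal_nonempty:
  assumes "part P" "E \<subseteq> clq P" "2 \<le> cnt P i" "2 * i < k"
  shows "legal E \<noteq> {}"
proof -
  obtain C D where "C \<in> P" "D \<in> P" "C \<noteq> D" "card C = i" "card D = i"
    using two_of_size[OF assms(1,3)] .
  moreover from this obtain p q where "p \<in> C" "q \<in> D"
    using part_ne[OF partD(1)[OF assms(1)]] by (metis ex_in_conv)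
  ultimately show ?thesis using legal_merge[OF assms(1,2), of C D p q] assms(4) by auto
qed

lemma stock_singles: "part P \<Longrightarrow> E \<subseteq> clq P \<Longrightarrow> cnt P 1 \<le> stock V E 1"
proof (rule stock_part)
  fix C :: "nat set" assume "card C = 1"
  then show "all_edges C \<subseteq> E" by (auto simp: all_edges_def card_1_singleton_iff)
qed (auto simp: part_def)

lemma stock_pairs: "part P \<Longrightarrow> E \<subseteq> clq P \<Longrightarrow> covered P E \<Longrightarrow> cnt P 2 \<le> stock V E 2"
  by (rule stock_part) (auto simp: part_def dest: covered_edge[rotated 3])

lemma maxi_cut_goal:
  assumes "pos E" "cut E v j" "1 \<le> j" "s \<le> stock V E j" "dgoal \<Phi> E0 s" "E0 \<subseteq> E"
  shows "maxi \<Phi> Max_player E"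
  by (rule maxi_cut[OF assms(1-4)]) (use assms(5,6) in \<open>auto simp: dgoal_def\<close>)

lemma maxi_join:
  assumes P: "part P" "E \<subseteq> clq P" and K: "K \<in> P" "K' \<in> P" "K \<noteq> K'"
    and x: "x \<in> K" "ispath E (x # xs)" "length xs = j"
    and y: "y \<in> K'" "ispath E (y # ys)" "Suc (length ys) = j"
    and s: "s + 2 \<le> stock V E j" and \<Phi>: "dgoal \<Phi> E0 s" "E0 \<subseteq> E" and pos: "pos (insert {x, y} E)"
  shows "maxi \<Phi> Max_player (insert {x, y} E)"
  using cut_join[OF partD(1)[OF P(1)] P(2) K x y] y(3) s stock_insert2[of V E j x y] \<Phi>
  by (intro maxi_cut_goal[OF pos, of x j s]) auto

text \<open>One of the two ends has a neighbour in its own class; this neighbour and the other end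
  are two arms on one vertex, to be used with isolated vertices. The joining edge itself spoils at
  most two of them, hence \<open>s + 2\<close>.\<close>

lemma maxi_join1:
  assumes P: "part P" "E \<subseteq> clq P" "covered P E" and K: "C \<in> P" "D \<in> P" "C \<noteq> D"
    and pq: "p \<in> C" "q \<in> D" and ns: "\<not> (card C = 1 \<and> card D = 1)"
    and s: "s + 2 \<le> cnt P 1" and \<Phi>: "dgoal \<Phi> E0 s" "E0 \<subseteq> E" and pos: "pos (insert {p, q} E)"
  shows "maxi \<Phi> Max_player (insert {p, q} E)"
proof -
  have s': "s + 2 \<le> stock V E 1" using s stock_singles[OF P(1,2)] by simp
  have "2 \<le> card C \<or> 2 \<le> card D"
    using ns part_card[OF P(1) K(1)] part_card[OF P(1) K(2)] by linarith
  then show ?thesis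
  proof
    assume "2 \<le> card C"
    then obtain y where y: "{p, y} \<in> E" using P(3) K pq by (auto simp: covered_def)
    then have "ispath E [p, y]" by (rule pos_ispath[OF part_pos[OF P(1,2)]])
    then show ?thesis
      using maxi_join[OF P(1,2) K pq(1), of "[y]" 1 q "[]"] pq s' \<Phi> pos by simp
  next
    assume "2 \<le> card D"
    then obtain y where y: "{q, y} \<in> E" using P(3) K pq by (auto simp: covered_def)
    then have "ispath E [q, y]" by (rule pos_ispath[OF part_pos[OF P(1,2)]])
    then show ?thesis
      using maxi_join[OF P(1,2) K(2,1) K(3)[symmetric] pq(2), of "[y]" 1 p "[]"] pq s' \<Phi> pos
      by (simp add: insert_commute)
  qed
qed

text \<open>\<open>p\<close> has an arm on two vertices in its own class, and \<open>q\<close> with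
  a neighbour is another one, so isolated edges can be attached at \<open>p\<close>.\<close>

lemma maxi_join2:
  assumes P: "part P" "E \<subseteq> clq P" "covered P E" "reach P E" and K: "C \<in> P" "D \<in> P" "C \<noteq> D"
    and pq: "p \<in> C" "q \<in> D" and ns: "3 \<le> card C" "2 \<le> card D"
    and s: "s + 2 \<le> cnt P 2" and \<Phi>: "dgoal \<Phi> E0 s" "E0 \<subseteq> E" and pos: "pos (insert {p, q} E)"
  shows "maxi \<Phi> Max_player (insert {p, q} E)"
proof -
  have s': "s + 2 \<le> stock V E 2" using s stock_pairs[OF P(1,2,3)] by simp
  obtain y z where "ispath E [p, y, z]" using P(4) K(1) pq(1) ns(1) unfolding reach_def by blast
  moreover obtain w where w: "{q, w} \<in> E" using P(3) K(2) pq(2) ns(2) unfolding covered_def by blast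
  moreover from this have "ispath E [q, w]" by (rule pos_ispath[OF part_pos[OF P(1,2)]])
  ultimately show ?thesis
    using maxi_join[OF P(1,2) K pq(1), of "[y, z]" 2 q "[w]"] pq s' \<Phi> pos by simp
qed

lemma merge_singles:
  assumes P: "part P" and C: "{p} \<in> P" "{q} \<in> P" "p \<noteq> q"
  defines "P' \<equiv> merge P {p} {q}"
  shows "part P'" "clq P' = insert {p, q} (clq P)" "cnt P' 1 + 2 = cnt P 1" "cnt P' 2 = cnt P 2 + 1"
    "\<And>i. 3 \<le> i \<Longrightarrow> cnt P' i = cnt P i" "{p, q} \<in> legal (clq P)"
proof -
  have cm: "cnt P' i + of_bool (1 = i) + of_bool (1 = i) = cnt P i + of_bool (2 = i)" for i
    using cnt_merge[OF partD(1)[OF P] _ C(1,2), of i] C(3) by (simp add: P'_def numeral_2_eq_2)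
  show "part P'" using part_merge[OF P C(1,2)] k4 by (simp add: P'_def)
  show "clq P' = insert {p, q} (clq P)"
    using clq_merge[OF C(1,2)] clq_merge_insert[of p "{p}" q "{q}" "clq P" P] C(3) by (auto simp: P'_def)
  show "cnt P' 1 + 2 = cnt P 1" "cnt P' 2 = cnt P 2 + 1"
    using cm[of 1] cm[of 2] by auto
  show "cnt P' i = cnt P i" if "3 \<le> i" for i using cm[of i] that by simp
  show "{p, q} \<in> legal (clq P)"
    using legal_merge[OF P order_refl C(1,2)] C(3) k4 by simp
qed

lemma maxi_pair:
  assumes P: "part P" "2 \<le> cnt P 1"
    and cont: "\<And>P'. part P' \<Longrightarrow> cnt P' 1 + 2 = cnt P 1 \<Longrightarrow> cnt P' 2 = cnt P 2 + 1 \<Longrightarrow>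
      (\<And>i. 3 \<le> i \<Longrightarrow> cnt P' i = cnt P i) \<Longrightarrow> clq P \<subseteq> clq P' \<Longrightarrow> maxi \<Phi> Mini_player (clq P')"
  shows "maxi \<Phi> Max_player (clq P)"
proof -
  obtain C D where "C \<in> P" "D \<in> P" "C \<noteq> D" "card C = 1" "card D = 1" using two_of_size[OF P] .
  then obtain p q where pq: "{p} \<in> P" "{q} \<in> P" "p \<noteq> q" by (auto simp: card_1_singleton_iff)
  note m = merge_singles[OF P(1) pq]
  show ?thesis using cont[OF m(1,3,4,5)] m(2,6) by (auto intro: maxi_own)
qed

text \<open>All classes are complete, so every move of Mini joins two of them, and joining two
  isolated vertices is the only join that \<open>maxi_join1\<close> does not punish.\<close>

lemma maxi_after_pair:
  assumes P: "part P" "s + 2 \<le> cnt P 1" "2 \<le> cnt P 1" and \<Phi>: "dgoal \<Phi> E0 s" "E0 \<subseteq> clq P"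
    and cont: "\<And>P'. part P' \<Longrightarrow> cnt P' 1 + 2 = cnt P 1 \<Longrightarrow> cnt P' 2 = cnt P 2 + 1 \<Longrightarrow>
      (\<And>i. 3 \<le> i \<Longrightarrow> cnt P' i = cnt P i) \<Longrightarrow> maxi \<Phi> Max_player (clq P')"
  shows "maxi \<Phi> Mini_player (clq P)"
proof (rule maxi_opp)
  show "pos (clq P)" using part_pos P by blast
  show "\<Phi> (clq P)" if "legal (clq P) = {}" using legal_nonempty[OF P(1) order_refl P(3)] that k4 by simp
  fix p q assume pq: "p \<in> V" "q \<in> V" "p \<noteq> q" "{p, q} \<notin> clq P" "pos (insert {p, q} (clq P))"
  obtain C D where C: "C \<in> P" "D \<in> P" "C \<noteq> D" "p \<in> C" "q \<in> D"
    by (rule move_cases[OF P(1) pq(1-3)]) (use pq(4) in simp)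
  show "maxi \<Phi> Max_player (insert {p, q} (clq P))"
  proof (cases "card C = 1 \<and> card D = 1")
    case True
    then have "{p} \<in> P" "{q} \<in> P" using C by (auto simp: card_1_singleton_iff)
    note m = merge_singles[OF P(1) this pq(3)]
    show ?thesis using cont[OF m(1,3,4,5)] m(2) by simp
  next
    case False
    then show ?thesis
      by (rule maxi_join1[OF P(1) order_refl covered_clq C _ P(2) \<Phi> pq(5)])
  qed
qed

text \<open>Max adds a missing edge in every round. Mini can add another one or make a new isolated
  edge, which is complete at once; \<open>f\<close> counts the latter. So at most one new edge
  appears per missing edge, at the price of two isolated vertices.\<close>

lemma maxi_fill:
  assumes \<Phi>: "dgoal \<Phi> E0 s"
    and "part P" "E \<subseteq> clq P" "covered P E" "E0 \<subseteq> E" "s + 2 * card (clq P - E) + 4 \<le> cnt P 1"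
    and "\<And>P' f. part P' \<Longrightarrow> f \<le> card (clq P - E) \<Longrightarrow> cnt P' 1 + 2 * f = cnt P 1 \<Longrightarrow>
      cnt P' 2 = cnt P 2 + f \<Longrightarrow> (\<And>i. 3 \<le> i \<Longrightarrow> cnt P' i = cnt P i) \<Longrightarrow> maxi \<Phi> Max_player (clq P')"
  shows "maxi \<Phi> Max_player E"
  using assms(2-)
proof (induction "card (clq P - E)" arbitrary: P E rule: less_induct)
  case less
  note P = less.prems(1-4)
  have finc: "finite (clq P - E)" for E
    using clq_sub[OF partD(1)[OF P(1)]] finite_all_edges[of V] finite_subset by blast
  show ?case
  proof (cases "clq P - E = {}")
    case True
    then have "E = clq P" using P by blast
    then show ?thesis using less.prems(6)[OF P(1), of 0] by simp
  next
    case False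
    then obtain e where e: "e \<in> clq P" "e \<notin> E" by blast
    have E1: "insert e E \<subseteq> clq P" using e P by blast
    have c1: "card (clq P - insert e E) + 1 = card (clq P - E)"
      using e finc by (metis DiffI Diff_insert Suc_eq_plus1 card_Suc_Diff1)
    have "maxi \<Phi> Mini_player (insert e E)"
    proof (rule maxi_opp)
      show pE: "pos (insert e E)" using part_pos[OF P(1) E1] .
      show "\<Phi> (insert e E)" if "legal (insert e E) = {}"
        using legal_nonempty[OF P(1) E1, of 1] that k4 less.prems(5) by simp
      fix p q assume pq: "p \<in> V" "q \<in> V" "p \<noteq> q" "{p, q} \<notin> insert e E" "pos (insert {p, q} (insert e E))"
      let ?F = "insert {p, q} (insert e E)"
      have cF: "covered P ?F" by (rule covered_mono[OF P(3)]) auto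
      from move_cases[OF P(1) pq(1-3)] show "maxi \<Phi> Max_player ?F"
      proof cases
        case 1
        have c2: "card (clq P - ?F) + 1 = card (clq P - insert e E)"
          using 1 pq(4) finc[of "insert e E"] card_Suc_Diff1[of "clq P - insert e E" "{p, q}"]
          by (simp add: Diff_insert[symmetric])
        show ?thesis
        proof (rule less.hyps[OF _ P(1)])
          show "card (clq P - ?F) < card (clq P - E)" using c1 c2 by simp
          show "s + 2 * card (clq P - ?F) + 4 \<le> cnt P 1" using c1 c2 less.prems(5) by simp
          show "maxi \<Phi> Max_player (clq P')" if "part P'" "f \<le> card (clq P - ?F)" "cnt P' 1 + 2 * f = cnt P 1"
            "cnt P' 2 = cnt P 2 + f" "\<And>i. 3 \<le> i \<Longrightarrow> cnt P' i = cnt P i" for P' f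
            using less.prems(6)[OF that(1) _ that(3,4,5)] that(2) c1 c2 by simp
        qed (use 1 E1 cF P(4) in auto)
      next
        case (2 C D)
        show ?thesis
        proof (cases "card C = 1 \<and> card D = 1")
          case True
          then have "{p} \<in> P" "{q} \<in> P" using 2 by (auto simp: card_1_singleton_iff)
          note m = merge_singles[OF P(1) this pq(3)]
          let ?P = "merge P {p} {q}"
          have nin: "{p, q} \<notin> clq P"
            by (rule clq_cross[OF partD(1)[OF P(1)] 2])
          \<comment> \<open>The new class of two vertices is completed by the very edge that creates
            it, so nothing is added to the list of missing edges.\<close>
          have eq: "clq ?P - ?F = clq P - insert e E" using m(2) nin by auto
          have cov: "covered ?P ?F" unfolding covered_def
          proof (intro ballI impI)
            fix X x assume X: "X \<in> ?P" "2 \<le> card X" "x \<in> X"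
            show "\<exists>y. {x, y} \<in> ?F"
            proof (cases "X \<in> P")
              case True then show ?thesis using X cF by (auto simp: covered_def)
            next
              case False
              then have "X = {p, q}" using X(1) by (auto simp: merge_def)
              then show ?thesis using X(3) by (auto simp: insert_commute)
            qed
          qed
          show ?thesis
          proof (rule less.hyps[OF _ m(1)])
            show "card (clq ?P - ?F) < card (clq P - E)" using c1 eq by simp
            show "s + 2 * card (clq ?P - ?F) + 4 \<le> cnt ?P 1" using eq c1 m(3) less.prems(5) by simp
            show "maxi \<Phi> Max_player (clq P')" if "part P'" "f \<le> card (clq ?P - ?F)" "cnt P' 1 + 2 * f = cnt ?P 1"
              "cnt P' 2 = cnt ?P 2 + f" "\<And>i. 3 \<le> i \<Longrightarrow> cnt P' i = cnt ?P i" for P' f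
              using less.prems(6)[OF that(1), of "f + 1"] that(2-5) c1 eq m(3,4,5) by simp
          qed (use m(2) E1 cov P(4) in auto)
        next
          case False
          show ?thesis
          proof (rule maxi_join1[OF P(1) E1 _ 2 False _ \<Phi> _ pq(5)])
            show "covered P (insert e E)" by (rule covered_mono[OF P(3)]) auto
          qed (use less.prems(5) P(4) in auto)
        qed
      qed
    qed
    with legal_inside[OF P(1,2) e] show ?thesis by (rule maxi_own)
  qed
qed

text \<open>Hanging an isolated vertex \<open>u\<close> on \<open>z\<close> makes \<open>z\<close> a
  cut vertex. Mini can repair this only by another edge from \<open>u\<close> to \<open>Q\<close>;
  then at most \<open>c - 2\<close> edges are missing from the enlarged clique, and
  \<open>maxi_fill\<close> completes it.\<close>

lemma maxi_grow:
  assumes P: "part P" and Q: "Q \<in> P" "card Q = c" "2 \<le> c" "Suc c < k"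
    and \<Phi>: "dgoal \<Phi> E0 s" "E0 \<subseteq> clq P" and s: "s + 2 * c + 8 \<le> cnt P 1"
    and cont: "\<And>P' f. part P' \<Longrightarrow> f \<le> c - 2 \<Longrightarrow> cnt P' 1 + 2 * f + 1 = cnt P 1 \<Longrightarrow>
      (\<And>i. 2 \<le> i \<Longrightarrow> cnt P' i + of_bool (i = c) = cnt P i + of_bool (i = Suc c) + of_bool (i = 2) * f) \<Longrightarrow>
      maxi \<Phi> Max_player (clq P')"
  shows "maxi \<Phi> Max_player (clq P)"
proof -
  have finP: "finite P" "finite Q" using part_fin P Q by auto
  obtain U where U: "U \<in> P" "card U = 1" using s cnt_pos[OF finP(1), of 1] by auto
  then obtain u where u: "U = {u}" by (auto simp: card_1_singleton_iff)
  have QU: "Q \<noteq> U" using U Q by auto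
  have uQ: "u \<notin> Q" using part_disjoint[OF partD(1)[OF P] Q(1) U(1) QU] u by auto
  obtain z where z: "z \<in> Q" using part_ne[OF partD(1)[OF P] Q(1)] by blast
  obtain y where y: "y \<in> Q" "y \<noteq> z"
    using Q(2,3) z by (metis card_le_Suc0_iff_eq finP(2) not_less_eq_eq numeral_2_eq_2)
  let ?P = "merge P Q U"
  let ?E = "insert {z, u} (clq P)"
  have P1: "part ?P" using part_merge[OF P Q(1) U(1)] Q U by simp
  have E1: "?E \<subseteq> clq ?P" using z uQ u by (intro clq_merge_insert) auto
  have cm: "cnt ?P i + of_bool (c = i) + of_bool (1 = i) = cnt P i + of_bool (Suc c = i)" for i
    using cnt_merge[OF partD(1)[OF P] _ Q(1) U(1) QU, of i] Q(2) U(2) by simp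
  have c1: "cnt ?P 1 + 1 = cnt P 1" using cm[of 1] Q(3) by simp
  have leg: "{z, u} \<in> legal (clq P)"
    using legal_merge[OF P order_refl Q(1) U(1) QU _ z, of u] u Q U by simp
  have nE: "{z, u} \<notin> clq P"
    using leg part_pos[OF P] by (simp add: legal_iff)
  have yz: "{z, y} \<in> clq P" using z y Q by (auto simp: clq_pair)
  have closedQ: "closed_upto (clq P) {z} Q" "closed_upto (clq P) {} {u}"
    using closed_upto_weaken[OF closed_part[OF partD(1)[OF P] order_refl Q(1)]]
      closed_part[OF partD(1)[OF P] order_refl U(1)] u by auto
  have "maxi \<Phi> Mini_player ?E"
  proof (rule maxi_opp)
    show "pos ?E" using part_pos[OF P1 E1] .
    show "\<Phi> ?E" if "legal ?E = {}"
      using legal_nonempty[OF P1 E1, of 1] that c1 s k4 by simp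
    fix p q assume pq: "p \<in> V" "q \<in> V" "p \<noteq> q" "{p, q} \<notin> ?E" "pos (insert {p, q} ?E)"
    let ?F = "insert {p, q} ?E"
    show "maxi \<Phi> Max_player ?F"
    proof (cases "{p, q} \<in> clq ?P")
      case True
      have F: "?F \<subseteq> clq ?P" using True E1 by auto
      have "clq ?P - clq P \<subseteq> (\<lambda>x. {x, u}) ` Q" using clq_merge[OF Q(1) U(1)] u by auto
      from card_mono[OF _ this] have "card (clq ?P - clq P) \<le> card ((\<lambda>x. {x, u}) ` Q)" using finP by simp
      also have "\<dots> \<le> c" using card_image_le[OF finP(2)] Q(2) by simp
      finally have le: "card (clq ?P - clq P) \<le> c" .
      have "clq ?P - ?F = (clq ?P - clq P) - {{z, u}, {p, q}}" by auto
      moreover have "{z, u} \<noteq> {p, q}" using pq(4) by auto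
      then have "card {{z, u}, {p, q}} = 2" by simp
      moreover have "{{z, u}, {p, q}} \<subseteq> clq ?P - clq P"
        using pq(4) nE F by auto
      \<comment> \<open>Of the at most \<open>c\<close> edges between \<open>u\<close> and
        \<open>Q\<close>, each player has claimed one.\<close>
      ultimately have m: "card (clq ?P - ?F) \<le> c - 2"
        using le by (simp add: card_Diff_subset)
      have "covered P ?F" by (rule covered_mono[OF covered_clq]) auto
      then have cov: "covered ?P ?F"
      proof -
        assume cP: "covered P ?F"
        show ?thesis unfolding covered_def
        proof (intro ballI impI)
          fix X x assume X: "X \<in> ?P" "2 \<le> card X" "x \<in> X"
          show "\<exists>y. {x, y} \<in> ?F"
          proof (cases "X \<in> P")
            case True then show ?thesis using X cP by (auto simp: covered_def)
          next
            case False
            then have "X = Q \<union> {u}" using X(1) u by (auto simp: merge_def)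
            then have "x \<in> Q \<or> x = u" using X(3) by auto
            then show ?thesis
            proof
              assume "x \<in> Q" then show ?thesis using cP Q by (auto simp: covered_def)
            next
              assume "x = u" then show ?thesis by (auto simp: insert_commute)
            qed
          qed
        qed
      qed
      show ?thesis
      proof (rule maxi_fill[OF \<Phi>(1) P1 F cov])
        show "E0 \<subseteq> ?F" using \<Phi>(2) by auto
        show "s + 2 * card (clq ?P - ?F) + 4 \<le> cnt ?P 1" using m s c1 by linarith
        fix P' f assume P': "part P'" "f \<le> card (clq ?P - ?F)" "cnt P' 1 + 2 * f = cnt ?P 1"
          "cnt P' 2 = cnt ?P 2 + f" "\<And>i. 3 \<le> i \<Longrightarrow> cnt P' i = cnt ?P i"
        show "maxi \<Phi> Max_player (clq P')"
        proof (rule cont[OF P'(1)])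
          show "f \<le> c - 2" using P'(2) m by simp
          show "cnt P' 1 + 2 * f + 1 = cnt P 1" using P'(3) c1 by simp
          fix i :: nat assume i: "2 \<le> i"
          show "cnt P' i + of_bool (i = c) = cnt P i + of_bool (i = Suc c) + of_bool (i = 2) * f"
          proof (cases "i = 2")
            case True then show ?thesis using cm[of 2] P'(4) by (auto simp: eq_commute of_bool_def)
          next
            case False then show ?thesis using cm[of i] P'(5)[of i] i by (auto simp: eq_commute of_bool_def)
          qed
        qed
      qed
    next
      case False
      have st: "s \<le> stock V ?F 1"
        using stock_singles[OF P order_refl] s stock_insert2[of V "clq P" 1 z u] stock_insert2[of V ?E 1 p q]
        by simp
      have pyz: "ispath ?F [z, y]" "ispath ?F [z, u]" using y yz uQ z by (auto simp: ispath_Cons)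
      \<comment> \<open>If the reply avoids \<open>u\<close>, the set \<open>{u}\<close> separates
        the arms. If it starts in \<open>u\<close>, it ends outside \<open>Q\<close>, and
        \<open>Q - {z}\<close> separates them.\<close>
      have "cut ?F z 1"
      proof (cases "u = p \<or> u = q")
        case ne: False
        have "closed_upto ?F {z} {u}"
          using closed_upto_weaken[OF closedQ(2)] ne by (intro closed_upto_insert) auto
        then show ?thesis unfolding cut_def
          by (intro exI[of _ "{u}"] exI[of _ "[u]"] exI[of _ "[y]"]) (use pyz uQ z y in auto)
      next
        case True
        have nQ: "p \<notin> Q" "q \<notin> Q"
          using True False uQ pq(3) u by (auto simp: clq_pair merge_def)
        have "closed_upto (clq P) {z} (Q - {z})"
          using closedQ(1) by (auto simp: closed_upto_def)
        then have "closed_upto ?F {z} (Q - {z})"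
          using nQ uQ by (intro closed_upto_insert) auto
        then show ?thesis unfolding cut_def
          by (intro exI[of _ "Q - {z}"] exI[of _ "[y]"] exI[of _ "[u]"]) (use pyz uQ z y in auto)
      qed
      then show ?thesis using st \<Phi> by (intro maxi_cut_goal[OF pq(5), of z 1 s]) auto
    qed
  qed
  with leg show ?thesis by (rule maxi_own)
qed

end

section \<open>Long paths: Max forces a vertex of linear degree\<close>

context path_game
begin

lemma clique_comp_edge:
  assumes P: "part P" "E \<subseteq> clq P" and B: "B \<in> P" "all_edges B \<subseteq> E" "B \<noteq> C" "B \<noteq> D" "C \<in> P" "D \<in> P"
    and pq: "p \<in> C" "q \<in> D"
  shows "clique_comp (insert {p, q} E) B"
  using part_disjoint[OF partD(1)[OF P(1)] B(1,5,3)] part_disjoint[OF partD(1)[OF P(1)] B(1,6,4)] pq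
  by (intro clique_comp_insert clique_comp_part[OF partD(1)[OF P(1)] P(2) B(1,2)]) auto

text \<open>In the path \<open>p' p q q'\<close> the vertex \<open>p\<close> has an arm on two
  vertices only towards \<open>q\<close>. The gadget applies with \<open>a = p'\<close>,
  \<open>v = p\<close> and \<open>X = D\<close>, and \<open>2 + (k - 4) + 2 = k\<close>.\<close>

lemma maxi_join_pairs:
  assumes P: "part P" "E \<subseteq> clq P" "covered P E" and C: "C \<in> P" "D \<in> P" "C \<noteq> D"
    and pq: "p \<in> C" "q \<in> D" and two: "card C = 2" "card D = 2"
    and B: "B \<in> P" "card B + 4 = k" "all_edges B \<subseteq> E" "3 \<le> card B"
    and s: "s + 6 \<le> cnt P 2" and \<Phi>: "dgoal \<Phi> E0 s" "E0 \<subseteq> E" and pos: "pos (insert {p, q} E)"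
  shows "maxi \<Phi> Max_player (insert {p, q} E)"
proof -
  note pP = partD(1)[OF P(1)]
  obtain p' where p': "C = {p, p'}" "p' \<noteq> p" using two(1) pq(1) by (auto simp: card_2_iff doubleton_eq_iff)
  obtain q' where q': "D = {q, q'}" "q' \<noteq> q" using two(2) pq(2) by (auto simp: card_2_iff doubleton_eq_iff)
  have dis: "C \<inter> D = {}" using part_disjoint[OF pP C] .
  have pp: "{p, p'} \<in> E" "{q, q'} \<in> E"
    using clique_edge[OF covered_edge[OF pP P(2,3) C(1) two(1)], of p p']
      clique_edge[OF covered_edge[OF pP P(2,3) C(2) two(2)], of q q'] p' q' by auto
  let ?F = "insert {p, q} E"
  have clC: "closed_upto E {} C" "closed_upto E {} D" using closed_part[OF pP P(2)] C by auto
  have "closed_upto E {p} {p'}"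
    using clC(1) p' by (auto simp: closed_upto_def)
  then have cl1: "closed_upto ?F {p} {p'}"
    using p' q' dis by (intro closed_upto_insert) auto
  have cl2: "closed_upto ?F {p} D"
    using closed_upto_weaken[OF clC(2)] p' dis by (intro closed_upto_insert) auto
  have notin: "p \<notin> D" "p' \<notin> D" using p'(1) dis by auto
  have nb: "nbh ?F p \<subseteq> insert p' D"
  proof
    fix y assume "y \<in> nbh ?F p"
    then have y: "{p, y} \<in> ?F" "y \<noteq> p" using nbh_subset[OF posD(1)[OF pos]] by (auto simp: nbh_def)
    show "y \<in> insert p' D"
    proof (cases "{p, y} \<in> E")
      case True
      then show ?thesis using closed_uptoD[OF clC(1) True pq(1)] y(2) p'(1) by auto
    next
      case False
      with y(1) have "{p, y} = {p, q}" by simp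
      then have "y = q" using y(2) unfolding doubleton_eq_iff by simp
      then show ?thesis using pq(2) by simp
    qed
  qed
  show ?thesis
  proof (rule maxi_gadget[OF pos, where v = p and a = p' and X = D and ?x0.0 = q and ?x1.0 = q' and B = B and s = s])
    show "{p', p} \<in> ?F" using pp by (simp add: insert_commute)
    show "ispath ?F [p, q, q']" using pp p' q' dis by (auto simp: ispath_Cons)
    have qq: "ispath ?F [q, q']" "ispath ?F [q', q]" using pp q' by (auto simp: ispath_Cons insert_commute)
    show "\<exists>zs. ispath ?F (x # zs) \<and> set (x # zs) = D" if "x \<in> D" for x
    proof (cases "x = q")
      case True then show ?thesis using qq(1) q'(1) by (intro exI[of _ "[q']"]) simp
    next
      case False
      then have "x = q'" using that q'(1) by simp
      then show ?thesis using qq(2) q'(1) by (intro exI[of _ "[q]"]) auto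
    qed
    have BCD: "B \<noteq> C" "B \<noteq> D" using B(4) two by auto
    show "clique_comp ?F B" by (rule clique_comp_edge[OF P(1,2) B(1,3) BCD C(1,2) pq])
    show "B \<subseteq> V" using part_sub[OF pP B(1)] .
    show "p \<notin> B" using part_disjoint[OF pP B(1) C(1) BCD(1)] pq by auto
    show "s + 4 \<le> stock V ?F 2"
      using s stock_pairs[OF P] stock_insert2[of V E 2 p q] by simp
    show "\<Phi> E'" if "pos E'" "?F \<subseteq> E'" "s \<le> 3 * deg E' u" for E' u
      using that \<Phi> by (auto simp: dgoal_def)
  qed (use cl1 cl2 nb notin q' p'(2) two(2) B(2,4) in simp_all)
qed

text \<open>The vertex \<open>z\<close> has only \<open>u\<close> as an arm outside its clique
  \<open>C\<close>. The gadget applies with \<open>a = u\<close>, \<open>v = z\<close> and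
  \<open>X = C - {z}\<close>, which explains the sum of the sizes of \<open>B\<close> and
  \<open>C\<close>.\<close>

lemma maxi_pendant:
  assumes P: "part P" "E \<subseteq> clq P" "covered P E" and C: "{u} \<in> P" "C \<in> P" "all_edges C \<subseteq> E" "3 \<le> card C"
    and z: "z \<in> C"
    and B: "B \<in> P" "B \<noteq> C" "card B + card C + 1 = k" "all_edges B \<subseteq> E" "3 \<le> card B"
    and s: "s + 6 \<le> cnt P 2" and \<Phi>: "dgoal \<Phi> E0 s" "E0 \<subseteq> E" and pos: "pos (insert {u, z} E)"
  shows "maxi \<Phi> Max_player (insert {u, z} E)"
proof -
  note pP = partD(1)[OF P(1)]
  have finC: "finite C" using part_fin P C by blast
  have uC: "{u} \<noteq> C" using C by auto
  have dis: "u \<notin> C" using part_disjoint[OF pP C(1,2) uC] by auto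
  let ?F = "insert {u, z} E"
  have clC: "closed_upto E {} {u}" "closed_upto E {} C" using closed_part[OF pP P(2)] C by auto
  have cl1: "closed_upto ?F {z} {u}"
    using closed_upto_weaken[OF clC(1)] by (intro closed_upto_insert) auto
  have "closed_upto E {z} (C - {z})" using clC(2) by (auto simp: closed_upto_def)
  then have cl2: "closed_upto ?F {z} (C - {z})"
    using dis by (intro closed_upto_insert) auto
  have nb: "nbh ?F z \<subseteq> insert u (C - {z})"
  proof
    fix y assume "y \<in> nbh ?F z"
    then have y: "{z, y} \<in> ?F" "y \<noteq> z" using nbh_subset[OF posD(1)[OF pos]] by (auto simp: nbh_def)
    show "y \<in> insert u (C - {z})"
    proof (cases "{z, y} \<in> E")
      case True
      then show ?thesis using closed_uptoD[OF clC(2) True z] y(2) by auto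
    next
      case False
      with y(1) have "{z, y} = {u, z}" by simp
      then have "y = u" using y(2) unfolding doubleton_eq_iff by simp
      then show ?thesis by simp
    qed
  qed
  obtain xs where xs: "ispath E (z # xs)" "length xs = 2" "set (z # xs) \<subseteq> C"
    using clique_arm[OF C(3) z finC, of 2] C(4) by auto
  then obtain x0 x1 where x: "xs = [x0, x1]" by (metis length_2E)
  have EF: "E \<subseteq> ?F" by auto
  show ?thesis
  proof (rule maxi_gadget[OF pos, where v = z and a = u and X = "C - {z}" and ?x0.0 = x0 and ?x1.0 = x1 and B = B and s = s])
    show "ispath ?F [z, x0, x1]" using ispath_mono[OF xs(1) EF] x by simp
    show "x0 \<in> C - {z}" "x1 \<in> C - {z}" using xs x by (auto simp: ispath_Cons)
    show "\<exists>zs. ispath ?F (y # zs) \<and> set (y # zs) = C - {z}" if y: "y \<in> C - {z}" for y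
    proof -
      obtain zs where zs: "distinct (y # zs)" "set (y # zs) = C - {z}"
        by (rule enum_from[OF _ y]) (use finC in auto)
      then have "ispath E (y # zs)" by (intro clique_ispath[OF C(3)]) auto
      then show ?thesis using zs ispath_mono[OF _ EF] by (intro exI[of _ zs]) simp
    qed
    have uB: "B \<noteq> {u}" using B(5) by auto
    show "clique_comp ?F B" by (rule clique_comp_edge[OF P(1,2) B(1,4) uB B(2) C(1,2) _ z]) simp
    show "B \<subseteq> V" using part_sub[OF pP B(1)] .
    show "z \<notin> B" using part_disjoint[OF pP B(1) C(2) B(2)] z by auto
    show "card (C - {z}) + card B + 2 = k" using B(3) C(4) z finC by simp
    show "s + 4 \<le> stock V ?F 2"
      using s stock_pairs[OF P] stock_insert2[of V E 2 u z] by simp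
    show "\<Phi> E'" if "pos E'" "?F \<subseteq> E'" "s \<le> 3 * deg E' u" for E' u
      using that \<Phi> by (auto simp: dgoal_def)
  qed (use cl1 cl2 nb dis z B(5) finC in auto)
qed

lemma card_diff_insert: "finite A \<Longrightarrow> e \<in> A \<Longrightarrow> e \<notin> E \<Longrightarrow> card (A - E) = Suc (card (A - insert e E))"
  using card_Suc_Diff1[of "A - E" e] by (simp add: Diff_insert[symmetric])

lemma finite_clq: "part P \<Longrightarrow> finite (clq P)"
  using clq_sub[OF partD(1)] finite_all_edges[of V] finite_subset by blast

text \<open>With no isolated vertex left, every move inside the components can be answered by another
  one, so Mini is the first who has to join two components.\<close>

lemma maxi_zugzwang:
  assumes P: "part P" "cnt P 1 = 0" and B: "B \<in> P" "card B + 4 = k" "3 \<le> card B"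
    and s: "s + 8 \<le> cnt P 2" and \<Phi>: "dgoal \<Phi> E0 s"
    and "E \<subseteq> clq P" "covered P E" "reach P E" "all_edges B \<subseteq> E" "E0 \<subseteq> E" "even (card (clq P - E))"
  shows "maxi \<Phi> Mini_player E"
  using assms(8-)
proof (induction "card (clq P - E)" arbitrary: E rule: less_induct)
  case less
  note E = less.prems
  note fin = finite_clq[OF P(1)]
  have no1: "2 \<le> card C" if "C \<in> P" for C
    using part_card[OF P(1) that] cnt_pos[OF part_fin(1)[OF P(1)], of 1] P(2) that
    by (cases "card C = 1") auto
  show ?case
  proof (rule maxi_opp)
    show "pos E" using part_pos[OF P(1) E(1)] .
    show "\<Phi> E" if "legal E = {}"
      using legal_nonempty[OF P(1) E(1), of 2] that B s by simp
    fix p q assume pq: "p \<in> V" "q \<in> V" "p \<noteq> q" "{p, q} \<notin> E" "pos (insert {p, q} E)"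
    let ?F = "insert {p, q} E"
    from move_cases[OF P(1) pq(1-3)] show "maxi \<Phi> Max_player ?F"
    proof cases
      case 1
      have c1: "card (clq P - E) = Suc (card (clq P - ?F))" using card_diff_insert[OF fin 1 pq(4)] .
      have F: "?F \<subseteq> clq P" using 1 E(1) by auto
      have "odd (card (clq P - ?F))" using c1 E(6) by simp
      then have "clq P - ?F \<noteq> {}" by (metis card.empty even_zero)
      then obtain e where e: "e \<in> clq P" "e \<notin> ?F" by blast
      have c2: "card (clq P - ?F) = Suc (card (clq P - insert e ?F))" using card_diff_insert[OF fin e] .
      have sub: "E \<subseteq> insert e ?F" by auto
      have "maxi \<Phi> Mini_player (insert e ?F)"
      proof (rule less.hyps)
        show "insert e ?F \<subseteq> clq P" using e F by auto
        show "covered P (insert e ?F)" using covered_mono[OF E(2) sub] .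
        show "reach P (insert e ?F)" using reach_mono[OF E(3) sub] .
        show "card (clq P - insert e ?F) < card (clq P - E)" using c1 c2 by simp
        show "all_edges B \<subseteq> insert e ?F" "E0 \<subseteq> insert e ?F" using E(4,5) by auto
        show "even (card (clq P - insert e ?F))" using c1 c2 E(6) by simp
      qed
      with legal_inside[OF P(1) F e] show ?thesis by (rule maxi_own)
    next
      case (2 C D)
      consider "card C = 2" "card D = 2" | "3 \<le> card C" | "3 \<le> card D"
        using no1[OF 2(1)] no1[OF 2(2)] by linarith
      then show ?thesis
      proof cases
        case 1
        show ?thesis
          by (rule maxi_join_pairs[OF P(1) E(1,2) 2 1 B(1,2) E(4) B(3) _ \<Phi> E(5) pq(5)]) (use s in simp)
      next
        case a: 2
        show ?thesis
          by (rule maxi_join2[OF P(1) E(1,2,3) 2 a no1[OF 2(2)] _ \<Phi> E(5) pq(5)]) (use s in simp)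
      next
        case a: 3
        have "maxi \<Phi> Max_player (insert {q, p} E)"
          by (rule maxi_join2[OF P(1) E(1,2,3) 2(2,1) 2(3)[symmetric] 2(5,4) a no1[OF 2(1)] _ \<Phi> E(5)])
            (use s pq(5) in \<open>auto simp: insert_commute\<close>)
        then show ?thesis by (simp add: insert_commute)
      qed
    qed
  qed
qed

lemma maxi_zugzwang_odd:
  assumes P: "part P" "cnt P 1 = 0" and B: "B \<in> P" "card B + 4 = k" "3 \<le> card B"
    and s: "s + 8 \<le> cnt P 2" and \<Phi>: "dgoal \<Phi> E0 s"
    and E: "E \<subseteq> clq P" "covered P E" "reach P E" "all_edges B \<subseteq> E" "E0 \<subseteq> E" "odd (card (clq P - E))"
  shows "maxi \<Phi> Max_player E"
proof -
  have "clq P - E \<noteq> {}" using E(6) by (metis card.empty even_zero)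
  then obtain e where e: "e \<in> clq P" "e \<notin> E" by blast
  have c: "card (clq P - E) = Suc (card (clq P - insert e E))"
    using card_diff_insert[OF finite_clq[OF P(1)] e] .
  have sub: "E \<subseteq> insert e E" by auto
  have "maxi \<Phi> Mini_player (insert e E)"
  proof (rule maxi_zugzwang[OF P B s \<Phi>])
    show "insert e E \<subseteq> clq P" using e(1) E(1) by simp
    show "covered P (insert e E)" by (rule covered_mono[OF E(2) sub])
    show "reach P (insert e E)" by (rule reach_mono[OF E(3) sub])
    show "all_edges B \<subseteq> insert e E" "E0 \<subseteq> insert e E" using E(4,5) by auto
    show "even (card (clq P - insert e E))" using c E(6) by simp
  qed
  with legal_inside[OF P(1) E(1) e] show ?thesis by (rule maxi_own)
qed

end

lemma cnt_zeroD: "finite P \<Longrightarrow> C \<in> P \<Longrightarrow> cnt P (card C) \<noteq> 0"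
  by (auto simp: cnt_def)

section \<open>Correcting the parity, and the complete strategy of Max for
  \<open>k \<ge> 7\<close>\<close>

context path_game
begin

lemma covered_merge:
  assumes "covered P E" "\<And>x. x \<in> C \<union> D \<Longrightarrow> \<exists>y. {x, y} \<in> E"
  shows "covered (merge P C D) E"
  unfolding covered_def
proof (intro ballI impI)
  fix X x assume "X \<in> merge P C D" "2 \<le> card X" "x \<in> X"
  then have "X \<in> P \<or> x \<in> C \<union> D" by (auto simp: merge_def)
  then show "\<exists>y. {x, y} \<in> E"
    using assms(1)[unfolded covered_def] assms(2) \<open>2 \<le> card X\<close> \<open>x \<in> X\<close> by metis
qed

lemma reach_merge:
  assumes "reach P E" "\<And>x. x \<in> C \<union> D \<Longrightarrow> \<exists>y z. ispath E [x, y, z]"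
  shows "reach (merge P C D) E"
  unfolding reach_def
proof (intro ballI impI)
  fix X x assume "X \<in> merge P C D" "3 \<le> card X" "x \<in> X"
  then have "X \<in> P \<or> x \<in> C \<union> D" by (auto simp: merge_def)
  then show "\<exists>y z. ispath E [x, y, z]"
    using assms(1)[unfolded reach_def] assms(2) \<open>3 \<le> card X\<close> \<open>x \<in> X\<close> by metis
qed

text \<open>The parity of this number decides who runs out of waiting moves after a join.\<close>

lemma card_clq_merge:
  assumes P: "part P" and C: "C \<in> P" "D \<in> P" "C \<noteq> D"
  shows "card (clq (merge P C D) - clq P) = card C * card D"
proof -
  note pP = partD(1)[OF P]
  have dis: "C \<inter> D = {}" using part_disjoint[OF pP C] .
  let ?f = "\<lambda>(p, q). {p, q} :: nat set"
  have "clq (merge P C D) - clq P = ?f ` (C \<times> D)"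
  proof
    show "clq (merge P C D) - clq P \<subseteq> ?f ` (C \<times> D)" using clq_merge[OF C(1,2)] by auto
    show "?f ` (C \<times> D) \<subseteq> clq (merge P C D) - clq P"
    proof clarify
      fix p q assume pq: "p \<in> C" "q \<in> D"
      then have "p \<noteq> q" using dis by auto
      from clq_merge_insert[OF pq this, of "{}" P] clq_cross[OF pP C pq]
      show "{p, q} \<in> clq (merge P C D) - clq P" by simp
    qed
  qed
  moreover have "inj_on ?f (C \<times> D)"
  proof (rule inj_onI, clarify)
    fix a b c d assume "a \<in> C" "b \<in> D" "c \<in> C" "d \<in> D" "{a, b} = {c, d}"
    then show "a = c \<and> b = d" using dis unfolding doubleton_eq_iff by blast
  qed
  ultimately show ?thesis by (simp add: card_image card_cartesian_product)
qed

lemma merge_other: "X \<in> P \<Longrightarrow> X \<noteq> C \<Longrightarrow> X \<noteq> D \<Longrightarrow> X \<in> merge P C D"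
  by (simp add: merge_def)

text \<open>As long as the reply does not touch \<open>T - {v}\<close>, this set hangs on
  \<open>v\<close> alone; the other arm is \<open>w\<close> with a neighbour.\<close>

lemma cut_bridge:
  assumes P: "part P" and T: "T \<in> P" "W \<in> P" "T \<noteq> W" "v \<in> T" "w \<in> W" "3 \<le> card T" "2 \<le> card W"
    and pq: "p \<notin> T - {v}" "q \<notin> T - {v}"
  shows "cut (insert {p, q} (insert {v, w} (clq P))) v 2"
proof -
  let ?F = "insert {p, q} (insert {v, w} (clq P))"
  note pP = partD(1)[OF P]
  have fin: "finite T" "finite W" using part_fin(2)[OF P] T by auto
  have dis: "T \<inter> W = {}" using part_disjoint[OF pP T(1,2,3)] .
  obtain xs where xs: "ispath (clq P) (v # xs)" "length xs = 2" "set (v # xs) \<subseteq> T"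
    using clique_arm[OF all_edges_clq[OF T(1)] T(4) fin(1), of 2] T(6) by auto
  obtain ys where ys: "ispath (clq P) (w # ys)" "length ys = 1" "set (w # ys) \<subseteq> W"
    using clique_arm[OF all_edges_clq[OF T(2)] T(5) fin(2), of 1] T(7) by auto
  have sub: "clq P \<subseteq> ?F" by auto
  have wT: "w \<notin> T" "v \<notin> W" using dis T(4,5) by auto
  have "closed_upto (clq P) {v} (T - {v})"
    using closed_part[OF pP order_refl T(1)] by (auto simp: closed_upto_def)
  then have cl: "closed_upto ?F {v} (T - {v})"
    using pq wT by (intro closed_upto_insert) auto
  have p1: "ispath ?F (v # xs)" using ispath_mono[OF xs(1) sub] .
  have "ispath ?F (w # ys)" using ispath_mono[OF ys(1) sub] .
  moreover have "v \<notin> set (w # ys)" using ys(3) wT(2) by blast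
  ultimately have p2: "ispath ?F (v # w # ys)" by (subst ispath_Cons) simp
  have "set xs \<subseteq> T - {v}" using xs(1,3) by (auto simp: ispath_Cons)
  moreover have "set (w # ys) \<inter> (T - {v}) = {}" using ys(3) dis by blast
  moreover have "length (w # ys) = 2" using ys(2) by simp
  ultimately show ?thesis unfolding cut_def using cl p1 p2 xs(2) by blast
qed

text \<open>All classes are complete and Max is to move, so he lacks a waiting move. Joining two
  triangles opens nine edges. Mini has to answer with a disjoint edge between the triangles, since
  otherwise \<open>v\<close> or \<open>w\<close> is a cut vertex; then seven edges are missing, an
  odd number with Max to move.\<close>

lemma maxi_endgame0:
  assumes k: "7 \<le> k" and P: "part P" "cnt P 1 = 0" and T: "S \<in> P" "T \<in> P" "S \<noteq> T" "card S = 3" "card T = 3"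
    and B: "B \<in> P" "B \<noteq> S" "B \<noteq> T" "card B + 4 = k"
    and s: "s + 10 \<le> cnt P 2" and \<Phi>: "dgoal \<Phi> {} s"
  shows "maxi \<Phi> Max_player (clq P)"
proof -
  note pP = partD(1)[OF P(1)]
  obtain v where v: "v \<in> S" using part_ne[OF pP T(1)] by blast
  obtain w where w: "w \<in> T" using part_ne[OF pP T(2)] by blast
  let ?P = "merge P S T"
  let ?E = "insert {v, w} (clq P)"
  have P1: "part ?P" using part_merge[OF P(1) T(1,2)] T k by simp
  have cm: "cnt ?P i + of_bool (3 = i) + of_bool (3 = i) = cnt P i + of_bool (6 = i)" for i
    using cnt_merge[OF pP _ T(1,2,3), of i] T(4,5) by simp
  have c1: "cnt ?P 1 = 0" "cnt ?P 2 = cnt P 2" using cm[of 1] cm[of 2] P(2) by simp_all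
  have leg: "{v, w} \<in> legal (clq P)"
    using legal_merge[OF P(1) order_refl T(1,2,3) _ v w] T k by simp
  have vw: "v \<noteq> w" using part_disjoint[OF pP T(1,2,3)] v w by auto
  have E1: "?E \<subseteq> clq ?P" by (rule clq_merge_insert[OF v w vw order_refl])
  have st: "s \<le> stock V (insert {p, q} ?E) 2" for p q
    using stock_pairs[OF P(1) order_refl covered_clq] s stock_insert2[of V "clq P" 2 v w]
      stock_insert2[of V ?E 2 p q] by simp
  have fixed: "maxi \<Phi> Max_player (insert {p, q} ?E)"
    if p: "p \<in> S - {v}" and q: "q \<in> T - {w}" for p q
  proof -
    let ?F = "insert {p, q} ?E"
    have "p \<noteq> q" using part_disjoint[OF pP T(1,2,3)] p q by auto
    then have F: "?F \<subseteq> clq ?P" using clq_merge_insert[of p S q T "{}" P] p q E1 by auto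
    have nin: "{v, w} \<notin> clq P" "{p, q} \<notin> clq P"
      using clq_cross[OF pP T(1,2,3)] v w p q by auto
    have "p \<notin> {v, w}" using part_disjoint[OF pP T(1,2,3)] p w by auto
    then have "{p, q} \<noteq> {v, w}" by auto
    then have "{p, q} \<notin> ?E" using nin by simp
    from card_diff_insert[OF finite_clq[OF P1] _ nin(1)] card_diff_insert[OF finite_clq[OF P1] _ this]
    have "card (clq ?P - clq P) = Suc (Suc (card (clq ?P - ?F)))" using F by simp
    then have odd: "odd (card (clq ?P - ?F))"
      using card_clq_merge[OF P(1) T(1,2,3)] T(4,5) by simp
    have sub: "clq P \<subseteq> ?F" by auto
    have cov: "covered P ?F" "reach P ?F"
      using covered_mono[OF covered_clq sub] reach_mono[OF reach_clq sub] .
    show ?thesis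
    proof (rule maxi_zugzwang_odd[OF P1 c1(1) merge_other[OF B(1,2,3)] B(4) _ _ \<Phi> F _ _ _ _ odd])
      show "covered ?P ?F"
      proof (rule covered_merge[OF cov(1)])
        fix x assume "x \<in> S \<union> T"
        then obtain X where "X \<in> P" "x \<in> X" "2 \<le> card X" using T by fastforce
        then show "\<exists>y. {x, y} \<in> ?F" using cov(1) unfolding covered_def by blast
      qed
      show "reach ?P ?F"
      proof (rule reach_merge[OF cov(2)])
        fix x assume "x \<in> S \<union> T"
        then obtain X where "X \<in> P" "x \<in> X" "3 \<le> card X" using T by fastforce
        then show "\<exists>y z. ispath ?F [x, y, z]" using cov(2) unfolding reach_def by blast
      qed
      show "all_edges B \<subseteq> ?F" using all_edges_clq[OF B(1)] sub by (rule order_trans)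
    qed (use s c1(2) B(4) k in simp_all)
  qed
  have "maxi \<Phi> Mini_player ?E"
  proof (rule maxi_opp)
    show "pos ?E" using part_pos[OF P1 E1] .
    show "\<Phi> ?E" if "legal ?E = {}"
      using legal_nonempty[OF P1 E1, of 2] that k s c1 by simp
    fix p q assume pq: "p \<in> V" "q \<in> V" "p \<noteq> q" "{p, q} \<notin> ?E" "pos (insert {p, q} ?E)"
    let ?F = "insert {p, q} ?E"
    have cut: "maxi \<Phi> Max_player ?F" if "cut ?F u 2" for u
      using maxi_cut_goal[OF pq(5) that _ st \<Phi>] by simp
    consider "p \<notin> S - {v}" "q \<notin> S - {v}" | "p \<notin> T - {w}" "q \<notin> T - {w}"
      | "p \<in> S - {v}" "q \<in> T - {w}" | "q \<in> S - {v}" "p \<in> T - {w}"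
      using part_disjoint[OF pP T(1,2,3)] by blast
    then show "maxi \<Phi> Max_player ?F"
    proof cases
      case 1
      show ?thesis by (rule cut[OF cut_bridge[OF P(1) T(1,2,3) v w _ _ 1]]) (use T in simp_all)
    next
      case 2
      have "cut (insert {p, q} (insert {w, v} (clq P))) w 2"
        by (rule cut_bridge[OF P(1) T(2,1) T(3)[symmetric] w v _ _ 2]) (use T in simp_all)
      then show ?thesis by (intro cut[of w]) (simp add: insert_commute)
    next
      case 3
      then show ?thesis by (rule fixed)
    next
      case 4
      then show ?thesis using fixed[of q p] by (simp add: insert_commute)
    qed
  qed
  with leg show ?thesis by (rule maxi_own)
qed

text \<open>Hanging the last isolated vertex on a triangle opens three edges. If Mini answers inside
  the new class, exactly one is left for Max. If she joins two classes instead, the join is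
  punished, possibly with the help of the pendant vertex.\<close>

lemma maxi_endgame1:
  assumes k: "7 \<le> k" and P: "part P" "cnt P 1 = 1" and T: "T \<in> P" "card T = 3"
    and B: "B \<in> P" "B \<noteq> T" "card B + 4 = k"
    and s: "s + 10 \<le> cnt P 2" and \<Phi>: "dgoal \<Phi> {} s"
  shows "maxi \<Phi> Max_player (clq P)"
proof -
  note pP = partD(1)[OF P(1)]
  obtain U where U: "U \<in> P" "card U = 1" using P cnt_pos[OF part_fin(1)[OF P(1)], of 1] by auto
  then obtain u where u: "U = {u}" by (auto simp: card_1_singleton_iff)
  obtain z where z: "z \<in> T" using part_ne[OF pP T(1)] by blast
  have UT: "U \<noteq> T" "B \<noteq> U" using U T B k by auto
  have uz: "u \<noteq> z" using part_disjoint[OF pP U(1) T(1) UT(1)] u z by auto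
  let ?P = "merge P U T"
  let ?E = "insert {u, z} (clq P)"
  have P1: "part ?P" using part_merge[OF P(1) U(1) T(1)] U T k by simp
  have cm: "cnt ?P i + of_bool (1 = i) + of_bool (3 = i) = cnt P i + of_bool (4 = i)" for i
    using cnt_merge[OF pP _ U(1) T(1) UT(1), of i] U T by simp
  have c1: "cnt ?P 1 = 0" "cnt ?P 2 = cnt P 2" using cm[of 1] cm[of 2] P(2) by simp_all
  have leg: "{u, z} \<in> legal (clq P)"
    using legal_merge[OF P(1) order_refl U(1) T(1) UT(1) _ _ z, of u] T U k u by simp
  have E1: "?E \<subseteq> clq ?P" using clq_merge_insert[OF _ z uz order_refl, of U P] u by simp
  have B3: "3 \<le> card B" using B k by simp
  have no1: "2 \<le> card C" if "C \<in> ?P" for C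
    using part_card[OF P1 that] cnt_zeroD[OF part_fin(1)[OF P1] that] c1(1)
    by (cases "card C = 1") auto
  have sub: "clq P \<subseteq> ?E" by auto
  obtain xs where xs: "ispath (clq P) (z # xs)" "length xs = 1" "set (z # xs) \<subseteq> T"
    using clique_arm[OF all_edges_clq[OF T(1)] z part_fin(2)[OF P(1) T(1)], of 1] T(2) by auto
  then obtain y where y: "xs = [y]" by (cases xs) auto
  have "ispath ?E [z, y]" using ispath_mono[OF xs(1) sub] y by simp
  moreover have "u \<notin> set [z, y]" using part_disjoint[OF pP U(1) T(1) UT(1)] u xs(3) y by auto
  ultimately have pu: "ispath ?E [u, z, y]" by (subst ispath_Cons) simp
  have cov: "covered ?P ?E"
  proof (rule covered_merge[OF covered_mono[OF covered_clq sub]])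
    fix x assume "x \<in> U \<union> T"
    then show "\<exists>y. {x, y} \<in> ?E"
      using covered_mono[OF covered_clq sub] T u unfolding covered_def by fastforce
  qed
  have rea: "reach ?P ?E"
  proof (rule reach_merge[OF reach_mono[OF reach_clq sub]])
    fix x assume "x \<in> U \<union> T"
    then show "\<exists>y z. ispath ?E [x, y, z]"
      using reach_mono[OF reach_clq sub] T u pu unfolding reach_def by fastforce
  qed
  have "maxi \<Phi> Mini_player ?E"
  proof (rule maxi_opp)
    show "pos ?E" using part_pos[OF P1 E1] .
    show "\<Phi> ?E" if "legal ?E = {}"
      using legal_nonempty[OF P1 E1, of 2] that k s c1 by simp
    fix p q assume pq: "p \<in> V" "q \<in> V" "p \<noteq> q" "{p, q} \<notin> ?E" "pos (insert {p, q} ?E)"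
    let ?F = "insert {p, q} ?E"
    from move_cases[OF P1 pq(1-3)] show "maxi \<Phi> Max_player ?F"
    proof cases
      case 1
      then have F: "?F \<subseteq> clq ?P" using E1 by auto
      have nin: "{u, z} \<notin> clq P" by (rule clq_cross[OF pP U(1) T(1) UT(1) _ z]) (simp add: u)
      from card_diff_insert[OF finite_clq[OF P1] _ nin] card_diff_insert[OF finite_clq[OF P1] 1 pq(4)]
      have "card (clq ?P - clq P) = Suc (Suc (card (clq ?P - ?F)))" using E1 by simp
      then have "card (clq ?P - ?F) = 1"
        using card_clq_merge[OF P(1) U(1) T(1) UT(1)] U(2) T(2) by simp
      then have odd: "odd (card (clq ?P - ?F))" by (simp only: odd_one not_False_eq_True)
      have sub2: "?E \<subseteq> ?F" by auto
      show ?thesis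
      proof (rule maxi_zugzwang_odd[OF P1 c1(1) merge_other[OF B(1) UT(2) B(2)] B(3) B3 _ \<Phi> F _ _ _ _ odd])
        show "covered ?P ?F" by (rule covered_mono[OF cov sub2])
        show "reach ?P ?F" by (rule reach_mono[OF rea sub2])
        show "all_edges B \<subseteq> ?F" by (rule order_trans[OF all_edges_clq[OF B(1)] order_trans[OF sub sub2]])
      qed (use s c1(2) in simp_all)
    next
      case (2 C D)
      show ?thesis
      proof (cases "card C = 2 \<and> card D = 2")
        case False
        then consider "3 \<le> card C" | "3 \<le> card D" using no1[OF 2(1)] no1[OF 2(2)] by linarith
        then show ?thesis
        proof cases
          case a: 1
          show ?thesis
            by (rule maxi_join2[OF P1 E1 cov rea 2 a no1[OF 2(2)] _ \<Phi> _ pq(5)]) (use s c1(2) in simp_all)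
        next
          case a: 2
          have "maxi \<Phi> Max_player (insert {q, p} ?E)"
            by (rule maxi_join2[OF P1 E1 cov rea 2(2,1) 2(3)[symmetric] 2(5,4) a no1[OF 2(1)] _ \<Phi>])
              (use s c1(2) pq(5) in \<open>simp_all add: insert_commute\<close>)
          then show ?thesis by (simp add: insert_commute)
        qed
      next
        case True
        have "card (U \<union> T) \<noteq> 2"
          using U T UT part_disjoint[OF pP U(1) T(1) UT(1)] part_fin(2)[OF P(1)] by (simp add: card_Un_disjoint)
        then have CD: "C \<in> P" "D \<in> P" using 2 True by (auto simp: merge_def)
        let ?Q = "merge P C D"
        let ?G = "insert {p, q} (clq P)"
        have ne: "C \<noteq> U" "D \<noteq> U" "C \<noteq> T" "D \<noteq> T" "C \<noteq> B" "D \<noteq> B"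
          using True U(2) T(2) B3 by auto
        have Q: "part ?Q" using part_merge[OF P(1) CD] True k by simp
        have G: "?G \<subseteq> clq ?Q" by (rule clq_merge_insert[OF 2(4,5) pq(3) order_refl])
        have subG: "clq P \<subseteq> ?G" by auto
        have cG: "covered P ?G" by (rule covered_mono[OF covered_clq subG])
        \<comment> \<open>The two edges are read in the opposite order: \<open>u\<close> is hung on
          the triangle after the isolated edges \<open>C\<close> and \<open>D\<close> have been
          joined.\<close>
        have eq: "?F = insert {u, z} ?G" by (simp add: insert_commute)
        show ?thesis unfolding eq
        proof (rule maxi_pendant[OF Q G, of u T z B s \<Phi> "{}"])
          show "covered ?Q ?G"
          proof (rule covered_merge[OF cG])
            fix x assume "x \<in> C \<union> D"
            then obtain X where "X \<in> P" "x \<in> X" "2 \<le> card X" using CD True by fastforce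
            then show "\<exists>y. {x, y} \<in> ?G" using cG unfolding covered_def by blast
          qed
          show "{u} \<in> ?Q" "T \<in> ?Q" "B \<in> ?Q"
            using merge_other[OF U(1), of C D] merge_other[OF T(1), of C D] merge_other[OF B(1), of C D] ne u by auto
          show "all_edges T \<subseteq> ?G" "all_edges B \<subseteq> ?G"
            using all_edges_clq[OF T(1)] all_edges_clq[OF B(1)] by auto
          show "s + 6 \<le> cnt ?Q 2"
            using cnt_merge[OF pP _ CD 2(3), of 2] True s by simp
          show "pos (insert {u, z} ?G)" using pq(5) unfolding eq .
        qed (use T(2) B(2,3) z \<Phi> B3 in simp_all)
      qed
    qed
  qed
  with leg show ?thesis by (rule maxi_own)
qed


lemma cnt_0: "part P \<Longrightarrow> cnt P 0 = 0"
  using cnt_pos[OF part_fin(1)[of P], of 0] part_card[of P] by fastforce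

text \<open>The final disjunction provides, at every stage, more than \<open>s\<close> isolated vertices or more than \<open>s\<close>
  isolated edges.\<close>

definition good :: "nat \<Rightarrow> nat set set \<Rightarrow> bool" where
  "good s P \<longleftrightarrow> part P \<and> (\<forall>i. i \<notin> {1, 2, 3, k - 4} \<longrightarrow> cnt P i = 0) \<and> 3 \<le> cnt P 3 \<and> 1 \<le> cnt P (k - 4) \<and>
     (5 * s + 80 \<le> cnt P 1 + 2 * cnt P 2 \<or> cnt P 1 + s + 20 \<le> cnt P 2)"

text \<open>The sizes \<open>3\<close> and \<open>k - 4\<close> add up to \<open>k - 1\<close>, so
  each serves a pendant vertex on the other. For \<open>k = 7\<close> they coincide and a second
  triangle is taken.\<close>

lemma good_gadget:
  assumes k: "7 \<le> k" and g: "good s P" and C: "C \<in> P" "3 \<le> card C"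
  obtains B where "B \<in> P" "B \<noteq> C" "card B + card C + 1 = k" "3 \<le> card B"
proof -
  have "cnt P (card C) \<noteq> 0" using cnt_zeroD[of P C] part_fin(1) g C by (auto simp: good_def)
  then have "card C \<in> {1, 2, 3, k - 4}" using g by (auto simp: good_def)
  then consider "card C = k - 4" | "card C = 3" "k \<noteq> 7" using C(2) by (cases "k = 7") auto
  then show thesis
  proof cases
    case 1
    obtain B where "B \<in> P" "card B = 3" "B \<notin> {C}"
      using ex_cnt_avoid[of "{C}" P 3] g by (auto simp: good_def)
    then show thesis using that[of B] 1 k by simp
  next
    case 2
    obtain B where "B \<in> P" "card B = k - 4" "B \<notin> {}"
      using ex_cnt_avoid[of "{}" P "k - 4"] g by (auto simp: good_def)
    moreover from this have "B \<noteq> C" using 2 k by auto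
    ultimately show thesis using that[of B] 2 k by simp
  qed
qed

text \<open>Both turns are treated at once, by induction on the number of isolated vertices. Max
  makes isolated edges until at most one isolated vertex is left and the endgames apply. Every other
  continuation of Mini is punished, except for a vertex hung on an edge, which is turned into a
  triangle.\<close>

lemma maxi_good:
  assumes k: "7 \<le> k" and \<Phi>: "dgoal \<Phi> {} s"
  shows "good s P \<Longrightarrow> maxi \<Phi> Max_player (clq P) \<and> maxi \<Phi> Mini_player (clq P)"
proof (induction "cnt P 1" arbitrary: P rule: less_induct)
  case less
  note g = less.prems
  have P: "part P" and c3: "3 \<le> cnt P 3" and ck: "1 \<le> cnt P (k - 4)"
    and c0: "\<And>i. i \<notin> {1, 2, 3, k - 4} \<Longrightarrow> cnt P i = 0"
    and inv: "5 * s + 80 \<le> cnt P 1 + 2 * cnt P 2 \<or> cnt P 1 + s + 20 \<le> cnt P 2"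
    using g by (auto simp: good_def)
  note pP = partD(1)[OF P]
  have pair: "good s P'" if "part P'" "cnt P' 1 + 2 = cnt P 1" "cnt P' 2 = cnt P 2 + 1"
    "\<And>i. 3 \<le> i \<Longrightarrow> cnt P' i = cnt P i" for P'
  proof -
    note P' = that
    have "cnt P' i = 0" if i: "i \<notin> {1, 2, 3, k - 4}" for i
    proof (cases "i = 0")
      case True
      then show ?thesis using cnt_0[OF P'(1)] by simp
    qed (use P'(4)[of i] c0[OF i] i in auto)
    then show ?thesis using that c3 ck inv k unfolding good_def by auto
  qed
  obtain B where B: "B \<in> P" "card B = k - 4"
    using ck cnt_pos[OF part_fin(1)[OF P], of "k - 4"] by auto
  have max: "maxi \<Phi> Max_player (clq P)"
  proof (cases "2 \<le> cnt P 1")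
    case True
    then show ?thesis
    proof (rule maxi_pair[OF P])
      fix P' assume P': "part P'" "cnt P' 1 + 2 = cnt P 1" "cnt P' 2 = cnt P 2 + 1"
        "\<And>i. 3 \<le> i \<Longrightarrow> cnt P' i = cnt P i"
      then show "maxi \<Phi> Mini_player (clq P')" using less.hyps[of P'] pair by simp
    qed
  next
    case False
    have c2: "s + 10 \<le> cnt P 2" using inv False by auto
    obtain S where S: "S \<in> P" "card S = 3" "S \<notin> {B}" using ex_cnt_avoid[of "{B}" P 3] c3 by auto
    have "card {B, S} \<le> 2" by (simp add: card_insert_if)
    then obtain T where T: "T \<in> P" "card T = 3" "T \<notin> {B, S}"
      using ex_cnt_avoid[of "{B, S}" P 3] c3 by auto
    show ?thesis
    proof (cases "cnt P 1 = 0")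
      case True
      show ?thesis
        by (rule maxi_endgame0[OF k P True S(1) T(1) _ S(2) T(2) B(1) _ _ _ c2 \<Phi>]) (use S T B k in auto)
    next
      case F: False
      then have "cnt P 1 = 1" using False by simp
      then show ?thesis
        by (rule maxi_endgame1[OF k P _ S(1,2) B(1) _ _ c2 \<Phi>]) (use S B k in auto)
    qed
  qed
  have min: "maxi \<Phi> Mini_player (clq P)"
  proof (rule maxi_opp)
    show "pos (clq P)" using part_pos[OF P order_refl] .
    have "2 \<le> cnt P 1 \<or> 2 \<le> cnt P 2" using inv by linarith
    then show "\<Phi> (clq P)" if "legal (clq P) = {}"
      using legal_nonempty[OF P order_refl, of 1] legal_nonempty[OF P order_refl, of 2] that k by auto
    have ordered: "maxi \<Phi> Max_player (insert {p, q} (clq P))"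
      if C: "C \<in> P" "D \<in> P" "C \<noteq> D" "p \<in> C" "q \<in> D" and le: "card C \<le> card D"
        and ns: "\<not> (card C = 1 \<and> card D = 1)" and pos: "pos (insert {p, q} (clq P))" for C D p q
    proof (cases "s + 2 \<le> cnt P 1")
      case True
      show ?thesis by (rule maxi_join1[OF P order_refl covered_clq C ns True \<Phi> _ pos]) simp
    next
      case False
      \<comment> \<open>Here \<open>cnt P 1 \<le> s + 1\<close>, so the first alternative of the
        invariant gives \<open>2 * cnt P 2 \<ge> 4 * s + 79\<close> and with it the second
        one.\<close>
      have c2: "s + 20 + cnt P 1 \<le> cnt P 2" using inv False by auto
      have c: "1 \<le> card C" "1 \<le> card D" using part_card[OF P] C by auto
      have pq: "p \<noteq> q" using part_disjoint[OF pP C(1,2,3)] C(4,5) by auto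
      consider "card C = 1" "card D = 2" | "card C = 1" "3 \<le> card D" | "card C = 2" "card D = 2"
        | "2 \<le> card C" "3 \<le> card D" using c le ns by linarith
      then show ?thesis
      proof cases
        case 1
        \<comment> \<open>Max adds the one edge missing from the triangle. The numbers of isolated
          vertices and of isolated edges both drop by one, so the second alternative of the
          invariant persists.\<close>
        let ?P = "merge P C D" and ?E = "insert {p, q} (clq P)"
        have P1: "part ?P" using part_merge[OF P C(1,2)] 1 k by simp
        have cm: "cnt ?P i + of_bool (1 = i) + of_bool (2 = i) = cnt P i + of_bool (3 = i)" for i
          using cnt_merge[OF pP _ C(1,2,3), of i] 1 by simp
        obtain q' where q': "D = {q, q'}" "q' \<noteq> q" using 1(2) C(5) by (auto simp: card_2_iff doubleton_eq_iff)
        have pq': "p \<noteq> q'" using part_disjoint[OF pP C(1,2,3)] C(4) q' by auto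
        have Cp: "C = {p}" using 1(1) C(4) by (auto simp: card_1_singleton_iff)
        have E: "?E \<subseteq> clq ?P" by (rule clq_merge_insert[OF C(4,5) pq order_refl])
        have e: "{p, q'} \<in> clq ?P" "{p, q'} \<notin> ?E"
        proof -
          show "{p, q'} \<in> clq ?P" using clq_merge_insert[OF C(4) _ pq', of D "{}" P] q' by simp
          have "{p, q'} \<notin> clq P" by (rule clq_cross[OF pP C(1,2,3,4)]) (simp add: q')
          moreover have "{p, q'} \<noteq> {p, q}" using q'(2) by (auto simp: doubleton_eq_iff)
          ultimately show "{p, q'} \<notin> ?E" by simp
        qed
        have eq: "insert {p, q'} ?E = clq ?P"
        proof
          show "insert {p, q'} ?E \<subseteq> clq ?P" using e(1) E by simp
          show "clq ?P \<subseteq> insert {p, q'} ?E" using clq_merge[OF C(1,2)] Cp q'(1) by auto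
        qed
        have "good s ?P" unfolding good_def
        proof (intro conjI allI impI)
          show "part ?P" by fact
          show "cnt ?P i = 0" if "i \<notin> {1, 2, 3, k - 4}" for i using cm[of i] c0[OF that] that by auto
          show "3 \<le> cnt ?P 3" using cm[of 3] c3 by simp
          have "1 \<noteq> k - 4" "2 \<noteq> k - 4" using k by auto
          then show "1 \<le> cnt ?P (k - 4)" using cm[of "k - 4"] ck by simp
          show "5 * s + 80 \<le> cnt ?P 1 + 2 * cnt ?P 2 \<or> cnt ?P 1 + s + 20 \<le> cnt ?P 2"
            using cm[of 1] cm[of 2] c2 by simp
        qed
        then have "maxi \<Phi> Mini_player (clq ?P)" using less.hyps[of ?P] cm[of 1] by simp
        then show ?thesis using maxi_own[OF legal_inside[OF P1 E e]] eq by simp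
      next
        case 2
        have Cp: "{p} \<in> P" using 2(1) C(1,4) by (auto simp: card_1_singleton_iff)
        obtain G where G: "G \<in> P" "G \<noteq> D" "card G + card D + 1 = k" "3 \<le> card G"
          using good_gadget[OF k g C(2) 2(2)] .
        show ?thesis
          by (rule maxi_pendant[OF P order_refl covered_clq Cp C(2) all_edges_clq[OF C(2)] 2(2) C(5)
            G(1,2,3) all_edges_clq[OF G(1)] G(4) _ \<Phi> _ pos]) (use c2 in simp_all)
      next
        case 3
        show ?thesis
          by (rule maxi_join_pairs[OF P order_refl covered_clq C 3 B(1) _ all_edges_clq[OF B(1)] _ _ \<Phi> _ pos])
            (use c2 B k in simp_all)
      next
        case 4
        have "maxi \<Phi> Max_player (insert {q, p} (clq P))"
          by (rule maxi_join2[OF P order_refl covered_clq reach_clq C(2,1) C(3)[symmetric] C(5,4) 4(2,1) _ \<Phi>])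
            (use c2 pos in \<open>simp_all add: insert_commute\<close>)
        then show ?thesis by (simp add: insert_commute)
      qed
    qed
    fix p q assume pq: "p \<in> V" "q \<in> V" "p \<noteq> q" "{p, q} \<notin> clq P" "pos (insert {p, q} (clq P))"
    obtain C D where C: "C \<in> P" "D \<in> P" "C \<noteq> D" "p \<in> C" "q \<in> D"
      by (rule move_cases[OF P pq(1-3)]) (use pq(4) in simp)
    show "maxi \<Phi> Max_player (insert {p, q} (clq P))"
    proof (cases "card C = 1 \<and> card D = 1")
      case True
      then have "{p} \<in> P" "{q} \<in> P" using C by (auto simp: card_1_singleton_iff)
      note m = merge_singles[OF P this pq(3)]
      show ?thesis using less.hyps[OF _ pair[OF m(1,3,4,5)]] m(2,3) by simp
    next
      case False
      show ?thesis
      proof (cases "card C \<le> card D")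
        case True
        then show ?thesis using ordered[OF C _ False pq(5)] by simp
      next
        case F: False
        have "maxi \<Phi> Max_player (insert {q, p} (clq P))"
          by (rule ordered[OF C(2,1) C(3)[symmetric] C(5,4)]) (use F False pq(5) in \<open>auto simp: insert_commute\<close>)
        then show ?thesis by (simp add: insert_commute)
      qed
    qed
  qed
  show ?case using max min by simp
qed

text \<open>One clique is grown vertex by vertex from \<open>q\<close> to \<open>k - 4\<close>
  vertices. A step uses at most \<open>2 * (q - 2) + 1 \<le> 3 * k\<close> isolated vertices and
  lowers \<open>cnt P 1 + 2 * cnt P 2\<close> by at most three, which explains the two budgets. For
  \<open>q = 3\<close> the growing clique is itself counted among the triangles, hence one more is
  required.\<close>

lemma maxi_chain:
  assumes k: "7 \<le> k" and \<Phi>: "dgoal \<Phi> {} s"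
  shows "part P \<Longrightarrow> 2 \<le> q \<Longrightarrow> q \<le> k - 4 \<Longrightarrow> 1 \<le> cnt P q \<Longrightarrow> (4 \<le> q \<longrightarrow> cnt P q = 1) \<Longrightarrow>
    3 + of_bool (q = 3) \<le> cnt P 3 \<Longrightarrow> (\<And>i. i \<notin> {1, 2, 3, q} \<Longrightarrow> cnt P i = 0) \<Longrightarrow>
    s + 3 * k * (k - q) + 80 \<le> cnt P 1 \<Longrightarrow> 5 * s + 80 + 3 * (k - q) \<le> cnt P 1 + 2 * cnt P 2 \<Longrightarrow>
    maxi \<Phi> Max_player (clq P)"
proof (induction "k - q" arbitrary: P q rule: less_induct)
  case less
  note H = less.prems
  show ?case
  proof (cases "q = k - 4")
    case True
    then have "good s P" using H unfolding good_def by auto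
    then show ?thesis using maxi_good[OF k \<Phi>] by blast
  next
    case False
    obtain Q where Q: "Q \<in> P" "card Q = q" using H(4) cnt_pos[OF part_fin(1)[OF H(1)], of q] by auto
    define M where "M = 3 * k * (k - Suc q)"
    have "k - q = Suc (k - Suc q)" using H(2,3) False k by simp
    then have mul: "3 * k * (k - q) = 3 * k + M" by (simp add: M_def)
    show ?thesis
    proof (rule maxi_grow[OF H(1) Q H(2) _ \<Phi>])
      show "Suc q < k" using H(3) k by simp
      show "s + 2 * q + 8 \<le> cnt P 1" using H(8)[unfolded mul] H(3) by linarith
      fix P' f assume P': "part P'" "f \<le> q - 2" "cnt P' 1 + 2 * f + 1 = cnt P 1"
        "\<And>i. 2 \<le> i \<Longrightarrow> cnt P' i + of_bool (i = q) = cnt P i + of_bool (i = Suc q) + of_bool (i = 2) * f"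
      show "maxi \<Phi> Max_player (clq P')"
      proof (rule less.hyps[OF _ P'(1)])
        show "k - Suc q < k - q" "2 \<le> Suc q" "Suc q \<le> k - 4" using H(2,3) False k by auto
        have cS: "cnt P' (Suc q) = cnt P (Suc q) + 1" using P'(4)[of "Suc q"] H(2) by simp
        then show "1 \<le> cnt P' (Suc q)" by simp
        show "4 \<le> Suc q \<longrightarrow> cnt P' (Suc q) = 1" using cS H(7)[of "Suc q"] by auto
        show "3 + of_bool (Suc q = 3) \<le> cnt P' 3" using P'(4)[of 3] H(6) by (auto simp: of_bool_def split: if_splits)
        show "cnt P' i = 0" if i: "i \<notin> {1, 2, 3, Suc q}" for i
        proof (cases "i = 0")
          case True
      then show ?thesis using cnt_0[OF P'(1)] by simp
        next
          case F: False
          then have i2: "4 \<le> i" using i by auto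
          show ?thesis
          proof (cases "i = q")
            case True
            then show ?thesis using P'(4)[of i] H(5) i2 by simp
          next
            case False
            then show ?thesis using P'(4)[of i] H(7)[of i] i i2 by simp
          qed
        qed
        show "s + 3 * k * (k - Suc q) + 80 \<le> cnt P' 1"
          using H(8)[unfolded mul] P'(2,3) H(3) k unfolding M_def[symmetric] by linarith
        have "cnt P' 2 + 1 \<ge> cnt P 2 + f" using P'(4)[of 2] by (auto simp: of_bool_def split: if_splits)
        then show "5 * s + 80 + 3 * (k - Suc q) \<le> cnt P' 1 + 2 * cnt P' 2"
          using H(9) P'(3) H(2,3) False k by linarith
      qed
    qed simp
  qed
qed

lemma maxi_two_pairs:
  assumes P: "part P" and \<Phi>: "dgoal \<Phi> E0 s" "E0 \<subseteq> clq P" and c: "s + 8 \<le> cnt P 1"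
    and cont: "\<And>P'. part P' \<Longrightarrow> cnt P' 1 + 4 = cnt P 1 \<Longrightarrow> cnt P' 2 = cnt P 2 + 2 \<Longrightarrow>
      (\<And>i. 3 \<le> i \<Longrightarrow> cnt P' i = cnt P i) \<Longrightarrow> maxi \<Phi> Max_player (clq P')"
  shows "maxi \<Phi> Max_player (clq P)"
proof (rule maxi_pair[OF P])
  fix P1 assume 1: "part P1" "cnt P1 1 + 2 = cnt P 1" "cnt P1 2 = cnt P 2 + 1"
    "\<And>i. 3 \<le> i \<Longrightarrow> cnt P1 i = cnt P i" "clq P \<subseteq> clq P1"
  show "maxi \<Phi> Mini_player (clq P1)"
  proof (rule maxi_after_pair[OF 1(1) _ _ \<Phi>(1) order_trans[OF \<Phi>(2) 1(5)]])
    fix P' assume "part P'" "cnt P' 1 + 2 = cnt P1 1" "cnt P' 2 = cnt P1 2 + 1"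
      "\<And>i. 3 \<le> i \<Longrightarrow> cnt P' i = cnt P1 i"
    then show "maxi \<Phi> Max_player (clq P')" using cont[of P'] 1(2,3,4) by simp
  qed (use 1(2) c in simp_all)
qed (use c in simp)

text \<open>Turning an edge into a triangle leaves Mini no free move.\<close>

lemma maxi_triangle:
  assumes P: "part P" and \<Phi>: "dgoal \<Phi> E0 s" "E0 \<subseteq> clq P" and c: "s + 12 \<le> cnt P 1" "1 \<le> cnt P 2"
    and cont: "\<And>P'. part P' \<Longrightarrow> cnt P' 1 + 1 = cnt P 1 \<Longrightarrow> cnt P' 2 + 1 = cnt P 2 \<Longrightarrow>
      cnt P' 3 = cnt P 3 + 1 \<Longrightarrow> (\<And>i. 4 \<le> i \<Longrightarrow> cnt P' i = cnt P i) \<Longrightarrow> maxi \<Phi> Max_player (clq P')"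
  shows "maxi \<Phi> Max_player (clq P)"
proof -
  obtain Q where Q: "Q \<in> P" "card Q = 2" using c(2) cnt_pos[OF part_fin(1)[OF P], of 2] by auto
  show ?thesis
  proof (rule maxi_grow[OF P Q _ _ \<Phi>])
    fix P' f assume P': "part P'" "f \<le> 2 - 2" "cnt P' 1 + 2 * f + 1 = cnt P 1"
      "\<And>i. 2 \<le> i \<Longrightarrow> cnt P' i + of_bool (i = 2) = cnt P i + of_bool (i = Suc 2) + of_bool (i = 2) * f"
    show "maxi \<Phi> Max_player (clq P')"
    proof (rule cont[OF P'(1)])
      show "cnt P' 1 + 1 = cnt P 1" using P'(2,3) by simp
      show "cnt P' 2 + 1 = cnt P 2" "cnt P' 3 = cnt P 3 + 1" using P'(4)[of 2] P'(4)[of 3] P'(2) by simp_all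
      show "cnt P' i = cnt P i" if "4 \<le> i" for i using P'(4)[of i] that by simp
    qed
  qed (use c k4 in simp_all)
qed

text \<open>Four isolated edges are gained. Three of them become triangles and the last one is the
  seed of the chain.\<close>

lemma maxi_start:
  assumes k: "7 \<le> k" and \<Phi>: "dgoal \<Phi> {} s" and P: "part P" "\<And>i. i \<notin> {1, 2} \<Longrightarrow> cnt P i = 0"
    and c: "5 * s + 3 * k * k + 200 \<le> cnt P 1"
  shows "maxi \<Phi> Max_player (clq P)"
proof (rule maxi_two_pairs[OF P(1) \<Phi>])
  fix P1 assume 1: "part P1" "cnt P1 1 + 4 = cnt P 1" "cnt P1 2 = cnt P 2 + 2" "\<And>i. 3 \<le> i \<Longrightarrow> cnt P1 i = cnt P i"
  show "maxi \<Phi> Max_player (clq P1)"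
  proof (rule maxi_two_pairs[OF 1(1) \<Phi>])
    fix P2 assume 2: "part P2" "cnt P2 1 + 4 = cnt P1 1" "cnt P2 2 = cnt P1 2 + 2" "\<And>i. 3 \<le> i \<Longrightarrow> cnt P2 i = cnt P1 i"
    show "maxi \<Phi> Max_player (clq P2)"
    proof (rule maxi_triangle[OF 2(1) \<Phi>])
      fix P3 assume 3: "part P3" "cnt P3 1 + 1 = cnt P2 1" "cnt P3 2 + 1 = cnt P2 2" "cnt P3 3 = cnt P2 3 + 1"
        "\<And>i. 4 \<le> i \<Longrightarrow> cnt P3 i = cnt P2 i"
      show "maxi \<Phi> Max_player (clq P3)"
      proof (rule maxi_triangle[OF 3(1) \<Phi>])
        fix P4 assume 4: "part P4" "cnt P4 1 + 1 = cnt P3 1" "cnt P4 2 + 1 = cnt P3 2" "cnt P4 3 = cnt P3 3 + 1"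
          "\<And>i. 4 \<le> i \<Longrightarrow> cnt P4 i = cnt P3 i"
        show "maxi \<Phi> Max_player (clq P4)"
        proof (rule maxi_triangle[OF 4(1) \<Phi>])
          fix P5 assume 5: "part P5" "cnt P5 1 + 1 = cnt P4 1" "cnt P5 2 + 1 = cnt P4 2" "cnt P5 3 = cnt P4 3 + 1"
            "\<And>i. 4 \<le> i \<Longrightarrow> cnt P5 i = cnt P4 i"
          have mul: "3 * k * (k - 2) + k \<le> 3 * k * k"
            using k by (simp add: diff_mult_distrib2)
          show "maxi \<Phi> Max_player (clq P5)"
          proof (rule maxi_chain[OF k \<Phi> 5(1), of 2])
            show "1 \<le> cnt P5 2" "3 + of_bool (2 = (3::nat)) \<le> cnt P5 3"
              using 1 2 3 4 5 by simp_all
            show "cnt P5 i = 0" if i: "i \<notin> {1, 2, 3, 2}" for i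
            proof (cases "i = 0")
              case True
      then show ?thesis using cnt_0[OF 5(1)] by simp
            next
              case False
              then have "4 \<le> i" using i by auto
              then show ?thesis using 1(4) 2(4) 3(5) 4(5) 5(5) P(2)[of i] by simp
            qed
            show "s + 3 * k * (k - 2) + 80 \<le> cnt P5 1"
              using mul c 1(2) 2(2) 3(2) 4(2) 5(2) by linarith
            have "3 * k \<le> 3 * k * k" using k by simp
            then show "5 * s + 80 + 3 * (k - 2) \<le> cnt P5 1 + 2 * cnt P5 2"
              using c 1(2) 2(2) 3(2) 4(2) 5(2) by linarith
          qed (use k in simp_all)
        qed (use c 1 2 3 4 in simp_all)
      qed (use c 1 2 3 in simp_all)
    qed (use c 1 2 in simp_all)
  qed (use c 1 in simp_all)
qed (use c in simp_all)

end

section \<open>Counting stars in path-free graphs\<close>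

text \<open>As long as a path has fewer than \<open>k\<close> vertices, its first vertex has a
  neighbour outside it.\<close>

lemma long_path:
  assumes W: "finite W" "W \<noteq> {}" "E \<subseteq> all_edges W" and deg: "\<And>v. v \<in> W \<Longrightarrow> k \<le> deg E v"
    and j: "Suc j \<le> k"
  shows "\<exists>xs. ispath E xs \<and> length xs = Suc j \<and> set xs \<subseteq> W"
  using j
proof (induction j)
  case 0
  obtain v where "v \<in> W" using W by blast
  then show ?case by (intro exI[of _ "[v]"]) simp
next
  case (Suc j)
  then obtain xs where xs: "ispath E xs" "length xs = Suc j" "set xs \<subseteq> W" by auto
  then obtain x ys where x: "xs = x # ys" by (cases xs) auto
  have "card (set xs) < card (nbh E x)"
    using deg[of x] card_length[of xs] xs x Suc.prems by (simp add: deg_def)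
  then have "\<not> nbh E x \<subseteq> set xs" using card_mono[of "set xs" "nbh E x"] by auto
  then obtain u where u: "u \<in> nbh E x" "u \<notin> set xs" by blast
  then have "ispath E (u # xs)" using xs x by (auto simp: ispath_Cons nbh_def insert_commute)
  moreover have "u \<in> W" using nbh_subset[OF W(3)] u(1) by blast
  ultimately show ?case using xs by (intro exI[of _ "u # xs"]) simp
qed

text \<open>By \<open>long_path\<close> some vertex has degree less than \<open>k\<close>. Deleting
  it lowers the degree sum by at most twice its degree, and the rest is still path-free.\<close>

lemma sum_deg_le:
  assumes "finite W" "E \<subseteq> all_edges W" "pfree k E"
  shows "(\<Sum>v\<in>W. deg E v) \<le> 2 * k * card W"
  using assms
proof (induction "card W" arbitrary: W E)
  case 0
  then show ?case by simp
next
  case (Suc m)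
  have "0 < k" using pfreeD[OF Suc.prems(3), of "[]"] by simp
  then obtain k' where k': "k = Suc k'" by (cases k) auto
  have ne: "W \<noteq> {}" using Suc.hyps(2) by auto
  have "\<exists>v\<in>W. deg E v < k"
  proof (rule ccontr)
    assume "\<not> (\<exists>v\<in>W. deg E v < k)"
    then have "\<And>v. v \<in> W \<Longrightarrow> k \<le> deg E v" by force
    from long_path[OF Suc.prems(1) ne Suc.prems(2) this, of k'] k'
    obtain xs where "ispath E xs" "length xs = k" by auto
    then show False using pfreeD[OF Suc.prems(3)] by auto
  qed
  then obtain v where v: "v \<in> W" "deg E v < k" by blast
  define F where "F = {e \<in> E. v \<notin> e}"
  have F: "F \<subseteq> all_edges (W - {v})"
  proof
    fix e assume e: "e \<in> F"
    then have "e \<in> all_edges W" using Suc.prems(2) by (auto simp: F_def)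
    then obtain a b where "e = {a, b}" "a \<in> W" "b \<in> W" "a \<noteq> b" by (rule all_edgesE)
    then show "e \<in> all_edges (W - {v})" using e by (auto simp: F_def)
  qed
  have "pfree k F" unfolding pfree_def
  proof (intro allI impI)
    fix xs assume "ispath F xs"
    then have "ispath E xs" by (rule ispath_mono) (auto simp: F_def)
    then show "length xs < k" by (rule pfreeD[OF Suc.prems(3)])
  qed
  then have IH: "(\<Sum>u\<in>W - {v}. deg F u) \<le> 2 * k * card (W - {v})"
    using Suc.hyps Suc.prems(1) v(1) F by (intro Suc.hyps(1)) auto
  have fin: "finite (nbh E v)" by (rule finite_nbh[OF Suc.prems(1,2)])
  have d: "deg E u \<le> deg F u + of_bool (u \<in> nbh E v)" if u: "u \<in> W - {v}" for u
  proof -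
    have finF: "finite (nbh F u)" using finite_nbh[OF _ F] Suc.prems(1) by simp
    have "nbh E u \<subseteq> nbh F u \<union> (if u \<in> nbh E v then {v} else {})"
    proof
      fix x assume x: "x \<in> nbh E u"
      show "x \<in> nbh F u \<union> (if u \<in> nbh E v then {v} else {})"
      proof (cases "x = v")
        case True
        then show ?thesis using x by (simp add: nbh_def insert_commute)
      next
        case False
        then show ?thesis using x u by (auto simp add: nbh_def F_def)
      qed
    qed
    from card_mono[OF _ this] finF
    have "deg E u \<le> card (nbh F u \<union> (if u \<in> nbh E v then {v} else {}))" by (simp add: deg_def)
    also have "\<dots> \<le> deg F u + card (if u \<in> nbh E v then {v} else {})" unfolding deg_def by (rule card_Un_le)
    finally show ?thesis by (cases "u \<in> nbh E v") simp_all
  qed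
  have "(\<Sum>u\<in>W. deg E u) = deg E v + (\<Sum>u\<in>W - {v}. deg E u)"
    using v(1) Suc.prems(1) by (simp add: sum.remove)
  also have "(\<Sum>u\<in>W - {v}. deg E u) \<le> (\<Sum>u\<in>W - {v}. deg F u + of_bool (u \<in> nbh E v))"
    by (rule sum_mono[OF d])
  also have "\<dots> = (\<Sum>u\<in>W - {v}. deg F u) + card ((W - {v}) \<inter> nbh E v)"
    using Suc.prems(1) by (simp add: sum.distrib sum_of_bool_eq Int_def)
  also have "card ((W - {v}) \<inter> nbh E v) \<le> deg E v"
    unfolding deg_def using fin by (intro card_mono) auto
  finally have "(\<Sum>u\<in>W. deg E u) \<le> 2 * deg E v + 2 * k * card (W - {v})" using IH by simp
  also have "\<dots> \<le> 2 * k * (1 + card (W - {v}))" using v(2) by simp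
  also have "1 + card (W - {v}) = card W" using v(1) Suc.prems(1) by (metis Suc_eq_plus1_left card_Suc_Diff1)
  finally show ?case by simp
qed

section \<open>The starting position, and the order of magnitude of the score\<close>

definition singletons :: "'a set \<Rightarrow> 'a set set" where
  "singletons A = (\<lambda>v. {v}) ` A"

lemma partition_singletons: "partition_on A (singletons A)"
  by (rule partition_onI) (auto simp: singletons_def disjnt_def)

lemma clq_singletons: "clq (singletons A) = {}"
  by (auto simp: clq_def singletons_def all_edges_def)

lemma cnt_singletons: "cnt (singletons A) i = (if i = 1 then card A else 0)"
proof (cases "i = 1")
  case True
  have "{C \<in> singletons A. card C = i} = singletons A" using True by (auto simp: singletons_def)
  moreover have "card (singletons A) = card A" unfolding singletons_def by (rule card_image) simp
  ultimately show ?thesis using True by (simp add: cnt_def)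
next
  case False
  then have none: "{C \<in> singletons A. card C = i} = {}" by (auto simp: singletons_def)
  show ?thesis using False unfolding cnt_def none by simp
qed

context path_game
begin

definition score :: "nat \<Rightarrow> nat set set \<Rightarrow> nat" where
  "score l E = (\<Sum>v\<in>V. deg E v choose (l - 1))"

lemma part_singletons: "part (singletons V)"
  using partition_singletons k4 by (auto simp: part_def singletons_def)

lemma pos_empty: "pos {}"
  using part_pos[OF part_singletons] by simp

lemma deg_outside: "pos E \<Longrightarrow> u \<notin> V \<Longrightarrow> deg E u = 0"
proof -
  assume E: "pos E" and u: "u \<notin> V"
  have "nbh E u = {}"
  proof (rule ccontr)
    assume "nbh E u \<noteq> {}"
    then obtain x where "{u, x} \<in> E" by (auto simp: nbh_def)
    then have "{u, x} \<in> all_edges V" using posD(1)[OF E] by (rule set_mp[rotated])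
    then show False using u by simp
  qed
  then show ?thesis by (simp add: deg_def)
qed

lemma deg_less: "pos E \<Longrightarrow> v \<in> V \<Longrightarrow> deg E v < n"
proof -
  assume E: "pos E" and v: "v \<in> V"
  have "deg E v \<le> card (V - {v})" unfolding deg_def
    using nbh_subset[OF posD(1)[OF E]] by (intro card_mono) auto
  also have "\<dots> < n" using v by (simp add: card_Diff_singleton)
  finally show ?thesis .
qed

text \<open>Of the \<open>l - 1\<close> factors bounding the binomial coefficient, one is kept as
  the degree and summed with \<open>sum_deg_le\<close>; the others are bounded by
  \<open>n\<close>.\<close>

lemma score_upper:
  assumes l: "3 \<le> l" and E: "pos E"
  shows "score l E \<le> 2 * k * n ^ (l - 1)"
proof -
  have l2: "l - 1 = Suc (l - 2)" using l by simp
  have "score l E \<le> (\<Sum>v\<in>V. deg E v * n ^ (l - 2))" unfolding score_def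
  proof (rule sum_mono)
    fix v assume v: "v \<in> V"
    have "deg E v choose (l - 1) \<le> deg E v ^ (l - 1)"
    proof (cases "l - 1 \<le> deg E v")
      case True then show ?thesis by (rule binomial_le_pow)
    next
      case False then show ?thesis by (simp add: binomial_eq_0)
    qed
    also have "\<dots> = deg E v * deg E v ^ (l - 2)" unfolding l2 by simp
    also have "\<dots> \<le> deg E v * n ^ (l - 2)"
      using deg_less[OF E v] by (intro mult_left_mono power_mono) auto
    finally show "deg E v choose (l - 1) \<le> deg E v * n ^ (l - 2)" .
  qed
  also have "\<dots> = (\<Sum>v\<in>V. deg E v) * n ^ (l - 2)" by (simp add: sum_distrib_right)
  also have "\<dots> \<le> (2 * k * card V) * n ^ (l - 2)"
    using sum_deg_le[OF _ posD[OF E]] by (intro mult_right_mono) auto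
  also have "\<dots> = 2 * k * n ^ (l - 1)" unfolding l2 by simp
  finally show ?thesis .
qed

lemma card_copies_score:
  "3 \<le> l \<Longrightarrow> pos E \<Longrightarrow> card (copies (star_graph l) (V, E)) = score l E"
  using card_copies_star[OF _ _ posD(1)] by (simp add: score_def)

lemma forces_pos:
  assumes "forces (path_graph k) n w \<Phi> p E" "pos E"
  shows "forces (path_graph k) n w (\<lambda>E. pos E \<and> \<Phi> E) p E"
  using assms
proof induction
  case (forces_end E p)
  then show ?case by (intro forces.forces_end) auto
next
  case (forces_own e E)
  then show ?case by (intro forces.forces_own[of e]) (auto dest: legal_pos)
next
  case (forces_opp E)
  then show ?case by (intro forces.forces_opp) (auto dest: legal_pos)
qed

lemma maxi_sat_score:
  assumes "3 \<le> l" "maxi \<Phi> first {}" "\<And>E. pos E \<Longrightarrow> \<Phi> E \<Longrightarrow> B \<le> score l E"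
  shows "B \<le> sat_score first n (star_graph l) (path_graph k)"
  unfolding sat_score_def
  using Max_player_forces[OF forces_pos[OF assms(2) pos_empty], of B "star_graph l"] assms(1,3) card_copies_score
  by simp

lemma mini_sat_score:
  assumes "3 \<le> l" "mini \<Phi> first {}" "\<And>E. pos E \<Longrightarrow> \<Phi> E \<Longrightarrow> score l E \<le> B"
  shows "sat_score first n (star_graph l) (path_graph k) \<le> B"
  unfolding sat_score_def
  using Mini_player_forces[OF forces_pos[OF assms(2) pos_empty], of "star_graph l" B] assms(1,3) card_copies_score
  by simp

lemma sat_score_upper:
  "3 \<le> l \<Longrightarrow> sat_score first n (star_graph l) (path_graph k) \<le> 2 * k * n ^ (l - 1)"
  by (rule mini_sat_score[of l "\<lambda>_. True", OF _ forces_superset[OF pos_empty] score_upper]) simp_all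

text \<open>Degree \<open>t\<close> comes from \<open>s = 3 * t\<close>, whence
  \<open>5 * s = 15 * t\<close>. The constant \<open>202\<close> adds to that of
  \<open>maxi_start\<close> the two vertices that Mini's opening edge uses up when she
  starts.\<close>

lemma sat_score_lower:
  assumes k: "7 \<le> k" and l: "3 \<le> l" and t: "1 \<le> t" "15 * t + 3 * k * k + 202 \<le> n"
  shows "t choose (l - 1) \<le> sat_score first n (star_graph l) (path_graph k)"
proof -
  define \<Phi> where "\<Phi> = (\<lambda>E. \<exists>u\<in>V. t \<le> deg E u)"
  have goal: "dgoal \<Phi> {} (3 * t)" unfolding dgoal_def
  proof (intro allI impI)
    fix E' u assume E': "pos E'" and d: "3 * t \<le> 3 * deg E' u"
    have "u \<in> V" using deg_outside[OF E', of u] d t(1) by (cases "u \<in> V") auto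
    then show "\<Phi> E'" using d by (auto simp: \<Phi>_def)
  qed
  let ?P = "singletons V"
  have win: "maxi \<Phi> first {}"
  proof (cases first)
    case Max_player
    have "maxi \<Phi> Max_player (clq ?P)"
      by (rule maxi_start[OF k goal part_singletons]) (use t in \<open>auto simp: cnt_singletons\<close>)
    then show ?thesis using Max_player by (simp add: clq_singletons)
  next
    case Mini_player
    have "maxi \<Phi> Mini_player (clq ?P)"
    proof (rule maxi_after_pair[OF part_singletons _ _ goal])
      fix P' assume P': "part P'" "cnt P' 1 + 2 = cnt ?P 1" "cnt P' 2 = cnt ?P 2 + 1"
        "\<And>i. 3 \<le> i \<Longrightarrow> cnt P' i = cnt ?P i"
      show "maxi \<Phi> Max_player (clq P')"
      proof (rule maxi_start[OF k goal P'(1)])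
        show "cnt P' i = 0" if "i \<notin> {1, 2}" for i
          using that P'(4)[of i] cnt_0[OF P'(1)] by (cases "i = 0") (auto simp: cnt_singletons)
        show "5 * (3 * t) + 3 * k * k + 200 \<le> cnt P' 1"
          using P'(2) t by (simp add: cnt_singletons)
      qed
    qed (use t in \<open>auto simp: cnt_singletons\<close>)
    then show ?thesis using Mini_player by (simp add: clq_singletons)
  qed
  show ?thesis
  proof (rule maxi_sat_score[OF l win])
    fix E assume "pos E" "\<Phi> E"
    then obtain u where u: "u \<in> V" "t \<le> deg E u" by (auto simp: \<Phi>_def)
    have "t choose (l - 1) \<le> deg E u choose (l - 1)" using u(2) by (rule binomial_right_mono)
    also have "\<dots> \<le> score l E" unfolding score_def
      by (rule member_le_sum[OF u(1)]) auto
    finally show "t choose (l - 1) \<le> score l E" .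
  qed
qed

end

lemma sat_score_bigtheta:
  assumes k: "7 \<le> k" and l: "3 \<le> l"
  shows "(\<lambda>n. real (sat_score first n (star_graph l) (path_graph k))) \<in> \<Theta>(\<lambda>n. real n ^ (l - 1))"
proof (rule bigthetaI)
  show "(\<lambda>n. real (sat_score first n (star_graph l) (path_graph k))) \<in> O(\<lambda>n. real n ^ (l - 1))"
  proof (rule bigoI[of _ "2 * real k"], rule always_eventually, rule allI)
    fix n
    interpret path_game k n by unfold_locales (use k in simp)
    have "real (sat_score first n (star_graph l) (path_graph k)) \<le> real (2 * k * n ^ (l - 1))"
      using sat_score_upper[OF l] by (simp only: of_nat_le_iff)
    then show "norm (real (sat_score first n (star_graph l) (path_graph k))) \<le> 2 * real k * norm (real n ^ (l - 1))"
      by simp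
  qed
  show "(\<lambda>n. real (sat_score first n (star_graph l) (path_graph k))) \<in> \<Omega>(\<lambda>n. real n ^ (l - 1))"
  proof (rule landau_omega.bigI[of "(1 / (32 * real (l - 1))) ^ (l - 1)"])
    show "\<forall>\<^sub>F n in sequentially. norm (real (sat_score first n (star_graph l) (path_graph k))) \<ge>
        (1 / (32 * real (l - 1))) ^ (l - 1) * norm (real n ^ (l - 1))"
      unfolding eventually_sequentially
    proof (intro exI allI impI)
      fix n assume n: "16 * (3 * k * k + 202 + l) \<le> n"
      interpret path_game k n by unfold_locales (use k in simp)
      \<comment> \<open>From \<open>16 * t \<le> n\<close> at least \<open>t\<close> vertices remain
        beyond \<open>15 * t\<close>, enough for the fixed costs; and
        \<open>n < 16 * t + 16 \<le> 32 * t\<close> gives the factor \<open>32\<close>.\<close>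
      define t where "t = n div 16"
      have t1: "3 * k * k + 202 + l \<le> t" using div_le_mono[OF n, of 16] by (simp add: t_def)
      have t2: "16 * t \<le> n" "n < 16 * t + 16" by (simp_all add: t_def)
      have low: "t choose (l - 1) \<le> sat_score first n (star_graph l) (path_graph k)"
        by (rule sat_score_lower[OF k l]) (use t1 t2 in linarith)+
      have "real n / (32 * real (l - 1)) \<le> real t / real (l - 1)"
      proof -
        have "n \<le> 32 * t" using t1 t2 by linarith
        then have "real n \<le> 32 * real t" by (simp flip: of_nat_le_iff[where 'a = real])
        then have "real n / 32 / real (l - 1) \<le> real t / real (l - 1)" by (intro divide_right_mono) simp_all
        then show ?thesis by simp
      qed
      then have "(real n / (32 * real (l - 1))) ^ (l - 1) \<le> (real t / real (l - 1)) ^ (l - 1)"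
        by (intro power_mono) auto
      also have "\<dots> \<le> real (t choose (l - 1))"
        by (rule binomial_ge_n_over_k_pow_k) (use t1 in linarith)
      also have "\<dots> \<le> real (sat_score first n (star_graph l) (path_graph k))" using low by simp
      finally show "(1 / (32 * real (l - 1))) ^ (l - 1) * norm (real n ^ (l - 1))
        \<le> norm (real (sat_score first n (star_graph l) (path_graph k)))"
        by (simp add: power_divide power_mult_distrib)
    qed
  qed (use l in simp)
qed

section \<open>Short paths: Max builds cliques\<close>

context path_game
begin

text \<open>The number of vertices in unfinished classes. A triangle is finished for
  \<open>k = 4\<close>, but for \<open>k = 5\<close> it still has to grow.\<close>

definition slack :: "nat set set \<Rightarrow> nat" where
  "slack P = cnt P 1 + 2 * cnt P 2 + (if k = 5 then 3 * cnt P 3 else 0)"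

lemma card_Union_size:
  assumes "part P"
  shows "card (\<Union>{C \<in> P. card C = i}) \<le> i * cnt P i"
proof -
  have "card (\<Union>{C \<in> P. card C = i}) \<le> (\<Sum>C\<in>{C \<in> P. card C = i}. card C)"
    using part_fin[OF assms] by (intro card_Union_le_sum_card)
  also have "\<dots> = i * cnt P i" by (simp add: cnt_def)
  finally show ?thesis .
qed

text \<open>A vertex of a finished clique has degree at least \<open>k - 2\<close> and contributes
  \<open>w\<close>. The vertex \<open>u\<close> is counted with its own degree instead, which costs
  the additional \<open>w\<close> on the right.\<close>

lemma score_cliques:
  assumes l: "3 \<le> l" and P: "part P" and k: "k \<in> {4, 5}" and c: "\<And>i. i \<notin> {1, 2, 3, k - 1} \<Longrightarrow> cnt P i = 0"
    and E: "pos E" "clq P \<subseteq> E"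
  defines "w \<equiv> (k - 2) choose (l - 1)"
  shows "w * n + (deg E u choose (l - 1)) \<le> score l E + w * slack P + w"
proof -
  define W where "W = \<Union>{C \<in> P. card C = k - 1}"
  define R where "R = \<Union>{C \<in> P. card C = 1} \<union> \<Union>{C \<in> P. card C = 2} \<union>
    (if k = 5 then \<Union>{C \<in> P. card C = 3} else {})"
  have WV: "W \<subseteq> V" using part_sub[OF partD(1)[OF P]] by (auto simp: W_def)
  have finW: "finite W" using WV finite_subset by blast
  have dW: "w \<le> deg E v choose (l - 1)" if v: "v \<in> W" for v
  proof -
    obtain C where C: "C \<in> P" "card C = k - 1" "v \<in> C" using v by (auto simp: W_def)
    have "C - {v} \<subseteq> nbh E v"
    proof
      fix x assume "x \<in> C - {v}"
      then have "{v, x} \<in> clq P" using C by (auto simp: clq_pair)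
      then show "x \<in> nbh E v" using E(2) by (auto simp: nbh_def)
    qed
    from card_mono[OF finite_nbh[OF _ posD(1)[OF E(1)]] this]
    have "k - 2 \<le> deg E v" using C part_fin(2)[OF P C(1)] by (simp add: deg_def)
    then show ?thesis unfolding w_def by (rule binomial_right_mono)
  qed
  have "V \<subseteq> W \<union> R"
  proof
    fix v assume "v \<in> V"
    then obtain C where C: "C \<in> P" "v \<in> C" using part_ex[OF partD(1)[OF P]] by blast
    have "card C \<in> {1, 2, 3, k - 1}"
    proof (rule ccontr)
      assume "card C \<notin> {1, 2, 3, k - 1}"
      from c[OF this] cnt_zeroD[OF part_fin(1)[OF P] C(1)] show False by simp
    qed
    then show "v \<in> W \<union> R"
      using C k by (auto simp: W_def R_def)
  qed
  moreover have "finite (\<Union>{C \<in> P. card C = i})" for i using part_fin[OF P] by auto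
  ultimately have "card V \<le> card (W \<union> R)"
    using finW unfolding R_def by (intro card_mono) auto
  also have "\<dots> \<le> card W + (card (\<Union>{C \<in> P. card C = 1}) + card (\<Union>{C \<in> P. card C = 2}) + card (if k = 5 then \<Union>{C \<in> P. card C = 3} else {}))"
    unfolding R_def by (intro order_trans[OF card_Un_le] add_mono order_refl)
  also have "\<dots> \<le> card W + slack P"
    using card_Union_size[OF P, of 1] card_Union_size[OF P, of 2] card_Union_size[OF P, of 3]
    by (auto simp: slack_def)
  finally have nW: "n \<le> card W + slack P" by simp
  have "w * card W + (deg E u choose (l - 1)) \<le> score l E + w"
  proof (cases "u \<in> V")
    case True
    have "card W \<le> card (W - {u}) + 1" using finW by (cases "u \<in> W") auto
    then have "w * card W \<le> w * card (W - {u}) + w" by (metis distrib_left mult.right_neutral mult_le_mono2)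
    moreover have "w * card (W - {u}) \<le> (\<Sum>v\<in>W - {u}. deg E v choose (l - 1))"
      using sum_bounded_below[of "W - {u}" w "\<lambda>v. deg E v choose (l - 1)"] dW by (simp add: mult.commute)
    moreover have "(\<Sum>v\<in>insert u (W - {u}). deg E v choose (l - 1)) \<le> score l E"
      unfolding score_def using True WV by (intro sum_mono2) auto
    moreover have "(\<Sum>v\<in>insert u (W - {u}). deg E v choose (l - 1)) =
        (deg E u choose (l - 1)) + (\<Sum>v\<in>W - {u}. deg E v choose (l - 1))"
      using finW by (intro sum.insert) auto
    ultimately show ?thesis by linarith
  next
    case False
    then have "deg E u choose (l - 1) = 0" using deg_outside[OF E(1)] l by simp
    moreover have "w * card W \<le> (\<Sum>v\<in>W. deg E v choose (l - 1))"
      using sum_bounded_below[of W w "\<lambda>v. deg E v choose (l - 1)"] dW by (simp add: mult.commute)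
    moreover have "\<dots> \<le> score l E"
      unfolding score_def using WV by (intro sum_mono2) auto
    ultimately show ?thesis by linarith
  qed
  moreover have "w * n \<le> w * card W + w * slack P"
    using nW by (metis add_mult_distrib2 mult_le_mono2)
  ultimately show ?thesis by linarith
qed

text \<open>The left-hand sides here and in \<open>choose_3_bound\<close> are
  \<open>w * (3 * d + 40) + w\<close> for \<open>w = 3\<close> and \<open>w = 1\<close>. The
  generous constant \<open>1000\<close> covers the small \<open>d\<close>.\<close>

lemma choose_2_bound: "9 * d + 123 \<le> (d choose 2) + 1000"
proof (cases "d \<le> 9")
  case False
  then have "10 \<le> d" by simp
  then show ?thesis
  proof (induction d rule: dec_induct)
    case (step d)
    have "Suc d choose 2 = d + (d choose 2)" by (simp add: numeral_2_eq_2)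
    then show ?case using step by simp
  qed (simp add: choose_two)
qed simp

lemma choose_3_bound: "3 * d + 41 \<le> (d choose 3) + 1000"
proof (cases "d \<le> 3")
  case False
  then have "4 \<le> d" by simp
  then show ?thesis
  proof (induction d rule: dec_induct)
    case (step d)
    have "4 choose 2 \<le> d choose 2" using step(1) by (rule binomial_right_mono)
    then have "3 \<le> d choose 2" by (simp add: choose_two)
    moreover have "Suc d choose 3 = (d choose 2) + (d choose 3)" by (simp add: numeral_3_eq_3 numeral_2_eq_2)
    ultimately show ?case using step by simp
  qed simp
qed simp

lemma choose_bound:
  assumes "k \<in> {4, 5}" "l \<in> {3, 4}" "l < k" "s \<le> 3 * d" "r \<le> s + 40"
  shows "((k - 2) choose (l - 1)) * r + ((k - 2) choose (l - 1)) \<le> (d choose (l - 1)) + 1000"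
proof -
  have r: "r \<le> 3 * d + 40" using assms by simp
  consider "k = 4" "l = 3" | "k = 5" "l = 3" | "k = 5" "l = 4" using assms by auto
  then show ?thesis
  proof cases
    case 1
    then show ?thesis using r choose_2_bound[of d] by (simp add: numeral_2_eq_2)
  next
    case 2
    have "(3::nat) choose 2 = 3" by (simp add: choose_two)
    then show ?thesis using 2 r choose_2_bound[of d] by simp
  next
    case 3
    then show ?thesis using r choose_3_bound[of d] by simp
  qed
qed

definition near :: "nat \<Rightarrow> nat set set \<Rightarrow> bool" where
  "near l E \<longleftrightarrow> ((k - 2) choose (l - 1)) * n \<le> score l E + 1000"

text \<open>If the threat is carried out, a vertex of degree \<open>d \<ge> s / 3\<close> appears.
  Its \<open>d choose (l - 1)\<close> stars make up for the unfinished vertices, of which there are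
  at most \<open>3 * d + 40\<close>.\<close>

lemma dgoal_near:
  assumes k: "k \<in> {4, 5}" "l \<in> {3, 4}" "l < k" and P: "part P" "\<And>i. i \<notin> {1, 2, 3, k - 1} \<Longrightarrow> cnt P i = 0"
    and s: "slack P \<le> s + 40"
  shows "dgoal (near l) (clq P) s"
  unfolding dgoal_def near_def
proof (intro allI impI)
  fix E u assume E: "pos E" "clq P \<subseteq> E" and d: "s \<le> 3 * deg E u"
  have "3 \<le> l" using k by auto
  from score_cliques[OF this P(1) k(1) P(2) E, of u] choose_bound[OF k d s]
  show "((k - 2) choose (l - 1)) * n \<le> score l E + 1000" by simp
qed

text \<open>In a cycle of moves Max makes two isolated edges and turns one after the other into a
  clique on \<open>k - 1\<close> vertices. For \<open>k = 5\<close> Mini can insert one new edge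
  while a triangle is being enlarged, so there are never more than two edges at the beginning of a
  step.\<close>

lemma maxi_near:
  assumes k: "k \<in> {4, 5}" "l \<in> {3, 4}" "l < k"
  shows "part P \<Longrightarrow> (\<And>i. i \<notin> {1, 2, k - 1} \<Longrightarrow> cnt P i = 0) \<Longrightarrow> cnt P 2 \<le> 2 \<Longrightarrow>
    maxi (near l) Max_player (clq P)"
proof (induction "cnt P 1" arbitrary: P rule: less_induct)
  case less
  note P = less.prems
  have c0: "cnt P i = 0" if "i \<notin> {1, 2, 3, k - 1}" for i using P(2) that by auto
  have sl: "slack P = cnt P 1 + 2 * cnt P 2" using P(2)[of 3] by (auto simp: slack_def)
  show ?case
  proof (cases "cnt P 1 < 30")
    case True
    have "dgoal (near l) (clq P) 0"
      by (rule dgoal_near[OF k P(1) c0]) (use sl True P(3) in auto)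
    then show ?thesis
      using part_pos[OF P(1) order_refl] by (intro forces_superset) (auto simp: dgoal_def)
  next
    case False
    \<comment> \<open>The reserve of \<open>30\<close> pays for the next clique,
      \<open>maxi_grow\<close> with \<open>c = 3\<close> asking for \<open>s + 14\<close>, and keeps
      the slack below \<open>s + 40\<close>.\<close>
    define s where "s = cnt P 1 - 30"
    have s: "cnt P 1 = s + 30" using False by (simp add: s_def)
    have goal: "dgoal (near l) (clq P) s"
      by (rule dgoal_near[OF k P(1) c0]) (use sl s P(3) in auto)
    show ?thesis
    proof (cases "cnt P 2 = 0")
      case True
      show ?thesis
      proof (rule maxi_two_pairs[OF P(1) goal order_refl])
        fix P' assume P': "part P'" "cnt P' 1 + 4 = cnt P 1" "cnt P' 2 = cnt P 2 + 2"
          "\<And>i. 3 \<le> i \<Longrightarrow> cnt P' i = cnt P i"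
        show "maxi (near l) Max_player (clq P')"
        proof (rule less.hyps[OF _ P'(1)])
          show "cnt P' i = 0" if "i \<notin> {1, 2, k - 1}" for i
            using that P'(4)[of i] P(2)[of i] cnt_0[OF P'(1)] by (cases "i = 0") auto
        qed (use P' True in auto)
      qed (use s in simp)
    next
      case False
      show ?thesis
      proof (rule maxi_triangle[OF P(1) goal order_refl])
        fix P' assume P': "part P'" "cnt P' 1 + 1 = cnt P 1" "cnt P' 2 + 1 = cnt P 2"
          "cnt P' 3 = cnt P 3 + 1" "\<And>i. 4 \<le> i \<Longrightarrow> cnt P' i = cnt P i"
        have z: "cnt P' i = 0" if "i \<notin> {1, 2, 3, k - 1}" for i
          using that P'(5)[of i] P(2)[of i] cnt_0[OF P'(1)] by (cases "i = 0") auto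
        show "maxi (near l) Max_player (clq P')"
        proof (cases "k = 4")
          case True
          show ?thesis by (rule less.hyps[OF _ P'(1)]) (use P' P(3) z True in auto)
        next
          case False
          then have k5: "k = 5" using k by simp
          have c3: "cnt P' 3 = 1" using P'(4) P(2)[of 3] k5 by simp
          then obtain Q where Q: "Q \<in> P'" "card Q = 3"
            using cnt_pos[OF part_fin(1)[OF P'(1)], of 3] by auto
          have goal': "dgoal (near l) (clq P') s"
            by (rule dgoal_near[OF k P'(1) z]) (use P'(2,3) P(3) c3 s in \<open>auto simp: slack_def\<close>)
          show ?thesis
          proof (rule maxi_grow[OF P'(1) Q _ _ goal' order_refl])
            fix P2 f assume P2: "part P2" "f \<le> 3 - 2" "cnt P2 1 + 2 * f + 1 = cnt P' 1"
              "\<And>i. 2 \<le> i \<Longrightarrow> cnt P2 i + of_bool (i = 3) = cnt P' i + of_bool (i = Suc 3) + of_bool (i = 2) * f"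
            show "maxi (near l) Max_player (clq P2)"
            proof (rule less.hyps[OF _ P2(1)])
              show "cnt P2 1 < cnt P 1" using P2(3) P'(2) by simp
              show "cnt P2 2 \<le> 2" using P2(4)[of 2] P2(2) P'(3) P(3) by simp
              show "cnt P2 i = 0" if i: "i \<notin> {1, 2, k - 1}" for i
              proof (cases "i = 0 \<or> i = 3")
                case True
                then show ?thesis using cnt_0[OF P2(1)] P2(4)[of 3] c3 by auto
              next
                case False
                then have "2 \<le> i" "i \<noteq> 3" "i \<noteq> 4" using i k5 by auto
                then show ?thesis using P2(4)[of i] z[of i] i by auto
              qed
            qed
          qed (use k5 P'(2) s in simp_all)
        qed
      qed (use s False in simp_all)
    qed
  qed
qed

lemma sat_score_near:
  assumes k: "k \<in> {4, 5}" "l \<in> {3, 4}" "l < k"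
  shows "((k - 2) choose (l - 1)) * n \<le> sat_score first n (star_graph l) (path_graph k) + 1000"
proof -
  let ?P = "singletons V"
  have win: "maxi (near l) first {}"
  proof (cases first)
    case Max_player
    have "maxi (near l) Max_player (clq ?P)"
      by (rule maxi_near[OF k part_singletons]) (auto simp: cnt_singletons)
    then show ?thesis using Max_player by (simp add: clq_singletons)
  next
    case Mini_player
    \<comment> \<open>For \<open>n \<le> 40\<close> the difference is \<open>0\<close>, and the goal
      then holds of every position.\<close>
    have goal: "dgoal (near l) (clq ?P) (n - 40)"
      by (rule dgoal_near[OF k part_singletons]) (auto simp: cnt_singletons slack_def)
    have "maxi (near l) Mini_player (clq ?P)"
    proof (cases "n \<le> 40")
      case True
      then show ?thesis using goal pos_empty
        by (intro forces_superset) (auto simp: dgoal_def clq_singletons)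
    next
      case False
      show ?thesis
      proof (rule maxi_after_pair[OF part_singletons _ _ goal order_refl])
        fix P' assume P': "part P'" "cnt P' 1 + 2 = cnt ?P 1" "cnt P' 2 = cnt ?P 2 + 1"
          "\<And>i. 3 \<le> i \<Longrightarrow> cnt P' i = cnt ?P i"
        show "maxi (near l) Max_player (clq P')"
        proof (rule maxi_near[OF k P'(1)])
          show "cnt P' i = 0" if "i \<notin> {1, 2, k - 1}" for i
            using that P'(4)[of i] cnt_0[OF P'(1)] by (cases "i = 0") (auto simp: cnt_singletons)
        qed (use P'(3) in \<open>auto simp: cnt_singletons\<close>)
      qed (use False in \<open>auto simp: cnt_singletons\<close>)
    qed
    then show ?thesis using Mini_player by (simp add: clq_singletons)
  qed
  have l: "3 \<le> l" using k by auto
  have "((k - 2) choose (l - 1)) * n - 1000 \<le> sat_score first n (star_graph l) (path_graph k)"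
    by (rule maxi_sat_score[OF l win]) (auto simp: near_def)
  then show ?thesis by simp
qed

end

section \<open>Short paths: Mini keeps components Hamiltonian\<close>

text \<open>Homogeneous traceability: every vertex starts a Hamiltonian path of \<open>C\<close>. It
  follows from a Hamiltonian cycle and also covers a single vertex and a single edge.\<close>

definition htr :: "'a set set \<Rightarrow> 'a set \<Rightarrow> bool" where
  "htr E C \<longleftrightarrow> (\<forall>x\<in>C. \<exists>zs. ispath E (x # zs) \<and> set (x # zs) = C)"

lemma htr_mono: "htr E C \<Longrightarrow> E \<subseteq> E' \<Longrightarrow> htr E' C"
  unfolding htr_def by (meson ispath_mono)

lemma htrE:
  assumes "htr E C" "x \<in> C"
  obtains zs where "ispath E (x # zs)" "set (x # zs) = C" "length (x # zs) = card C"
  using assms unfolding htr_def by (metis distinct_card ispath_def)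

lemma htr_singleton: "htr E {x}"
  by (auto simp: htr_def intro: exI[of _ "[]"])

text \<open>The cycle is cut open in front of \<open>x\<close>. For two vertices the closing edge is
  the edge itself.\<close>

lemma htr_cycle:
  assumes zs: "ispath E zs" "zs \<noteq> []" "{last zs, hd zs} \<in> E"
  shows "htr E (set zs)"
  unfolding htr_def
proof
  fix x assume "x \<in> set zs"
  then obtain as bs where s: "zs = as @ x # bs" by (meson split_list)
  have p: "ispath E as" "ispath E (x # bs)" "set as \<inter> set (x # bs) = {}"
    using zs(1) unfolding s ispath_append by simp_all
  have "ispath E ((x # bs) @ as)"
    unfolding ispath_append[of E "x # bs"] using p zs(3) s by (cases as) auto
  then show "\<exists>ys. ispath E (x # ys) \<and> set (x # ys) = set zs"
    using s by (intro exI[of _ "bs @ as"]) auto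
qed

lemma htr_neighbour:
  assumes "htr E C" "2 \<le> card C" "x \<in> C"
  obtains y where "{x, y} \<in> E"
proof -
  obtain zs where "ispath E (x # zs)" "length (x # zs) = card C" using htrE[OF assms(1,3)] by metis
  then show thesis using that[of "hd zs"] assms(2) by (cases zs) (auto simp: ispath_Cons)
qed

lemma htr_path3:
  assumes "htr E C" "3 \<le> card C" "x \<in> C"
  obtains y z where "ispath E [x, y, z]" "set [x, y, z] \<subseteq> C"
proof -
  obtain zs where zs: "ispath E (x # zs)" "set (x # zs) = C" "length (x # zs) = card C"
    using htrE[OF assms(1,3)] .
  then obtain y z ws where "zs = y # z # ws" using assms(2) by (cases zs; cases "tl zs") auto
  then show thesis using that[of y z] zs by (auto simp: ispath_Cons)
qed

lemma htr_join_path: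
  assumes P: "partition_on A P" and C: "C \<in> P" "D \<in> P" "C \<noteq> D" "p \<in> C" "q \<in> D"
    and h: "htr E C" "htr E D"
  obtains xs ys where "ispath (insert {p, q} E) (rev (p # xs) @ q # ys)" "set (p # xs) = C" "set (q # ys) = D"
    "length (rev (p # xs) @ q # ys) = card C + card D"
proof -
  obtain xs where xs: "ispath E (p # xs)" "set (p # xs) = C" "length (p # xs) = card C"
    using htrE[OF h(1) C(4)] .
  obtain ys where ys: "ispath E (q # ys)" "set (q # ys) = D" "length (q # ys) = card D"
    using htrE[OF h(2) C(5)] .
  have sub: "E \<subseteq> insert {p, q} E" by auto
  have 1: "ispath (insert {p, q} E) (rev (p # xs))" "ispath (insert {p, q} E) (q # ys)"
    unfolding ispath_rev using ispath_mono[OF xs(1) sub] ispath_mono[OF ys(1) sub] .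
  have "set (rev (p # xs)) \<inter> set (q # ys) = {}"
    unfolding set_rev xs(2) ys(2) using part_disjoint[OF P C(1,2,3)] .
  then have "ispath (insert {p, q} E) (rev (p # xs) @ q # ys)"
    unfolding ispath_append[of _ "rev (p # xs)"] using 1 by simp
  then show thesis using that xs ys by auto
qed

context path_game
begin

definition HT :: "nat set set \<Rightarrow> nat set set \<Rightarrow> bool" where
  "HT P E \<longleftrightarrow> partition_on V P \<and> E \<subseteq> clq P \<and> (\<forall>C\<in>P. htr E C)"

text \<open>The shape that results when the last isolated vertex \<open>u\<close> is hung on a
  traceable class \<open>D\<close>.\<close>

definition pendant :: "nat set set \<Rightarrow> nat set \<Rightarrow> bool" where
  "pendant E C \<longleftrightarrow> (\<exists>u D x. C = insert u D \<and> u \<notin> D \<and> htr E D \<and> 2 \<le> card D \<and> card D + 1 < k \<and>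
     x \<in> D \<and> {u, x} \<in> E)"

text \<open>No isolated vertex is left and \<open>C0\<close> is the only class that may fail to be
  traceable. The value \<open>C0 = {}\<close>, which is never a class, stands for no
  exception.\<close>

definition settled_but :: "nat set set \<Rightarrow> nat set set \<Rightarrow> nat set \<Rightarrow> bool" where
  "settled_but P E C0 \<longleftrightarrow> partition_on V P \<and> E \<subseteq> clq P \<and> (\<forall>C\<in>P. C \<noteq> C0 \<longrightarrow> 2 \<le> card C \<and> htr E C) \<and>
     (C0 \<in> P \<longrightarrow> pendant E C0)"

lemma pendantE:
  assumes "pendant E C"
  obtains u D x where "C = insert u D" "u \<notin> D" "htr E D" "2 \<le> card D" "card D + 1 < k" "x \<in> D" "{u, x} \<in> E"
  using assms unfolding pendant_def by (elim exE conjE) (rule that)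

lemma settled_butD:
  assumes "settled_but P E C0"
  shows "partition_on V P" "E \<subseteq> clq P" "C \<in> P \<Longrightarrow> C \<noteq> C0 \<Longrightarrow> 2 \<le> card C" "C \<in> P \<Longrightarrow> C \<noteq> C0 \<Longrightarrow> htr E C"
    "C0 \<in> P \<Longrightarrow> pendant E C0"
  using assms unfolding settled_but_def by simp_all

lemma htr_card: "pos E \<Longrightarrow> htr E C \<Longrightarrow> C \<noteq> {} \<Longrightarrow> card C < k"
  using htrE[of E C] pfreeD[OF posD(2)[of E]] by (metis ex_in_conv)

lemma HT_part: "pos E \<Longrightarrow> HT P E \<Longrightarrow> part P"
  using htr_card[of E] part_ne[of V P] by (auto simp: HT_def part_def)

lemma HT_inside: "HT P E \<Longrightarrow> e \<in> clq P \<Longrightarrow> HT P (insert e E)"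
  using htr_mono[of E _ "insert e E"] by (auto simp: HT_def)

text \<open>Spanning paths ending in \<open>p\<close> and starting in \<open>q\<close> combine to
  one path through both classes. Thus legal joins of traceable classes never reach \<open>k\<close>
  vertices.\<close>

lemma HT_join_card:
  assumes "HT P E" "C \<in> P" "D \<in> P" "C \<noteq> D" "p \<in> C" "q \<in> D" "pos (insert {p, q} E)"
  shows "card C + card D < k"
proof -
  have "partition_on V P" "htr E C" "htr E D" using assms by (auto simp: HT_def)
  from htr_join_path[OF this(1) assms(2-6) this(2,3)]
  obtain xs where "ispath (insert {p, q} E) xs" "length xs = card C + card D" by metis
  then show ?thesis using pfreeD[OF posD(2)[OF assms(7)]] by metis
qed

lemma HT_merge:
  assumes H: "HT P E" and C: "C \<in> P" "D \<in> P"
    and F: "F \<subseteq> clq (merge P C D)" "E \<subseteq> F" "htr F (C \<union> D)"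
  shows "HT (merge P C D) F"
  unfolding HT_def
proof (intro conjI ballI)
  show "partition_on V (merge P C D)" using partition_merge C H by (auto simp: HT_def)
  fix X assume "X \<in> merge P C D"
  then have "X = C \<union> D \<or> X \<in> P" by (auto simp: merge_def)
  then show "htr F X" using F(3) htr_mono[OF _ F(2), of X] H by (auto simp: HT_def)
qed (fact F(1))

lemma HT_pair:
  assumes H: "HT P E" and C: "{p} \<in> P" "{q} \<in> P" "p \<noteq> q"
  shows "HT (merge P {p} {q}) (insert {p, q} E)"
proof (rule HT_merge[OF H C(1,2)])
  show "insert {p, q} E \<subseteq> clq (merge P {p} {q})"
    using H C(3) by (intro clq_merge_insert) (auto simp: HT_def)
  have "htr (insert {p, q} E) (set [p, q])"
    using C(3) by (intro htr_cycle) (auto simp: ispath_Cons insert_commute)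
  then show "htr (insert {p, q} E) ({p} \<union> {q})" by (simp add: insert_commute)
qed auto

text \<open>Joining the far ends of spanning paths from \<open>p\<close> and from \<open>q\<close> closes a Hamiltonian cycle.\<close>

lemma HT_repair:
  assumes H: "HT P E" and C: "C \<in> P" "D \<in> P" "C \<noteq> D" "p \<in> C" "q \<in> D"
    and pos: "pos (insert {p, q} E)" and ns: "\<not> (card C = 1 \<and> card D = 1)"
  obtains e where "e \<in> legal (insert {p, q} E)" "HT (merge P C D) (insert e (insert {p, q} E))"
proof -
  have pP: "partition_on V P" and h: "htr E C" "htr E D" and E: "E \<subseteq> clq P" using H C by (auto simp: HT_def)
  have posE: "pos E" using pos ispath_mono[of E _ "insert {p, q} E"] by (auto simp: pos_def pfree_def)
  have P: "part P" using HT_part[OF posE H] .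
  have dis: "C \<inter> D = {}" using part_disjoint[OF pP C(1,2,3)] .
  let ?F = "insert {p, q} E"
  obtain xs ys where z: "ispath ?F (rev (p # xs) @ q # ys)" "set (p # xs) = C" "set (q # ys) = D"
    "length (rev (p # xs) @ q # ys) = card C + card D"
    using htr_join_path[OF pP C h] .
  define zs where "zs = rev (p # xs) @ q # ys"
  have sz: "set zs = C \<union> D" using z(2,3) by (auto simp: zs_def)
  define a b where "a = hd zs" and "b = last zs"
  have ab: "a = last (p # xs)" "b = last (q # ys)"
    by (simp_all add: a_def b_def zs_def hd_append hd_rev)
  have aC: "a \<in> C" "b \<in> D" using z(2,3) ab last_in_set[of "p # xs"] last_in_set[of "q # ys"] by auto
  have ne: "a \<noteq> b" using aC dis by auto
  \<comment> \<open>The closing edge would coincide with \<open>p q\<close> only if both classes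
    were single vertices.\<close>
  have "{a, b} \<noteq> {p, q}"
  proof
    assume "{a, b} = {p, q}"
    then have "a = p" "b = q" using aC C dis unfolding doubleton_eq_iff by auto
    moreover have "distinct (p # xs)" "distinct (q # ys)" using z(1) by (auto simp: ispath_def)
    ultimately have "xs = []" "ys = []" using ab by (auto split: if_splits)
    then show False using z(2,3) ns by auto
  qed
  moreover have "{a, b} \<notin> E" using clq_cross[OF pP C(1,2,3) aC] E by blast
  ultimately have nF: "{a, b} \<notin> ?F" by simp
  have F: "?F \<subseteq> clq (merge P C D)"
    using C dis E by (intro clq_merge_insert) auto
  have G: "{a, b} \<in> clq (merge P C D)"
    using aC ne by (auto simp: clq_pair merge_def)
  have P1: "part (merge P C D)" using part_merge[OF P C(1,2) HT_join_card[OF H C pos]] .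
  have "{a, b} \<in> legal ?F" by (rule legal_inside[OF P1 F G nF])
  moreover have "HT (merge P C D) (insert {a, b} ?F)"
  proof (rule HT_merge[OF H C(1,2)])
    have "ispath (insert {a, b} ?F) zs" using z(1) unfolding zs_def by (rule ispath_mono) auto
    then have "htr (insert {a, b} ?F) (set zs)"
      by (rule htr_cycle) (auto simp: a_def b_def zs_def insert_commute)
    then show "htr (insert {a, b} ?F) (C \<union> D)" using sz by simp
  qed (use F G in auto)
  ultimately show thesis by (rule that)
qed

lemma settled_0:
  assumes "pos E" "HT P E" "cnt P 1 = 0"
  shows "settled_but P E {}"
proof -
  have P: "part P" using HT_part assms by blast
  have "2 \<le> card C" if "C \<in> P" for C
    using part_card[OF P that] cnt_zeroD[OF part_fin(1)[OF P] that] assms(3) by (cases "card C = 1") auto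
  moreover have "{} \<notin> P" using assms(2) part_ne by (auto simp: HT_def)
  ultimately show ?thesis using assms(2) unfolding settled_but_def HT_def by simp
qed

lemma settled_1:
  assumes E: "pos E" "HT P E" and P: "cnt P 1 = 1" "{u} \<in> P" "D \<in> P" "2 \<le> card D" "card D + 1 < k" and x: "x \<in> D"
  shows "settled_but (merge P {u} D) (insert {u, x} E) (insert u D)"
proof -
  have part: "part P" using HT_part E by blast
  have pP: "partition_on V P" and h: "\<And>C. C \<in> P \<Longrightarrow> htr E C" and Ec: "E \<subseteq> clq P" using E(2) by (auto simp: HT_def)
  have uD: "{u} \<noteq> D" using P(4) by auto
  have un: "u \<notin> D" using part_disjoint[OF pP P(2,3) uD] by auto
  let ?F = "insert {u, x} E"
  have sub: "E \<subseteq> ?F" by auto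
  have big: "2 \<le> card C" if C: "C \<in> P" "C \<noteq> {u}" for C
  proof (rule ccontr)
    assume "\<not> 2 \<le> card C"
    then have "card C = 1" using part_card[OF part C(1)] by simp
    then have "{C, {u}} \<subseteq> {C \<in> P. card C = 1}" using C P(2) by auto
    from card_mono[OF _ this] part_fin(1)[OF part] have "card {C, {u}} \<le> cnt P 1" by (simp add: cnt_def)
    then show False using C(2) P(1) by simp
  qed
  have m: "X \<in> P \<and> X \<noteq> {u}" if "X \<in> merge P {u} D" "X \<noteq> insert u D" for X
    using that by (auto simp: merge_def)
  show ?thesis unfolding settled_but_def
  proof (intro conjI ballI impI)
    show "partition_on V (merge P {u} D)" by (rule partition_merge[OF pP P(2,3)])
    show "?F \<subseteq> clq (merge P {u} D)" using un x Ec by (intro clq_merge_insert) auto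
    show "2 \<le> card C" "htr ?F C" if "C \<in> merge P {u} D" "C \<noteq> insert u D" for C
      using m[OF that] big h htr_mono[OF _ sub] by auto
    show "pendant ?F (insert u D)" unfolding pendant_def
      by (rule exI[of _ u], rule exI[of _ D], rule exI[of _ x]) (use un htr_mono[OF h[OF P(3)] sub] P x in simp)
  qed
qed

text \<open>Mini answers a join by closing a Hamiltonian cycle, unless two isolated vertices were
  joined. Her difficulty is a free move, when all classes are traceable on her turn. She then joins
  two isolated vertices, or hangs the only one on a class with room, which settles the position;
  with no isolated vertex it is settled already.\<close>

lemma mini_HT:
  assumes k: "k \<le> 5"
    and settled: "\<And>P E C0 p. pos E \<Longrightarrow> settled_but P E C0 \<Longrightarrow> mini \<Phi> p E"
    and final: "\<And>P E. pos E \<Longrightarrow> HT P E \<Longrightarrow> \<Phi> E"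
  shows "pos E \<Longrightarrow> HT P E \<Longrightarrow> mini \<Phi> Max_player E \<and> mini \<Phi> Mini_player E"
proof (induction "card (all_edges V - E)" arbitrary: P E rule: less_induct)
  case less
  note E = less.prems
  have P: "part P" using HT_part[OF E] .
  have Ec: "E \<subseteq> clq P" using E by (auto simp: HT_def)
  have IH: "mini \<Phi> Max_player (insert e E) \<and> mini \<Phi> Mini_player (insert e E)"
    if "e \<in> legal E" "HT P' (insert e E)" for e P'
    using less.hyps[OF card_unclaimed_less[OF that(1)] legal_pos[OF E(1) that(1)] that(2)] .
  have max: "mini \<Phi> Max_player E"
  proof (rule mini_opp[OF E(1)])
    show "\<Phi> E" by (rule final[OF E])
    fix p q assume pq: "p \<in> V" "q \<in> V" "p \<noteq> q" "{p, q} \<notin> E" "pos (insert {p, q} E)"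
    have leg: "{p, q} \<in> legal E" using pq by (subst legal_iff[OF E(1)]) (auto simp: pos_def)
    from move_cases[OF P pq(1-3)] show "mini \<Phi> Mini_player (insert {p, q} E)"
    proof cases
      case 1
      then show ?thesis using IH[OF leg HT_inside[OF E(2)]] by blast
    next
      case (2 C D)
      show ?thesis
      proof (cases "card C = 1 \<and> card D = 1")
        case True
        then have "{p} \<in> P" "{q} \<in> P" using 2 by (auto simp: card_1_singleton_iff)
        from IH[OF leg HT_pair[OF E(2) this pq(3)]] show ?thesis by blast
      next
        case False
        from HT_repair[OF E(2) 2 pq(5) False]
        obtain e where e: "e \<in> legal (insert {p, q} E)" "HT (merge P C D) (insert e (insert {p, q} E))" .
        have "mini \<Phi> Max_player (insert e (insert {p, q} E))"
          using less.hyps[OF _ legal_pos[OF pq(5) e(1)] e(2)] card_unclaimed_less[OF e(1)] card_unclaimed_less[OF leg]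
          by simp
        with e(1) show ?thesis by (rule mini_own)
      qed
    qed
  qed
  have min: "mini \<Phi> Mini_player E"
  proof -
    consider "2 \<le> cnt P 1" | "cnt P 1 = 0" | "cnt P 1 = 1" by linarith
    then show ?thesis
    proof cases
      case 1
      obtain C D where "C \<in> P" "D \<in> P" "C \<noteq> D" "card C = 1" "card D = 1" using two_of_size[OF P 1] .
      then obtain p q where pq: "{p} \<in> P" "{q} \<in> P" "p \<noteq> q" by (auto simp: card_1_singleton_iff)
      have leg: "{p, q} \<in> legal E" using legal_merge[OF P Ec pq(1,2)] pq(3) k4 by simp
      show ?thesis using mini_own[OF leg] IH[OF leg HT_pair[OF E(2) pq]] by blast
    next
      case 2
      show ?thesis using settled[OF E(1) settled_0[OF E 2]] .
    next
      case 3
      then obtain U where U: "U \<in> P" "card U = 1" using cnt_pos[OF part_fin(1)[OF P], of 1] by auto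
      then obtain u where u: "{u} \<in> P" by (auto simp: card_1_singleton_iff)
      have only: "C = {u}" if "C \<in> P" "card C = 1" for C
      proof -
        have "C \<notin> {C \<in> P. card C = 1} - {{u}}"
        proof
          assume "C \<in> {C \<in> P. card C = 1} - {{u}}"
          then have "{C, {u}} \<subseteq> {C \<in> P. card C = 1}" "C \<noteq> {u}" using u by auto
          moreover from this have "card {C, {u}} \<le> cnt P 1"
            unfolding cnt_def using part_fin(1)[OF P] by (intro card_mono) auto
          ultimately show False using 3 by simp
        qed
        then show ?thesis using that by blast
      qed
      have join: "mini \<Phi> Mini_player E" if D: "D \<in> P" "2 \<le> card D" "card D + 1 < k" for D
      proof -
        obtain x where x: "x \<in> D" using part_ne[OF partD(1)[OF P] D(1)] by blast
        have "{u} \<noteq> D" using D(2) by auto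
        then have leg: "{u, x} \<in> legal E" using legal_merge[OF P Ec u D(1) _ _ _ x] D(3) by simp
        show ?thesis
          using mini_own[OF leg] settled[OF legal_pos[OF E(1) leg] settled_1[OF E 3 u D x]] by blast
      qed
      show ?thesis
      proof (cases "\<exists>D\<in>P. 2 \<le> card D \<and> card D + 1 < k")
        case True
        then show ?thesis using join by blast
      next
        case False
        show ?thesis
        proof (cases "legal E = {}")
          case True
          then show ?thesis using final[OF E] by (rule forces_end)
        next
          case ne: False
          then obtain e where e: "e \<in> legal E" by blast
          then have "e \<in> all_edges V" "pos (insert e E)" "e \<notin> E"
            using legal_iff[OF E(1)] legal_pos[OF E(1) e] by auto
          then obtain p q where pq: "e = {p, q}" "p \<in> V" "q \<in> V" "p \<noteq> q" by (auto elim!: all_edgesE)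
          from move_cases[OF P pq(2-4)] show ?thesis
          proof cases
            case 1
            then show ?thesis using mini_own[OF e] IH[OF e HT_inside[OF E(2)]] pq(1) by blast
          next
            case (2 C D)
            \<comment> \<open>With no room anywhere, each class is a single vertex or has at least
              \<open>k - 1\<close> vertices, so a legal join would need a second isolated
              vertex.\<close>
            have s: "card C + card D < k" using HT_join_card[OF E(2) 2] \<open>pos (insert e E)\<close> pq(1) by simp
            have big: "card X = 1 \<or> k \<le> card X + 1" if "X \<in> P" for X
              using False part_card[OF P that] that by force
            have "card C = 1" "card D = 1" using big[OF 2(1)] big[OF 2(2)] s part_card[OF P 2(1)] part_card[OF P 2(2)] by linarith+
            then show ?thesis using only[OF 2(1)] only[OF 2(2)] 2(3) by simp
          qed
        qed
      qed
    qed
  qed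
  show ?case using max min by blast
qed

section \<open>Degree bounds for the final graph, and settled positions for
  \<open>k = 4\<close>\<close>

lemma deg_part:
  assumes "partition_on V P" "E \<subseteq> clq P" "C \<in> P" "v \<in> C"
  shows "nbh E v \<subseteq> C - {v}" "deg E v \<le> card C - 1"
proof -
  show sub: "nbh E v \<subseteq> C - {v}"
  proof
    fix y assume "y \<in> nbh E v"
    then have e: "{v, y} \<in> E" by (simp add: nbh_def)
    have "y \<in> C" by (rule clq_edgeE[OF assms(1,2) e assms(4,3)])
    moreover have "y \<noteq> v" using e assms(2) clq_pair[of v y P] by blast
    ultimately show "y \<in> C - {v}" by simp
  qed
  have "finite C" using part_sub[OF assms(1,3)] finite_subset by blast
  then show "deg E v \<le> card C - 1"
    using card_mono[OF _ sub] assms(4) by (simp add: deg_def)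
qed

text \<open>Components on \<open>k - 1\<close> vertices give degree at most \<open>k - 2\<close>.
  For \<open>k = 5\<close> one component on five vertices can arise, and one vertex \<open>w\<close>
  of it may have degree four.\<close>

definition capped :: "nat set set \<Rightarrow> bool" where
  "capped E \<longleftrightarrow> (\<exists>w. \<forall>v. deg E v \<le> k - 2 + of_bool (k = 5 \<and> v = w))"

lemma capped_part:
  assumes "pos E" "partition_on V P" "E \<subseteq> clq P" "\<And>C. C \<in> P \<Longrightarrow> card C < k"
  shows "capped E"
proof -
  have "deg E v \<le> k - 2" for v
  proof (cases "v \<in> V")
    case True
    then obtain C where C: "C \<in> P" "v \<in> C" using part_ex[OF assms(2)] by blast
    then show ?thesis using deg_part(2)[OF assms(2,3) C] assms(4)[OF C(1)] by linarith
  qed (simp add: deg_outside[OF assms(1)])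
  then show ?thesis unfolding capped_def by (intro exI[of _ 0] allI trans_le_add1)
qed

lemma score_capped:
  assumes "capped E"
  shows "score l E \<le> n * ((k - 2) choose (l - 1)) + (if k = 5 then 4 choose (l - 1) else 0)"
proof -
  obtain w where w: "\<And>v. deg E v \<le> k - 2 + of_bool (k = 5 \<and> v = w)" using assms by (auto simp: capped_def)
  have "score l E \<le> (\<Sum>v\<in>V. ((k - 2) choose (l - 1)) + (if v = w then if k = 5 then 4 choose (l - 1) else 0 else 0))"
    unfolding score_def
  proof (rule sum_mono)
    fix v
    show "deg E v choose (l - 1) \<le> ((k - 2) choose (l - 1)) + (if v = w then if k = 5 then 4 choose (l - 1) else 0 else 0)"
    proof (cases "k = 5 \<and> v = w")
      case True
      then have "deg E v \<le> 4" using w[of v] by simp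
      from binomial_right_mono[OF this, of "l - 1"] True show ?thesis by simp
    next
      case False
      then have "of_bool (k = 5 \<and> v = w) = (0 :: nat)" by simp
      then have "deg E v \<le> k - 2" using w[of v] by linarith
      from binomial_right_mono[OF this, of "l - 1"] show ?thesis by simp
    qed
  qed
  also have "\<dots> \<le> n * ((k - 2) choose (l - 1)) + (if k = 5 then 4 choose (l - 1) else 0)"
    by (simp add: sum.distrib)
  finally show ?thesis .
qed

lemma settled_neighbour:
  assumes "settled_but P E C0" "v \<in> V"
  obtains y where "{v, y} \<in> E"
proof -
  note S = settled_butD[OF assms(1)]
  obtain C where C: "C \<in> P" "v \<in> C" using part_ex[OF S(1) assms(2)] by blast
  show thesis
  proof (cases "C = C0")
    case False
    show ?thesis by (rule htr_neighbour[OF S(4)[OF C(1) False] S(3)[OF C(1) False] C(2) that])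
  next
    case True
    then obtain u D x where D: "C0 = insert u D" "htr E D" "2 \<le> card D" "x \<in> D" "{u, x} \<in> E"
      using S(5) C(1) pendantE by metis
    show ?thesis
    proof (cases "v = u")
      case True then show ?thesis using D(5) that by simp
    next
      case False
      then have "v \<in> D" using C(2) \<open>C = C0\<close> D(1) by simp
      then show ?thesis by (rule htr_neighbour[OF D(2,3) _ that])
    qed
  qed
qed

text \<open>Every vertex has a neighbour inside its class, so a join of two classes would create the
  path \<open>p' p q q'\<close>. The partition can no longer change.\<close>

lemma mini_settled_4:
  assumes k: "k = 4" and E: "pos E" "settled_but P E C0"
  shows "mini capped p E"
proof (rule forces_invariant[where I = "\<lambda>F. pos F \<and> E \<subseteq> F \<and> F \<subseteq> clq P"])
  note S = settled_butD[OF E(2)]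
  note pP = S(1)
  show "pos E \<and> E \<subseteq> E \<and> E \<subseteq> clq P" using E(1) S(2) by simp
  have small: "card C < k" if C: "C \<in> P" for C
  proof (cases "C = C0")
    case False
    then show ?thesis using S(4)[OF C] htr_card[OF E(1)] part_ne[OF pP C] by blast
  next
    case True
    then obtain u D where "C = insert u D" "card D + 1 < k" "u \<notin> D" using S(5) C pendantE by metis
    then show ?thesis by (cases "finite D") auto
  qed
  show "capped F" if "pos F \<and> E \<subseteq> F \<and> F \<subseteq> clq P" "legal F = {}" for F
    using capped_part[OF _ pP _ small] that by blast
  fix F e assume F: "pos F \<and> E \<subseteq> F \<and> F \<subseteq> clq P" and e: "e \<in> legal F"
  have posF: "pos F" using F by blast
  have G: "pos (insert e F)" by (rule legal_pos[OF posF e])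
  have "e \<in> all_edges V" using e legal_iff[OF posF] by blast
  then obtain p q where pq: "e = {p, q}" "p \<in> V" "q \<in> V" "p \<noteq> q" by (rule all_edgesE)
  have part: "part P" using pP small by (simp add: part_def)
  have "e \<in> clq P"
  proof (rule move_cases[OF part pq(2-4)])
    show "e \<in> clq P" if "{p, q} \<in> clq P" using that pq by simp
    fix C D assume C: "C \<in> P" "D \<in> P" "C \<noteq> D" "p \<in> C" "q \<in> D"
    obtain p' q' where e': "{p, p'} \<in> E" "{q, q'} \<in> E"
      using settled_neighbour[OF E(2) pq(2)] settled_neighbour[OF E(2) pq(3)] by metis
    have Ec: "E \<subseteq> clq P" using F by blast
    have in': "p' \<in> C - {p}" "q' \<in> D - {q}"
      using deg_part(1)[OF pP Ec C(1,4)] deg_part(1)[OF pP Ec C(2,5)] e' by (auto simp: nbh_def)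
    have "ispath (insert e F) [p', p, q, q']"
      using e' F in' C part_disjoint[OF pP C(1,2,3)] pq(1)
      by (auto simp: ispath_Cons insert_commute)
    from pfreeD[OF posD(2)[OF G] this] k show "e \<in> clq P" by simp
  qed
  then show "pos (insert e F) \<and> E \<subseteq> insert e F \<and> insert e F \<subseteq> clq P" using F G by auto
qed


section \<open>Settled positions for \<open>k = 5\<close>\<close>

definition reach3 :: "nat set set \<Rightarrow> nat set \<Rightarrow> bool" where
  "reach3 E C \<longleftrightarrow> (\<forall>x\<in>C. \<exists>y z. ispath E [x, y, z])"

text \<open>A class with \<open>reach3\<close> cannot take part in a join. What can still be joined
  are single edges and possibly \<open>C0\<close>, when it has three vertices; joined to an edge, it
  becomes the only class on five vertices, and that class has \<open>reach3\<close>.\<close>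

definition frozen :: "nat set set \<Rightarrow> nat set set \<Rightarrow> nat set \<Rightarrow> bool" where
  "frozen P E C0 \<longleftrightarrow> partition_on V P \<and> E \<subseteq> clq P \<and> pos E \<and> (\<forall>v\<in>V. nbh E v \<noteq> {}) \<and>
     (\<forall>C\<in>P. C \<noteq> C0 \<longrightarrow> card C \<le> 4 \<and> (card C = 2 \<or> reach3 E C)) \<and>
     (C0 \<in> P \<longrightarrow> card C0 = 3 \<or> card C0 \<le> 5 \<and> reach3 E C0)"

lemma reach3_mono: "reach3 E C \<Longrightarrow> E \<subseteq> E' \<Longrightarrow> reach3 E' C"
  unfolding reach3_def by (meson ispath_mono)

lemma reach3I: "(\<And>x. x \<in> C \<Longrightarrow> \<exists>y z. ispath E [x, y, z]) \<Longrightarrow> reach3 E C"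
  by (simp add: reach3_def)

lemma nbh_mono: "E \<subseteq> E' \<Longrightarrow> nbh E v \<subseteq> nbh E' v"
  by (auto simp: nbh_def)

lemma frozenD:
  assumes "frozen P E C0"
  shows "partition_on V P" "E \<subseteq> clq P" "pos E" "v \<in> V \<Longrightarrow> nbh E v \<noteq> {}"
    "C \<in> P \<Longrightarrow> C \<noteq> C0 \<Longrightarrow> card C \<le> 4" "C \<in> P \<Longrightarrow> C \<noteq> C0 \<Longrightarrow> card C = 2 \<or> reach3 E C"
    "C0 \<in> P \<Longrightarrow> card C0 = 3 \<or> card C0 \<le> 5 \<and> reach3 E C0"
  using assms unfolding frozen_def by simp_all

lemma frozen_nbh:
  assumes "frozen P E C0" "C \<in> P" "p \<in> C"
  obtains p' where "p' \<in> C" "p' \<noteq> p" "{p, p'} \<in> E"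
proof -
  note F = frozenD[OF assms(1)]
  have "p \<in> V" using part_sub[OF F(1) assms(2)] assms(3) by blast
  then obtain p' where "p' \<in> nbh E p" using F(4) by blast
  then show thesis using that deg_part(1)[OF F(1,2) assms(2,3)] by (auto simp: nbh_def)
qed

lemma frozen_inside:
  assumes F: "frozen P E C0" and e: "e \<in> clq P" "pos (insert e E)"
  shows "frozen P (insert e E) C0"
proof -
  note D = frozenD[OF F]
  have sub: "E \<subseteq> insert e E" by auto
  show ?thesis unfolding frozen_def
  proof (intro conjI ballI impI)
    show "nbh (insert e E) v \<noteq> {}" if "v \<in> V" for v using D(4)[OF that] nbh_mono[OF sub] by blast
    show "card C \<le> 4" "card C = 2 \<or> reach3 (insert e E) C" if "C \<in> P" "C \<noteq> C0" for C
      using D(5,6)[OF that] reach3_mono[OF _ sub] by auto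
    show "card C0 = 3 \<or> card C0 \<le> 5 \<and> reach3 (insert e E) C0" if "C0 \<in> P"
      using D(7)[OF that] reach3_mono[OF _ sub] by auto
  qed (use D e in auto)
qed

lemma frozen_merge:
  assumes F: "frozen P E C0" and C: "C \<in> P" "D \<in> P" and pos: "pos (insert {p, q} E)"
    and sub': "insert {p, q} E \<subseteq> clq (merge P C D)" and C1: "C0 \<in> P \<Longrightarrow> C0 \<notin> {C, D} \<Longrightarrow> C1 = C0"
    and new: "reach3 (insert {p, q} E) (C \<union> D)" "card (C \<union> D) \<le> 5" "C \<union> D \<noteq> C1 \<Longrightarrow> card (C \<union> D) \<le> 4"
    and sz: "C1 = C0 \<or> C1 = C \<union> D"
  shows "frozen (merge P C D) (insert {p, q} E) C1"
proof -
  note D = frozenD[OF F]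
  let ?G = "insert {p, q} E"
  have sub: "E \<subseteq> ?G" by auto
  have m: "X = C \<union> D \<or> X \<in> P \<and> X \<notin> {C, D}" if "X \<in> merge P C D" for X
    using that by (auto simp: merge_def)
  show ?thesis unfolding frozen_def
  proof (intro conjI ballI impI)
    show "partition_on V (merge P C D)" by (rule partition_merge[OF D(1) C])
    show "nbh ?G v \<noteq> {}" if "v \<in> V" for v using D(4)[OF that] nbh_mono[OF sub] by blast
    show "card X \<le> 4" if X: "X \<in> merge P C D" "X \<noteq> C1" for X
    proof (cases "X = C \<union> D")
      case False
      then have "X \<in> P" "X \<noteq> C0" using m[OF X(1)] C1 X(2) by auto
      then show ?thesis by (rule D(5))
    qed (use new X in auto)
    show "card X = 2 \<or> reach3 ?G X" if X: "X \<in> merge P C D" "X \<noteq> C1" for X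
    proof (cases "X = C \<union> D")
      case False
      then have "X \<in> P" "X \<noteq> C0" using m[OF X(1)] C1 X(2) by auto
      from D(6)[OF this] reach3_mono[OF _ sub] show ?thesis by blast
    qed (use new X in auto)
    show "card C1 = 3 \<or> card C1 \<le> 5 \<and> reach3 ?G C1" if "C1 \<in> merge P C D"
    proof (cases "C1 = C \<union> D")
      case False
      then have "C0 \<in> P" "C1 = C0" using m[OF that] sz by auto
      from D(7)[OF this(1)] this(2) reach3_mono[OF _ sub] show ?thesis by blast
    qed (use new in auto)
  qed (use pos sub' in auto)
qed

text \<open>Together with a neighbour \<open>q'\<close> of \<open>q\<close> this would give the path
  \<open>z y p q q'\<close> on five vertices.\<close>

lemma frozen_join_no_path:
  assumes k: "k = 5" and F: "frozen P E C0" and C: "C \<in> P" "D \<in> P" "C \<noteq> D" "p \<in> C" "q \<in> D"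
    and pos: "pos (insert {p, q} E)"
  shows "\<not> ispath E [p, y, z]"
proof
  assume path: "ispath E [p, y, z]"
  note D = frozenD[OF F]
  obtain q' where q': "q' \<in> D" "q' \<noteq> q" "{q, q'} \<in> E" using frozen_nbh[OF F C(2,5)] .
  have s: "set [p, y, z] \<subseteq> C" by (rule ispath_part[OF D(1,2) path C(4,1)])
  have sub: "E \<subseteq> insert {p, q} E" by auto
  have "ispath E [q, q']" using q' by (auto simp: ispath_Cons)
  then have "ispath (insert {p, q} E) (rev [p, y, z] @ [q, q'])"
    unfolding ispath_append[of _ "rev [p, y, z]"] ispath_rev
    using ispath_mono[OF path sub] ispath_mono[OF _ sub] s q' C part_disjoint[OF D(1) C(1,2,3)] by auto
  from pfreeD[OF posD(2)[OF pos] this] k show False by simp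
qed

text \<open>\<open>D\<close> must be a single edge. Either \<open>C\<close> is one as well, giving
  four vertices, or \<open>C = C0\<close> is a path on three vertices with centre \<open>p\<close>,
  giving five. In both cases every vertex of the new class starts a path on three vertices.\<close>

lemma frozen_join:
  assumes k: "k = 5" and F: "frozen P E C0" and C: "C \<in> P" "D \<in> P" "C \<noteq> D" "p \<in> C" "q \<in> D"
    and pos: "pos (insert {p, q} E)" and D0: "D \<noteq> C0"
  shows "\<exists>C1. frozen (merge P C D) (insert {p, q} E) C1"
proof -
  note D = frozenD[OF F]
  let ?G = "insert {p, q} E"
  have np: "\<And>y z. \<not> ispath E [p, y, z]" by (rule frozen_join_no_path[OF k F C pos])
  have "pos (insert {q, p} E)" using pos by (simp add: insert_commute)
  then have nq: "\<And>y z. \<not> ispath E [q, y, z]" by (rule frozen_join_no_path[OF k F C(2,1) C(3)[symmetric] C(5,4)])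
  have nC: "\<not> reach3 E C" "\<not> reach3 E D" using np nq C(4,5) by (auto simp: reach3_def)
  have dis: "C \<inter> D = {}" by (rule part_disjoint[OF D(1) C(1,2,3)])
  have pq: "p \<noteq> q" using dis C by auto
  have sub: "E \<subseteq> ?G" by auto
  have G: "?G \<subseteq> clq (merge P C D)" by (rule clq_merge_insert[OF C(4,5) pq D(2)])
  obtain q' where q': "q' \<in> D" "q' \<noteq> q" "{q, q'} \<in> E" using frozen_nbh[OF F C(2,5)] .
  obtain p' where p': "p' \<in> C" "p' \<noteq> p" "{p, p'} \<in> E" using frozen_nbh[OF F C(1,4)] .
  have cD: "card D = 2" using D(6)[OF C(2) D0] nC by blast
  then have Deq: "D = {q, q'}" using q' C(5) by (auto simp: card_2_iff doubleton_eq_iff)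
  have new: "p \<notin> D" "p' \<notin> D" "q \<notin> C" "q' \<notin> C" using dis C p' q' by auto
  have pqG: "{p, q} \<in> ?G" "{q, p} \<in> ?G" "{p, p'} \<in> ?G" "{p', p} \<in> ?G" "{q, q'} \<in> ?G" "{q', q} \<in> ?G"
    using p'(3) q'(3) by (simp_all add: insert_commute)
  have paths: "ispath ?G [p, q, q']" "ispath ?G [q, p, p']" "ispath ?G [q', q, p]" "ispath ?G [p', p, q]"
    using pqG new p' q' pq C by (auto simp: ispath_Cons)
  have finCD: "finite C" "finite D" using part_sub[OF D(1)] C finite_subset by blast+
  show ?thesis
  proof (cases "C = C0")
    case False
    then have "card C = 2" using D(6)[OF C(1)] nC by blast
    then have Ceq: "C = {p, p'}" using p' C(4) by (auto simp: card_2_iff doubleton_eq_iff)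
    have r: "reach3 ?G (C \<union> D)"
    proof (rule reach3I)
      fix x assume "x \<in> C \<union> D"
      then consider "x = p" | "x = p'" | "x = q" | "x = q'" using Ceq Deq by blast
      then show "\<exists>y z. ispath ?G [x, y, z]" using paths by cases blast+
    qed
    have c4: "card (C \<union> D) = 4" using \<open>card C = 2\<close> cD dis finCD by (simp add: card_Un_disjoint)
    show ?thesis
      by (rule exI, rule frozen_merge[OF F C(1,2) pos G, of C0]) (use r c4 in auto)
  next
    case True
    then have c3: "card C = 3" using D(7) C(1) nC by blast
    have "card (C - {p, p'}) = 1" using c3 p' C(4) finCD by (simp add: card_Diff_subset)
    then obtain y where "C - {p, p'} = {y}" by (auto simp: card_1_singleton_iff)
    then have y: "C = {p, p', y}" "y \<noteq> p" "y \<noteq> p'" using p' C(4) by auto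
    obtain z where z: "z \<in> C" "z \<noteq> y" "{y, z} \<in> E" using frozen_nbh[OF F C(1), of y] y by blast
    \<comment> \<open>The third vertex \<open>y\<close> cannot hang on \<open>p'\<close>, as
      \<open>p p' y\<close> would be a path from \<open>p\<close>; so \<open>p\<close> is the
      centre.\<close>
    have "z \<noteq> p'"
    proof
      assume "z = p'"
      then have "ispath E [p, p', y]" using p' y z by (auto simp: ispath_Cons insert_commute)
      then show False using np by blast
    qed
    then have "z = p" using z y by auto
    then have "ispath ?G [y, p, p']" using z y p' by (auto simp: ispath_Cons)
    have r: "reach3 ?G (C \<union> D)"
    proof (rule reach3I)
      fix x assume "x \<in> C \<union> D"
      then consider "x = p" | "x = p'" | "x = q" | "x = q'" | "x = y" using y(1) Deq by blast
      then show "\<exists>y z. ispath ?G [x, y, z]" using paths \<open>ispath ?G [y, p, p']\<close> by cases blast+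
    qed
    have c5: "card (C \<union> D) = 5" using c3 cD dis finCD by (simp add: card_Un_disjoint)
    show ?thesis
      by (rule exI, rule frozen_merge[OF F C(1,2) pos G, of "C \<union> D"]) (use r c5 True in auto)
  qed
qed

text \<open>Two vertices \<open>v\<close> and \<open>w\<close> of degree four lie in the same class
  on five vertices and are adjacent to all of it, so \<open>a v b w c\<close> would be a path on
  five vertices.\<close>

lemma frozen_capped:
  assumes k: "k = 5" and F: "frozen P E C0"
  shows "capped E"
proof -
  note D = frozenD[OF F]
  have one: "v = w" if vw: "3 < deg E v" "3 < deg E w" for v w
  proof (rule ccontr)
    assume ne: "v \<noteq> w"
    have in0: "x \<in> C0 \<and> C0 \<in> P" if x: "3 < deg E x" for x
    proof -
      have "x \<in> V" using deg_outside[OF D(3), of x] x by (cases "x \<in> V") auto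
      then obtain C where C: "C \<in> P" "x \<in> C" using part_ex[OF D(1)] by blast
      have "C = C0"
        using D(5)[OF C(1)] deg_part(2)[OF D(1,2) C] x by (cases "C = C0") auto
      then show ?thesis using C by simp
    qed
    have C0: "C0 \<in> P" "v \<in> C0" "w \<in> C0" using in0 vw by auto
    have fin: "finite C0" using part_sub[OF D(1) C0(1)] finite_subset by blast
    have c5: "card C0 \<le> 5" using D(7)[OF C0(1)] by auto
    have full: "nbh E x = C0 - {x}" if x: "x \<in> C0" "3 < deg E x" for x
    proof (rule card_subset_eq)
      show "nbh E x \<subseteq> C0 - {x}" by (rule deg_part(1)[OF D(1,2) C0(1) x(1)])
      from card_mono[OF _ this] show "card (nbh E x) = card (C0 - {x})"
        using x c5 fin by (simp add: deg_def)
    qed (use fin in simp)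
    have "card C0 = 5" using deg_part(2)[OF D(1,2) C0(1,2)] vw(1) c5 by simp
    then have "card (C0 - {v, w}) = 3" using C0 ne fin by (simp add: card_Diff_subset)
    then obtain a b c where abc: "C0 - {v, w} = {a, b, c}" "a \<noteq> b" "a \<noteq> c" "b \<noteq> c"
      by (auto simp: card_3_iff)
    then have x: "a \<noteq> v" "a \<noteq> w" "b \<noteq> v" "b \<noteq> w" "c \<noteq> v" "c \<noteq> w" "a \<in> C0" "b \<in> C0" "c \<in> C0" by auto
    have "a \<in> nbh E v" "b \<in> nbh E v" "b \<in> nbh E w" "c \<in> nbh E w"
      using full[OF C0(2) vw(1)] full[OF C0(3) vw(2)] x by auto
    then have "{v, a} \<in> E" "{v, b} \<in> E" "{w, b} \<in> E" "{w, c} \<in> E" by (simp_all add: nbh_def)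
    then have "ispath E [a, v, b, w, c]"
      using x abc ne by (auto simp: ispath_Cons insert_commute)
    from pfreeD[OF posD(2)[OF D(3)] this] k show False by simp
  qed
  have le4: "deg E v \<le> 4" for v
  proof (cases "v \<in> V")
    case True
    then obtain C where C: "C \<in> P" "v \<in> C" using part_ex[OF D(1)] by blast
    have "card C \<le> 5" using D(5)[OF C(1)] D(7) C(1) by (cases "C = C0") auto
    then show ?thesis using deg_part(2)[OF D(1,2) C] by linarith
  qed (simp add: deg_outside[OF D(3)])
  \<comment> \<open>If no degree exceeds three, \<open>w\<close> is arbitrary and the bound holds
    without the exception.\<close>
  define w where "w = (SOME w. 3 < deg E w)"
  have "deg E v \<le> k - 2 + of_bool (k = 5 \<and> v = w)" for v
  proof (cases "3 < deg E v")
    case True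
    then have "3 < deg E w" unfolding w_def by (rule someI)
    then have "v = w" using one True by blast
    then show ?thesis using le4[of v] k by simp
  qed (use k in simp)
  then show ?thesis unfolding capped_def by blast
qed

lemma frozen_settled:
  assumes k: "k = 5" and E: "pos E" "settled_but P E C0"
  shows "frozen P E C0"
proof -
  note S = settled_butD[OF E(2)]
  show ?thesis unfolding frozen_def
  proof (intro conjI ballI impI)
    show "nbh E v \<noteq> {}" if v: "v \<in> V" for v
    proof -
      obtain y where "{v, y} \<in> E" using settled_neighbour[OF E(2) v] .
      then have "y \<in> nbh E v" by (simp add: nbh_def)
      then show ?thesis by blast
    qed
    show "card C \<le> 4" if "C \<in> P" "C \<noteq> C0" for C
      using htr_card[OF E(1) S(4)[OF that] part_ne[OF S(1) that(1)]] k by simp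
    show "card C = 2 \<or> reach3 E C" if C: "C \<in> P" "C \<noteq> C0" for C
    proof (cases "card C = 2")
      case False
      then have "3 \<le> card C" using S(3)[OF C] by simp
      then have "reach3 E C" using htr_path3[OF S(4)[OF C]] by (intro reach3I) metis
      then show ?thesis ..
    qed simp
    show "card C0 = 3 \<or> card C0 \<le> 5 \<and> reach3 E C0" if in0: "C0 \<in> P"
    proof -
      obtain u D x where D: "C0 = insert u D" "u \<notin> D" "htr E D" "2 \<le> card D" "card D + 1 < k" "x \<in> D" "{u, x} \<in> E"
        using pendantE[OF S(5)[OF in0]] .
      have "finite D" using D(4) by (metis card.infinite not_numeral_le_zero)
      then have c: "card C0 = card D + 1" using D(1,2) by simp
      show ?thesis
      proof (cases "card D = 2")
        case False
        then have D3: "3 \<le> card D" using D(4) by simp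
        have "reach3 E C0"
        proof (rule reach3I)
          fix v assume "v \<in> C0"
          then consider "v \<in> D" | "v = u" using D(1) by blast
          then show "\<exists>y z. ispath E [v, y, z]"
          proof cases
            case 1
            show ?thesis using htr_path3[OF D(3) D3 1] by metis
          next
            case 2
            obtain y z where y: "ispath E [x, y, z]" "set [x, y, z] \<subseteq> D" using htr_path3[OF D(3) D3 D(6)] .
            then have "ispath E [u, x, y]" using D(2,7) by (auto simp: ispath_Cons)
            then show ?thesis using 2 by blast
          qed
        qed
        then show ?thesis using c D(5) k by simp
      qed (use c in simp)
    qed
  qed (use S E in auto)
qed

lemma mini_settled_5:
  assumes k: "k = 5" and E: "pos E" "settled_but P E C0"
  shows "mini capped p E"
proof (rule forces_invariant[where I = "\<lambda>F. \<exists>P C0. frozen P F C0"])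
  show "\<exists>P C0. frozen P E C0" using frozen_settled[OF assms] by blast
  show "capped F" if "\<exists>P C0. frozen P F C0" for F using frozen_capped[OF k] that by blast
  fix F e assume "\<exists>P C0. frozen P F C0" and e: "e \<in> legal F"
  then obtain P C0 where F: "frozen P F C0" by blast
  note D = frozenD[OF F]
  have G: "pos (insert e F)" by (rule legal_pos[OF D(3) e])
  have "e \<in> all_edges V" using e legal_iff[OF D(3)] by blast
  then obtain p q where pq: "e = {p, q}" "p \<in> V" "q \<in> V" "p \<noteq> q" by (rule all_edgesE)
  obtain C where C: "C \<in> P" "p \<in> C" using part_ex[OF D(1) pq(2)] by blast
  obtain X where X: "X \<in> P" "q \<in> X" using part_ex[OF D(1) pq(3)] by blast
  show "\<exists>P C0. frozen P (insert e F) C0"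
  proof (cases "C = X")
    case True
    then have "e \<in> clq P" using C X pq by (auto simp: clq_pair)
    then show ?thesis using frozen_inside[OF F _ G] by blast
  next
    case ne: False
    show ?thesis
    proof (cases "X = C0")
      case False
      then show ?thesis using frozen_join[OF k F C(1) X(1) ne C(2) X(2)] G pq(1) by auto
    next
      case True
      have eq: "insert e F = insert {q, p} F" using pq(1) by (simp add: insert_commute)
      have "C \<noteq> C0" using True ne by simp
      from frozen_join[OF k F X(1) C(1) ne[symmetric] X(2) C(2) G[unfolded eq] this]
      show ?thesis unfolding eq by blast
    qed
  qed
qed

lemma HT_capped: "pos E \<Longrightarrow> HT P E \<Longrightarrow> capped E"
proof -
  assume E: "pos E" "HT P E"
  have P: "part P" using HT_part[OF E] .
  show ?thesis by (rule capped_part[OF E(1) partD(1)[OF P] _ partD(2)[OF P]]) (use E in \<open>auto simp: HT_def\<close>)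
qed

lemma sat_score_capped:
  assumes k: "k \<in> {4, 5}" and l: "3 \<le> l"
  shows "sat_score first n (star_graph l) (path_graph k)
    \<le> n * ((k - 2) choose (l - 1)) + (if k = 5 then 4 choose (l - 1) else 0)"
proof (rule mini_sat_score[OF l, of capped])
  have H: "HT (singletons V) {}"
    using partition_singletons htr_singleton by (auto simp: HT_def singletons_def)
  have "mini capped Max_player {} \<and> mini capped Mini_player {}"
  proof (rule mini_HT[OF _ _ HT_capped pos_empty H])
    show "mini capped p E" if "pos E" "settled_but P E C0" for P E C0 p
      using mini_settled_4[OF _ that] mini_settled_5[OF _ that] k by auto
  qed (use k in auto)
  then show "mini capped first {}" by (cases first) auto
qed (rule score_capped)

end

text \<open>The strategies of Max and Mini fix the score up to an additive constant, which is
  \<open>o(n)\<close>.\<close>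

lemma sat_score_asymptotics:
  assumes kl: "k \<in> {4, 5}" "l \<in> {3, 4}" "l < k" and w: "(k - 2) choose (l - 1) = w"
  shows "\<exists>g \<in> o(\<lambda>n. real n). \<forall>n.
    real (sat_score first n (star_graph l) (path_graph k)) = real w * real n - g n"
proof (intro bexI allI)
  let ?s = "\<lambda>n. sat_score first n (star_graph l) (path_graph k)"
  let ?g = "\<lambda>n. real w * real n - real (?s n)"
  show "real (?s n) = real w * real n - ?g n" for n by simp
  have "\<bar>?g n\<bar> \<le> 1000" for n
  proof -
    interpret path_game k n by unfold_locales (use kl in auto)
    have "3 \<le> l" using kl by auto
    have "4 choose (l - 1) \<le> (1000 :: nat)" using kl(2) by (auto simp: choose_two eval_nat_numeral)
    then have "?s n \<le> n * w + 1000"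
      using sat_score_capped[OF kl(1) \<open>3 \<le> l\<close>, of first] unfolding w by (simp split: if_splits)
    moreover have "w * n \<le> ?s n + 1000" using sat_score_near[OF kl, of first] unfolding w .
    ultimately have "real (?s n) \<le> real (n * w + 1000)" "real (w * n) \<le> real (?s n + 1000)"
      by (simp_all only: of_nat_le_iff)
    then show ?thesis by (simp add: mult.commute abs_le_iff)
  qed
  then have "?g \<in> O(\<lambda>n. 1)" by (intro bigoI[of _ 1000]) simp
  also have "(\<lambda>n. 1) \<in> o(\<lambda>n. real n)"
    by (rule smalloI_tendsto[OF lim_1_over_n]) (simp add: eventually_gt_at_top)
  finally show "?g \<in> o(\<lambda>n. real n)" .
qed


theorem theorem1p1:
  fixes first :: player
  shows
    "(\<forall>k\<ge>7. \<forall>l\<ge>3.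
        (\<lambda>n. real (sat_score first n (star_graph l) (path_graph k))) \<in> \<Theta>(\<lambda>n. real n ^ (l - 1))) \<and>
     ((\<exists>g \<in> o(\<lambda>n. real n). \<forall>n.
         real (sat_score first n (star_graph 3) (path_graph 4)) = real n - g n) \<and>
      (\<forall>l\<ge>4. \<forall>n. sat_score first n (star_graph l) (path_graph 4) = 0)) \<and>
     ((\<exists>g \<in> o(\<lambda>n. real n). \<forall>n.
         real (sat_score first n (star_graph 3) (path_graph 5)) = 3 * real n - g n) \<and>
      (\<exists>g \<in> o(\<lambda>n. real n). \<forall>n.
         real (sat_score first n (star_graph 4) (path_graph 5)) = real n - g n) \<and>
      (\<forall>n. sat_score first n (star_graph 5) (path_graph 5) \<le> 1) \<and>
      (\<forall>l\<ge>6. \<forall>n. sat_score first n (star_graph l) (path_graph 5) = 0))"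
proof (intro conjI allI impI)
  show "(\<lambda>n. real (sat_score first n (star_graph l) (path_graph k))) \<in> \<Theta>(\<lambda>n. real n ^ (l - 1))"
    if "7 \<le> k" "3 \<le> l" for k l
    by (rule sat_score_bigtheta[OF that])
  show "\<exists>g \<in> o(\<lambda>n. real n). \<forall>n. real (sat_score first n (star_graph 3) (path_graph 4)) = real n - g n"
    using sat_score_asymptotics[of 4 3 1 first] by (simp add: choose_two)
  show "\<exists>g \<in> o(\<lambda>n. real n). \<forall>n. real (sat_score first n (star_graph 3) (path_graph 5)) = 3 * real n - g n"
    using sat_score_asymptotics[of 5 3 3 first] by (simp add: choose_two)
  show "\<exists>g \<in> o(\<lambda>n. real n). \<forall>n. real (sat_score first n (star_graph 4) (path_graph 5)) = real n - g n"
    using sat_score_asymptotics[of 5 4 1 first] by simp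
  show "sat_score first n (star_graph l) (path_graph 4) = 0" if "4 \<le> l" for l n
  proof -
    interpret path_game 4 n by unfold_locales simp
    show ?thesis using sat_score_capped[of l first] that by (simp add: binomial_eq_0)
  qed
  show "sat_score first n (star_graph 5) (path_graph 5) \<le> 1" for n
  proof -
    interpret path_game 5 n by unfold_locales simp
    \<comment> \<open>As \<open>3 choose 4 = 0\<close>, only the exceptional vertex contributes,
      namely \<open>4 choose 4 = 1\<close>.\<close>
    show ?thesis using sat_score_capped[of 5 first] by (simp add: binomial_eq_0)
  qed
  show "sat_score first n (star_graph l) (path_graph 5) = 0" if "6 \<le> l" for l n
  proof -
    interpret path_game 5 n by unfold_locales simp
    show ?thesis using sat_score_capped[of l first] that by (simp add: binomial_eq_0)
  qed
qed

end
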